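(* Let $T>0$, let $Q$ be the law of the diffusion $dX_t=\mu_t\,dt+\sigma_t\,dW_t$, $0\le t\le T$, and let $h=h\left((X_t)_{0\le t\le T}\right)$ be a real-valued measurable function of the path. Let $\mathcal U$ be a class of adapted $m$-dimensional processes $u=(u_t)_{0\le t\le T}$ and, for $u\in\mathcal U$, let $P^u$ be the proposal measure under which $dX_t=\mu_t\,dt+\sigma_t(u_t\,dt+dW_t)$ (precise definitions in the context). Suppose that 1. $\mathcal U$ is uniformly bounded in the $L^\infty$ norm: there is a constant $C$ such that for all $u\in\mathcal U$, $$\|u\|_\infty=\inf\left\{A\ge 0: |u_t|<A\text{ for all }t,\ P^u\text{-almost surely}\right\}<C;$$ 2. there is an $r>1$ such that $h\in L^r(Q)$. Then flat-AMIS with proposals from the class $\mathcal P=\{P^u\mid u\in\mathcal U\}$ is consistent, i.e. the flat-AMIS estimators $$\hat\psi_k=\frac{1}{\sum_{l=1}^k N_l}\sum_{l=1}^k\sum_{n=1}^{N_l} h(X_n^l)\,\tfrac{dQ}{dP_l}(X_n^l),\qquad P_l\in\mathcal P,$$ satisfy $\hat\psi_k\to\psi=\mathbb E_Q[h(X)]$ almost surely when $\sum_{l\le k}N_l\to\infty$.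
   Context: Diffusion setting: on a filtered probability space with probability measure $Q$, $W^Q$ is an $m$-dimensional $Q$-Brownian motion on $[0,T]$, $(\mu_t)$ and $(\sigma_t)$ are adapted processes of dimensions $d$ and $d\times m$, and $X$ is the $d$-dimensional Itô process $dX_t=\mu_t\,dt+\sigma_t\,dW^Q_t$. For an adapted $m$-dimensional process $u$, $P^u$ is the measure obtained from $Q$ by the Girsanov change of measure, so that $W_t=W^Q_t-\int_0^t u_s\,ds$ is a $P^u$-Brownian motion, $dX_t=\mu_t\,dt+\sigma_t(u_t\,dt+dW_t)$ under $P^u$, and $$\frac{dQ}{dP^u}=\exp\left(-\int_0^T u_t^\top dW_t-\frac12\int_0^T u_t^\top u_t\,dt\right).$$ A sample $X_n\sim P^u$ is a path drawn under $P^u$ (together with its driving noise), and $\frac{dQ}{dP^u}(X_n)$ is the density $\exp\left(-\int_0^T u_t^\top dW_t-\frac12\int_0^T u_t^\top u_t\,dt\right)$ evaluated at that sample. $|\cdot|$ is the Euclidean norm. Adaptive Multiple Importance Sampling (AMIS) with flat re-weighting (flat-AMIS): $N_1,N_2,\ldots$ are given (non-random) sample sizes. At iteration $k=1,2,\ldots$: (1) a proposal $P_k\in\mathcal P$ is constructed, possibly depending (measurably, so that the importance weights $\frac{dQ}{dP_k}(X_n^k)$ are random variables) on all samples $X_n^l$, $1\le l<k$, $1\le n\le N_l$, drawn in earlier iterations, the dependence being otherwise arbitrary; (2) given all earlier samples, $X_1^k,\ldots,X_{N_k}^k$ are drawn independently with $X_n^k\sim P_k$; (3) all re-weighting factors are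 $w_n^l=1$; (4) the output is $\hat\psi_k=\frac{1}{\sum_{l=1}^k N_l}\sum_{l=1}^k\sum_{n=1}^{N_l} h(X_n^l)\,\frac{dQ}{dP_l}(X_n^l)$. "Almost surely" is with respect to the joint law of all samples. Consistency means $\hat\psi_k\to\psi$ almost surely when $\sum_{l\le k}N_l\to\infty$. *)

theory Defs
  imports "HOL-Probability.Probability"
begin

section \<open>Stochastic processes on a finite time interval\<close>

definition filtration_upto :: "real \<Rightarrow> 'a measure \<Rightarrow> (real \<Rightarrow> 'a measure) \<Rightarrow> bool" where
  "filtration_upto T M F \<longleftrightarrow>
     (\<forall>t\<in>{0..T}. subalgebra M (F t)) \<and> (\<forall>s\<in>{0..T}. \<forall>t\<in>{s..T}. sets (F s) \<subseteq> sets (F t))"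

text \<open>Joint measurability is the usual standing convention that makes time integrals
  \<open>\<integral> Y\<^sub>s ds\<close> random variables.\<close>

definition adapted_process ::
  "real \<Rightarrow> 'a measure \<Rightarrow> (real \<Rightarrow> 'a measure) \<Rightarrow> (real \<Rightarrow> 'a \<Rightarrow> 'v::topological_space) \<Rightarrow> bool" where
  "adapted_process T M F Y \<longleftrightarrow>
     (\<forall>t\<in>{0..T}. Y t \<in> borel_measurable (F t)) \<and>
     (\<lambda>(t, \<omega>). Y t \<omega>) \<in> borel_measurable (restrict_space borel {0..T} \<Otimes>\<^sub>M M)"

text \<open>For \<open>s < t\<close> the increment \<open>W\<^sub>t - W\<^sub>s\<close> is independent of \<open>F\<^sub>s\<close> and is a vector of independent
  centred Gaussians of variance \<open>t - s\<close>, given here by its Lebesgue density.\<close>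

definition brownian_motion ::
  "real \<Rightarrow> 'a measure \<Rightarrow> (real \<Rightarrow> 'a measure) \<Rightarrow> (real \<Rightarrow> 'a \<Rightarrow> real ^ 'm) \<Rightarrow> bool" where
  "brownian_motion T M F W \<longleftrightarrow>
     (\<forall>t\<in>{0..T}. W t \<in> borel_measurable (F t)) \<and>
     (AE \<omega> in M. W 0 \<omega> = 0) \<and>
     (AE \<omega> in M. continuous_on {0..T} (\<lambda>t. W t \<omega>)) \<and>
     (\<forall>s t. 0 \<le> s \<and> s < t \<and> t \<le> T \<longrightarrow>
        distributed M lborel (\<lambda>\<omega>. W t \<omega> - W s \<omega>)
          (\<lambda>x. ennreal (\<Prod>i\<in>UNIV. normal_density 0 (sqrt (t - s)) (x $ i))) \<and>
        prob_space.indep_set M (sets (F s))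
          {(\<lambda>\<omega>. W t \<omega> - W s \<omega>) -` B \<inter> space M | B. B \<in> sets borel})"


section \<open>The stochastic integral\<close>

text \<open>A simple process on \<open>[0,t]\<close> takes the value \<open>\<xi> i\<close> on \<open>(\<tau> i, \<tau> (i+1)]\<close> for \<open>i < n\<close>.\<close>

definition simple_process ::
  "(real \<Rightarrow> 'a measure) \<Rightarrow> real \<Rightarrow> nat \<Rightarrow> (nat \<Rightarrow> real) \<Rightarrow> (nat \<Rightarrow> 'a \<Rightarrow> real ^ 'm) \<Rightarrow> bool" where
  "simple_process F t n \<tau> \<xi> \<longleftrightarrow>
     \<tau> 0 = 0 \<and> \<tau> n = t \<and> (\<forall>i<n. \<tau> i \<le> \<tau> (Suc i)) \<and>
     (\<forall>i<n. \<xi> i \<in> borel_measurable (F (\<tau> i)) \<and> bounded (\<xi> i ` space (F (\<tau> i))))"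

definition simple_value ::
  "nat \<Rightarrow> (nat \<Rightarrow> real) \<Rightarrow> (nat \<Rightarrow> 'a \<Rightarrow> real ^ 'm) \<Rightarrow> real \<Rightarrow> 'a \<Rightarrow> real ^ 'm" where
  "simple_value n \<tau> \<xi> s \<omega> = (\<Sum>i<n. indicator {\<tau> i<..\<tau> (Suc i)} s *\<^sub>R \<xi> i \<omega>)"

definition simple_integral_wrt ::
  "(real \<Rightarrow> 'a \<Rightarrow> real ^ 'm) \<Rightarrow> nat \<Rightarrow> (nat \<Rightarrow> real) \<Rightarrow> (nat \<Rightarrow> 'a \<Rightarrow> real ^ 'm) \<Rightarrow> 'a \<Rightarrow> real" where
  "simple_integral_wrt W n \<tau> \<xi> \<omega> = (\<Sum>i<n. \<xi> i \<omega> \<bullet> (W (\<tau> (Suc i)) \<omega> - W (\<tau> i) \<omega>))"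

definition tendsto_0_in_prob :: "'a measure \<Rightarrow> (nat \<Rightarrow> 'a \<Rightarrow> ennreal) \<Rightarrow> bool" where
  "tendsto_0_in_prob M Z \<longleftrightarrow>
     (\<forall>\<epsilon>>0. (\<lambda>j. measure M {\<omega> \<in> space M. ennreal \<epsilon> < Z j \<omega>}) \<longlonglongrightarrow> 0)"

text \<open>\<open>is_ito_integral M F W t H I\<close>: the random variable \<open>I\<close> is a version of
  \<open>\<integral>\<^sub>0\<^sup>t H\<^sub>s\<^sup>T dW\<^sub>s\<close>, i.e. a limit in probability of integrals of simple processes \<open>H\<^sup>j\<close> with
  \<open>\<integral>\<^sub>0\<^sup>t |H\<^sup>j\<^sub>s - H\<^sub>s|\<^sup>2 ds \<rightarrow> 0\<close> in probability. The integrator may also be a Brownian motion with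
  an absolutely continuous drift.\<close>

definition is_ito_integral ::
  "'a measure \<Rightarrow> (real \<Rightarrow> 'a measure) \<Rightarrow> (real \<Rightarrow> 'a \<Rightarrow> real ^ 'm) \<Rightarrow> real \<Rightarrow>
   (real \<Rightarrow> 'a \<Rightarrow> real ^ 'm) \<Rightarrow> ('a \<Rightarrow> real) \<Rightarrow> bool" where
  "is_ito_integral M F W t H I \<longleftrightarrow>
     adapted_process t M F H \<and> I \<in> borel_measurable M \<and>
     (\<exists>n \<tau> \<xi>. (\<forall>j. simple_process F t (n j) (\<tau> j) (\<xi> j)) \<and>
        tendsto_0_in_prob M
          (\<lambda>j \<omega>. \<integral>\<^sup>+ s\<in>{0..t}. ennreal (norm (simple_value (n j) (\<tau> j) (\<xi> j) s \<omega> - H s \<omega>) ^ 2) \<partial>lborel) \<and>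
        tendsto_0_in_prob M
          (\<lambda>j \<omega>. ennreal \<bar>simple_integral_wrt W (n j) (\<tau> j) (\<xi> j) \<omega> - I \<omega>\<bar>))"

text \<open>Any two versions agree almost everywhere, so the choice of version is immaterial.\<close>

definition ito_integral ::
  "'a measure \<Rightarrow> (real \<Rightarrow> 'a measure) \<Rightarrow> (real \<Rightarrow> 'a \<Rightarrow> real ^ 'm) \<Rightarrow> real \<Rightarrow>
   (real \<Rightarrow> 'a \<Rightarrow> real ^ 'm) \<Rightarrow> 'a \<Rightarrow> real" where
  "ito_integral M F W t H = (SOME I. is_ito_integral M F W t H I)"

text \<open>\<open>dX\<^sub>t = \<mu>\<^sub>t dt + \<sigma>\<^sub>t dW\<^sub>t\<close>, written in integrated form and coordinate by coordinate;
  \<open>\<sigma> s \<omega> $ i\<close> is the \<open>i\<close>-th row of the matrix.\<close>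

definition ito_process ::
  "real \<Rightarrow> 'a measure \<Rightarrow> (real \<Rightarrow> 'a measure) \<Rightarrow> (real \<Rightarrow> 'a \<Rightarrow> real ^ 'm) \<Rightarrow>
   (real \<Rightarrow> 'a \<Rightarrow> real ^ 'd) \<Rightarrow> (real \<Rightarrow> 'a \<Rightarrow> real ^ 'm ^ 'd) \<Rightarrow> (real \<Rightarrow> 'a \<Rightarrow> real ^ 'd) \<Rightarrow> bool" where
  "ito_process T M F W \<mu> \<sigma> X \<longleftrightarrow>
     adapted_process T M F \<mu> \<and> adapted_process T M F \<sigma> \<and>
     (\<forall>t\<in>{0..T}. X t \<in> borel_measurable (F t)) \<and>
     (AE \<omega> in M. continuous_on {0..T} (\<lambda>t. X t \<omega>)) \<and>
     (AE \<omega> in M. set_integrable lborel {0..T} (\<lambda>s. \<mu> s \<omega>)) \<and>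
     (\<forall>t\<in>{0..T}. \<forall>i. is_ito_integral M F W t (\<lambda>s \<omega>. \<sigma> s \<omega> $ i)
        (\<lambda>\<omega>. (X t \<omega> - X 0 \<omega> - (LINT s:{0..t}|lborel. \<mu> s \<omega>)) $ i))"

text \<open>Paths on \<open>[0,T]\<close> as elements of \<open>PiM {0..T} (\<lambda>_. borel)\<close>.\<close>

definition path_upto :: "real \<Rightarrow> (real \<Rightarrow> 'a \<Rightarrow> 'v) \<Rightarrow> 'a \<Rightarrow> real \<Rightarrow> 'v" where
  "path_upto T X \<omega> = (\<lambda>t\<in>{0..T}. X t \<omega>)"


section \<open>Girsanov change of measure\<close>

definition energy :: "real \<Rightarrow> (real \<Rightarrow> 'a \<Rightarrow> real ^ 'm) \<Rightarrow> 'a \<Rightarrow> real" where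
  "energy T u \<omega> = (LINT s:{0..T}|lborel. u s \<omega> \<bullet> u s \<omega>)"

definition girsanov_measure ::
  "real \<Rightarrow> 'a measure \<Rightarrow> (real \<Rightarrow> 'a measure) \<Rightarrow> (real \<Rightarrow> 'a \<Rightarrow> real ^ 'm) \<Rightarrow>
   (real \<Rightarrow> 'a \<Rightarrow> real ^ 'm) \<Rightarrow> 'a measure" where
  "girsanov_measure T Q F W u =
     density Q (\<lambda>\<omega>. ennreal (exp (ito_integral Q F W T u \<omega> - energy T u \<omega> / 2)))"

text \<open>The shifted process, a Brownian motion under \<open>girsanov_measure T Q F W u\<close> by Girsanov's
  theorem.\<close>

definition shifted_noise ::
  "(real \<Rightarrow> 'a \<Rightarrow> real ^ 'm) \<Rightarrow> (real \<Rightarrow> 'a \<Rightarrow> real ^ 'm) \<Rightarrow> real \<Rightarrow> 'a \<Rightarrow> real ^ 'm" where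
  "shifted_noise W u t \<omega> = W t \<omega> - (LINT s:{0..t}|lborel. u s \<omega>)"

text \<open>The change of measure is available for \<open>u\<close>: the stochastic integral \<open>\<integral>\<^sub>0\<^sup>T u\<^sub>t\<^sup>T dW\<^sub>t\<close> exists
  under \<open>Q\<close> (which forces \<open>\<integral>\<^sub>0\<^sup>T |u\<^sub>t|\<^sup>2 dt < \<infinity>\<close> almost surely) and the Girsanov density has total
  mass one.\<close>

definition girsanov_control ::
  "real \<Rightarrow> 'a measure \<Rightarrow> (real \<Rightarrow> 'a measure) \<Rightarrow> (real \<Rightarrow> 'a \<Rightarrow> real ^ 'm) \<Rightarrow>
   (real \<Rightarrow> 'a \<Rightarrow> real ^ 'm) \<Rightarrow> bool" where
  "girsanov_control T Q F W u \<longleftrightarrow>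
     adapted_process T Q F u \<and> (\<exists>I. is_ito_integral Q F W T u I) \<and>
     prob_space (girsanov_measure T Q F W u)"

text \<open>\<open>Z\<close> is a version of \<open>dQ/dP\<^sup>u = exp (- \<integral>\<^sub>0\<^sup>T u\<^sub>t\<^sup>T dW\<^sub>t - 1/2 \<integral>\<^sub>0\<^sup>T u\<^sub>t\<^sup>T u\<^sub>t dt)\<close>, where now \<open>W\<close> is the
  shifted process and the stochastic integral is taken under \<open>P\<^sup>u\<close>.\<close>

definition is_importance_weight ::
  "real \<Rightarrow> 'a measure \<Rightarrow> (real \<Rightarrow> 'a measure) \<Rightarrow> (real \<Rightarrow> 'a \<Rightarrow> real ^ 'm) \<Rightarrow>
   (real \<Rightarrow> 'a \<Rightarrow> real ^ 'm) \<Rightarrow> ('a \<Rightarrow> real) \<Rightarrow> bool" where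
  "is_importance_weight T Q F W u Z \<longleftrightarrow>
     (\<exists>J. is_ito_integral (girsanov_measure T Q F W u) F (shifted_noise W u) T u J \<and>
        (AE \<omega> in girsanov_measure T Q F W u. Z \<omega> = exp (- J \<omega> - energy T u \<omega> / 2)))"

text \<open>Valued in \<^typ>\<open>ereal\<close> so that the infimum over the empty set is \<open>\<infinity>\<close>.\<close>

definition control_sup_norm :: "real \<Rightarrow> 'a measure \<Rightarrow> (real \<Rightarrow> 'a \<Rightarrow> real ^ 'm) \<Rightarrow> ereal" where
  "control_sup_norm T P u =
     Inf (ereal ` {A. 0 \<le> A \<and> (AE \<omega> in P. \<forall>t\<in>{0..T}. norm (u t \<omega>) < A)})"


section \<open>Adaptive multiple importance sampling with flat re-weighting\<close>

text \<open>Iterations and samples are numbered from 1; \<open>past N k\<close> indexes the samples drawn strictly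
  before iteration \<open>k\<close>, a pair \<open>(l, n)\<close> standing for the \<open>n\<close>-th sample of iteration \<open>l\<close>. A sample is
  an outcome of the filtered space, and thus carries both the path and its driving noise.\<close>

definition past :: "(nat \<Rightarrow> nat) \<Rightarrow> nat \<Rightarrow> (nat \<times> nat) set" where
  "past N k = (SIGMA l:{1..<k}. {1..N l})"

definition history_space :: "'a measure \<Rightarrow> (nat \<Rightarrow> nat) \<Rightarrow> nat \<Rightarrow> (nat \<times> nat \<Rightarrow> 'a) measure" where
  "history_space Q N k = (\<Pi>\<^sub>M i\<in>past N k. Q)"

definition history ::
  "(nat \<Rightarrow> nat) \<Rightarrow> (nat \<Rightarrow> nat \<Rightarrow> 's \<Rightarrow> 'a) \<Rightarrow> nat \<Rightarrow> 's \<Rightarrow> nat \<times> nat \<Rightarrow> 'a" where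
  "history N \<xi> k s = (\<lambda>(l, n)\<in>past N k. \<xi> l n s)"

definition history_algebra ::
  "'a measure \<Rightarrow> (nat \<Rightarrow> nat) \<Rightarrow> 's measure \<Rightarrow> (nat \<Rightarrow> nat \<Rightarrow> 's \<Rightarrow> 'a) \<Rightarrow> nat \<Rightarrow> 's measure" where
  "history_algebra Q N S \<xi> k = vimage_algebra (space S) (history N \<xi> k) (history_space Q N k)"

text \<open>\<open>S\<close> is the probability space carrying all samples \<open>\<xi> l n\<close>. In iteration \<open>k\<close> the control of the
  proposal is \<open>U k x\<close> and the weight function is \<open>Z k x\<close>, where \<open>x\<close> is the history. The last clause
  says that, conditionally on the history, the samples of iteration \<open>k\<close> are independent with law
  \<open>P\<^sup>u\<close> for \<open>u = U k x\<close>.\<close>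

definition amis_sampling ::
  "real \<Rightarrow> 'a measure \<Rightarrow> (real \<Rightarrow> 'a measure) \<Rightarrow> (real \<Rightarrow> 'a \<Rightarrow> real ^ 'm) \<Rightarrow>
   (real \<Rightarrow> 'a \<Rightarrow> real ^ 'm) set \<Rightarrow> (nat \<Rightarrow> nat) \<Rightarrow> 's measure \<Rightarrow> (nat \<Rightarrow> nat \<Rightarrow> 's \<Rightarrow> 'a) \<Rightarrow>
   (nat \<Rightarrow> (nat \<times> nat \<Rightarrow> 'a) \<Rightarrow> real \<Rightarrow> 'a \<Rightarrow> real ^ 'm) \<Rightarrow>
   (nat \<Rightarrow> (nat \<times> nat \<Rightarrow> 'a) \<Rightarrow> 'a \<Rightarrow> real) \<Rightarrow> bool" where
  "amis_sampling T Q F W \<U> N S \<xi> U Z \<longleftrightarrow>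
     prob_space S \<and>
     (\<forall>k\<ge>1. \<forall>n\<in>{1..N k}. \<xi> k n \<in> S \<rightarrow>\<^sub>M Q) \<and>
     (\<forall>k\<ge>1. \<forall>x\<in>space (history_space Q N k).
        U k x \<in> \<U> \<and> is_importance_weight T Q F W (U k x) (Z k x)) \<and>
     (\<forall>k\<ge>1. (\<lambda>(x, \<omega>). Z k x \<omega>) \<in> borel_measurable (history_space Q N k \<Otimes>\<^sub>M Q)) \<and>
     (\<forall>k\<ge>1. \<forall>A. (\<forall>n\<in>{1..N k}. A n \<in> sets Q) \<longrightarrow>
        (AE s in S.
           real_cond_exp S (history_algebra Q N S \<xi> k)
             (indicator {s \<in> space S. \<forall>n\<in>{1..N k}. \<xi> k n s \<in> A n}) s =
           (\<Prod>n=1..N k. measure (girsanov_measure T Q F W (U k (history N \<xi> k s))) (A n))))"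

text \<open>The estimator after iteration \<open>k\<close> when all re-weighting factors equal 1; \<open>f\<close> is the integrand
  as a function of a sample.\<close>

definition flat_amis_estimator ::
  "(nat \<Rightarrow> nat) \<Rightarrow> (nat \<Rightarrow> nat \<Rightarrow> 's \<Rightarrow> 'a) \<Rightarrow> (nat \<Rightarrow> (nat \<times> nat \<Rightarrow> 'a) \<Rightarrow> 'a \<Rightarrow> real) \<Rightarrow>
   ('a \<Rightarrow> real) \<Rightarrow> nat \<Rightarrow> 's \<Rightarrow> real" where
  "flat_amis_estimator N \<xi> Z f k s =
     (\<Sum>l=1..k. \<Sum>n=1..N l. f (\<xi> l n s) * Z l (history N \<xi> l s) (\<xi> l n s)) / real (\<Sum>l=1..k. N l)"

end

theory Submission
  imports Defs
begin

text \<open>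
  Every weighted sample has the same conditional mean \<open>\<psi>\<close> given all samples drawn before it: the weight is
  the reciprocal of the density of the proposal with respect to \<open>Q\<close>, so the proposal, however it was
  chosen, integrates \<open>h dQ/dP\<close> to \<open>\<psi>\<close>. The centred sums are thus a martingale, and the means converge
  almost surely once the weighted samples have bounded \<open>q\<close>-th moments for some \<open>q > 1\<close>. Three ingredients
  make this precise.

  \<^emph>\<open>Moments.\<close> Put \<open>q = 2 r / (r + 1)\<close>. The \<open>q\<close>-th moment of \<open>h dQ/dP\<close> under the proposal is the integral of
  \<open>\<bar>h\<bar> powr q * (dQ/dP) powr (q - 1)\<close> under \<open>Q\<close>, and Young's inequality bounds it by the \<open>r\<close>-th moment of \<open>h\<close> plus
  the mean of \<open>dQ/dP\<close> under \<open>Q\<close> (\<open>weighted_moment_interpolation\<close>). That mean is at most \<open>exp (C\<^sup>2 T)\<close>,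
  uniformly over the class of controls (\<open>girsanov_importance_weight\<close>).

  \<^emph>\<open>Weights.\<close> The density of the proposal involves a stochastic integral under \<open>Q\<close>, the weight one under the
  proposal against the shifted noise. That these fit together, and the bound on the mean of the weight,
  both follow from one inequality: the exponential of a stochastic integral minus half its energy has
  mean at most one. For simple processes this is a Gaussian computation, one partition cell at a time,
  and Fatou's lemma extends it to limits (\<open>exponential_limit_le_one\<close>).

  \<^emph>\<open>Strong law.\<close> Given the past, each sample follows the current proposal (\<open>nn_integral_next_draw\<close>). The
  von Bahr-Esseen inequality bounds the \<open>q\<close>-th moment of \<open>n\<close> centred summands by a multiple of \<open>n\<close>. This
  yields convergence along \<open>n = j ^ a\<close> for a suitable power \<open>a\<close>, and if \<open>h\<close> is nonnegative, the sums are
  monotone and cannot escape between these indices (\<open>strong_law_conditional_mean\<close>). The general case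
  follows by splitting \<open>h\<close> into its positive and negative part.
\<close>


section \<open>A strong law for summands with a common conditional mean\<close>

text \<open>For \<open>t\<close> in the unit interval \<open>t \<le> t powr s\<close>; apply this to the two shares of \<open>x + y\<close>.\<close>

lemma powr_add_le_add_powr:
  fixes x y s :: real
  assumes "0 \<le> x" "0 \<le> y" "0 < s" "s \<le> 1"
  shows "(x + y) powr s \<le> x powr s + y powr s"
proof (cases "x + y = 0")
  case False
  then have pos: "x + y > 0" using assms by auto
  have *: "t \<le> t powr s" if "0 \<le> t" "t \<le> 1" for t :: real
  proof (cases "t = 0")
    case False
    then show ?thesis using powr_mono'[of s 1 t] that assms by auto
  qed auto
  have "1 = x / (x + y) + y / (x + y)" using pos by (simp add: add_divide_distrib[symmetric])
  also have "\<dots> \<le> (x / (x + y)) powr s + (y / (x + y)) powr s"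
    using assms pos by (intro add_mono *) auto
  also have "\<dots> = (x powr s + y powr s) / (x + y) powr s"
    using assms by (simp add: powr_divide add_divide_distrib)
  finally show ?thesis using pos by (simp add: le_divide_eq)
qed (use assms in auto)

lemma abs_diff_powr_le:
  fixes x y s :: real
  assumes "0 \<le> x" "0 \<le> y" "0 < s" "s \<le> 1"
  shows "\<bar>x powr s - y powr s\<bar> \<le> \<bar>x - y\<bar> powr s"
proof -
  have "b powr s - a powr s \<le> (b - a) powr s \<and> a powr s \<le> b powr s" if "0 \<le> a" "a \<le> b" for a b
    using powr_add_le_add_powr[of a "b - a" s] powr_mono2[of s a b] that assms by auto
  from this[of x y] this[of y x] show ?thesis using assms by (cases "x \<le> y") auto
qed

text \<open>Up to the factor \<open>s + 1\<close> this is the derivative of \<open>\<bar>x\<bar> powr (s + 1)\<close>; its Hoelder continuity controls the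
  error of the first-order expansion of that power.\<close>

lemma signed_powr_Hoelder:
  fixes x y s :: real
  assumes "0 < s" "s \<le> 1"
  shows "\<bar>sgn x * \<bar>x\<bar> powr s - sgn y * \<bar>y\<bar> powr s\<bar> \<le> 2 * \<bar>x - y\<bar> powr s"
proof -
  have same: "\<bar>a powr s - b powr s\<bar> \<le> 2 * \<bar>a - b\<bar> powr s" if "0 \<le> a" "0 \<le> b" for a b
    using abs_diff_powr_le[OF that assms] powr_ge_zero[of "\<bar>a - b\<bar>" s] by linarith
  have opp: "a powr s + b powr s \<le> 2 * (a + b) powr s" if "0 \<le> a" "0 \<le> b" for a b :: real
    using powr_mono2[of s a "a + b"] powr_mono2[of s b "a + b"] that assms by auto
  consider "0 \<le> x \<and> 0 \<le> y" | "x \<le> 0 \<and> y \<le> 0" | "0 < x \<and> y < 0" | "x < 0 \<and> 0 < y" by linarith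
  then show ?thesis
  proof cases
    case 1 then show ?thesis using same[of x y] by (auto simp: sgn_if abs_minus_commute)
  next
    case 2 then show ?thesis using same[of "-x" "-y"] by (auto simp: sgn_if abs_minus_commute)
  next
    case 3 then show ?thesis using opp[of x "-y"] by (auto simp: sgn_if)
  next
    case 4 then show ?thesis using opp[of "-x" y] by (auto simp: sgn_if abs_minus_commute add.commute)
  qed
qed

text \<open>The graph of the convex function \<open>\<bar>x\<bar> powr q\<close> lies above its tangents. Young's inequality proves this
  without differentiating at zero.\<close>

lemma abs_powr_tangent:
  fixes x y q :: real
  assumes "1 < q"
  shows "\<bar>x\<bar> powr q + q * (sgn x * \<bar>x\<bar> powr (q - 1)) * (y - x) \<le> \<bar>y\<bar> powr q"
proof (cases "x = 0 \<or> y = 0")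
  case True
  then show ?thesis
  proof
    assume "y = 0"
    have "\<bar>x\<bar> powr q = \<bar>x\<bar> powr (q - 1) * \<bar>x\<bar>" by (simp add: powr_diff)
    moreover have "sgn x * x = \<bar>x\<bar>" by (auto simp: sgn_if)
    moreover have "q * (sgn x * \<bar>x\<bar> powr (q - 1)) * (y - x) = - (q * (\<bar>x\<bar> powr (q - 1) * (sgn x * x)))"
      using \<open>y = 0\<close> by (simp add: algebra_simps)
    ultimately have "q * (sgn x * \<bar>x\<bar> powr (q - 1)) * (y - x) = - q * \<bar>x\<bar> powr q" by simp
    moreover have "1 * \<bar>x\<bar> powr q \<le> q * \<bar>x\<bar> powr q"
      using assms by (intro mult_right_mono) auto
    ultimately show ?thesis using powr_ge_zero[of "\<bar>y\<bar>" q] by linarith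
  qed simp
next
  case False
  let ?a = "\<bar>x\<bar>" and ?b = "\<bar>y\<bar>"
  have pos: "?a > 0" "?b > 0" using False by auto
  have "(?a powr q) powr (1 - 1/q) * (?b powr q) powr (1/q) \<le> (1 - 1/q) * ?a powr q + (1/q) * ?b powr q"
    using assms pos by (intro Youngs_inequality_0) auto
  also have "(?a powr q) powr (1 - 1/q) = ?a powr (q - 1)"
    using assms by (simp add: powr_powr right_diff_distrib)
  also have "(?b powr q) powr (1/q) = ?b" using assms pos by (simp add: powr_powr)
  finally have young: "q * (?a powr (q - 1) * ?b) \<le> (q - 1) * ?a powr q + ?b powr q"
    using assms by (simp add: field_simps)
  have sx: "sgn x * x = ?a" by (auto simp: sgn_if)
  have "sgn x * y \<le> ?b" by (auto simp: sgn_if)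
  then have "?a powr (q - 1) * (sgn x * y) \<le> ?a powr (q - 1) * ?b" by (intro mult_left_mono) auto
  then have "q * (?a powr (q - 1) * (sgn x * y)) \<le> q * (?a powr (q - 1) * ?b)"
    by (rule mult_left_mono) (use assms in auto)
  moreover have aq: "?a powr q = ?a powr (q - 1) * ?a" using pos by (simp add: powr_diff)
  moreover have "q * (sgn x * ?a powr (q - 1)) * (y - x)
      = q * (?a powr (q - 1) * (sgn x * y)) - q * (?a powr (q - 1) * (sgn x * x))"
    by (simp add: algebra_simps)
  moreover have "(q - 1) * ?a powr q = q * (?a powr (q - 1) * ?a) - ?a powr q"
    unfolding aq by (simp add: algebra_simps)
  ultimately show ?thesis using young unfolding sx by linarith
qed

text \<open>The tangent at \<open>a + b\<close> overestimates the increment, and moving its slope back to \<open>a\<close> costs at most a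
  multiple of \<open>\<bar>b\<bar> powr q\<close>. The term linear in \<open>b\<close> vanishes in expectation when \<open>b\<close> has conditional mean
  zero given \<open>a\<close>, so \<open>q\<close>-th moments of such sums grow at most linearly in the number of summands: this
  is the von Bahr-Esseen inequality.\<close>

lemma abs_add_powr_le:
  fixes a b q :: real
  assumes "1 < q" "q \<le> 2"
  shows "\<bar>a + b\<bar> powr q \<le> \<bar>a\<bar> powr q + q * (sgn a * \<bar>a\<bar> powr (q - 1)) * b + 4 * \<bar>b\<bar> powr q"
proof -
  let ?\<phi> = "\<lambda>x::real. sgn x * \<bar>x\<bar> powr (q - 1)"
  have "\<bar>a + b\<bar> powr q \<le> \<bar>a\<bar> powr q + q * ?\<phi> (a + b) * b"
    using abs_powr_tangent[of q "a + b" a] assms by simp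
  moreover have "(?\<phi> (a + b) - ?\<phi> a) * b \<le> 2 * \<bar>b\<bar> powr q"
  proof -
    have "(?\<phi> (a + b) - ?\<phi> a) * b \<le> \<bar>?\<phi> (a + b) - ?\<phi> a\<bar> * \<bar>b\<bar>"
      by (simp add: abs_mult[symmetric])
    also have "\<dots> \<le> (2 * \<bar>b\<bar> powr (q - 1)) * \<bar>b\<bar>"
      using signed_powr_Hoelder[of "q - 1" "a + b" a] assms by (intro mult_right_mono) auto
    also have "\<dots> = 2 * \<bar>b\<bar> powr q" by (simp add: powr_diff)
    finally show ?thesis .
  qed
  then have "q * ((?\<phi> (a + b) - ?\<phi> a) * b) \<le> 2 * (2 * \<bar>b\<bar> powr q)"
    using assms by (intro order_trans[OF mult_left_mono[of _ "2 * \<bar>b\<bar> powr q"]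
      mult_right_mono[of q 2]]) auto
  ultimately show ?thesis by (simp add: algebra_simps)
qed


text \<open>Between two consecutive indices \<open>j ^ a\<close> and \<open>(j + 1) ^ a\<close> a monotone sequence is trapped between its
  values there, and the ratio of those indices tends to one. Hence convergence of the means along
  such a sparse subsequence already gives convergence of all means.\<close>

lemma LIMSEQ_mean_of_subsequence:
  fixes A :: "nat \<Rightarrow> real" and a :: nat
  assumes mono: "\<And>n. A n \<le> A (Suc n)" and nonneg: "0 \<le> A 0" and a: "a \<noteq> 0"
    and lim: "(\<lambda>j. A (Suc j ^ a) / real (Suc j ^ a)) \<longlonglongrightarrow> c"
  shows "(\<lambda>n. A n / real n) \<longlonglongrightarrow> c"
proof -
  have incA: "incseq A" using mono by (rule incseq_SucI)
  have A0: "0 \<le> A n" for n using incseqD[OF incA, of 0 n] nonneg by simp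
  define B where "B j = A (j ^ a) / real (j ^ a)" for j
  have B: "B \<longlonglongrightarrow> c"
    using lim unfolding B_def by (rule filterlim_sequentially_Suc[THEN iffD1])
  define J where "J n = nat \<lfloor>root a (real n)\<rfloor>" for n :: nat
  have J: "J n ^ a \<le> n" "n < Suc (J n) ^ a" for n
  proof -
    have "real (J n) = of_int \<lfloor>root a (real n)\<rfloor>"
      using a by (simp add: J_def)
    then have le: "real (J n) \<le> root a (real n)" and lt: "root a (real n) < real (Suc (J n))"
      by linarith+
    have "real (J n) ^ a \<le> root a (real n) ^ a" using le by (intro power_mono) auto
    then have "real (J n ^ a) \<le> real n" using a by simp
    then show "J n ^ a \<le> n" by (simp only: of_nat_le_iff)
    have "root a (real n) ^ a < real (Suc (J n)) ^ a" using lt a by (intro power_strict_mono) auto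
    then have "real n < real (Suc (J n) ^ a)" using a by simp
    then show "n < Suc (J n) ^ a" by (simp only: of_nat_less_iff)
  qed
  have J_top: "filterlim J at_top sequentially"
    unfolding filterlim_at_top
  proof
    fix z :: nat
    have "z \<le> J n" if "z ^ a \<le> n" for n
    proof (rule ccontr)
      assume "\<not> z \<le> J n"
      then have "Suc (J n) ^ a \<le> z ^ a" by (intro power_mono) auto
      then show False using J(2)[of n] that by linarith
    qed
    then show "\<forall>\<^sub>F n in sequentially. z \<le> J n"
      by (auto simp: eventually_sequentially intro!: exI[of _ "z ^ a"])
  qed
  have ratio: "(\<lambda>j. (real j / real (Suc j)) ^ a) \<longlonglongrightarrow> 1"
    using tendsto_power[OF LIMSEQ_n_over_Suc_n, of a] by simp
  have ratio': "(\<lambda>j. (real (Suc j) / real j) ^ a) \<longlonglongrightarrow> 1"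
    using tendsto_power[OF LIMSEQ_Suc_n_over_n, of a] by simp
  have "(\<lambda>j. B j * (real j / real (Suc j)) ^ a) \<longlonglongrightarrow> c * 1"
    by (intro tendsto_mult B ratio)
  then have low: "(\<lambda>n. B (J n) * (real (J n) / real (Suc (J n))) ^ a) \<longlonglongrightarrow> c"
    using filterlim_compose[OF _ J_top] by fastforce
  have "(\<lambda>j. B (Suc j) * (real (Suc j) / real j) ^ a) \<longlonglongrightarrow> c * 1"
    using B by (intro tendsto_mult ratio') (rule LIMSEQ_Suc)
  then have up: "(\<lambda>n. B (Suc (J n)) * (real (Suc (J n)) / real (J n)) ^ a) \<longlonglongrightarrow> c"
    using filterlim_compose[OF _ J_top] by fastforce
  show ?thesis
  proof (rule tendsto_sandwich[OF _ _ low up])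
    have ev: "\<forall>\<^sub>F n in sequentially. 1 \<le> J n"
      using J_top by (auto simp: filterlim_at_top)
    show "\<forall>\<^sub>F n in sequentially. B (J n) * (real (J n) / real (Suc (J n))) ^ a \<le> A n / real n"
      using ev
    proof eventually_elim
      case (elim n)
      have n: "0 < n" using J(1)[of n] elim a by (metis One_nat_def le_zero_eq not_gr_zero not_less_eq_eq power_eq_0_iff)
      have "B (J n) * (real (J n) / real (Suc (J n))) ^ a = A (J n ^ a) / real (Suc (J n) ^ a)"
        using elim by (simp add: B_def power_divide)
      also have "\<dots> \<le> A n / real n"
        using J[of n] n A0 incseqD[OF incA J(1)] by (intro frac_le) (auto simp del: power_Suc of_nat_Suc of_nat_power)
      finally show ?case .
    qed
    show "\<forall>\<^sub>F n in sequentially. A n / real n \<le> B (Suc (J n)) * (real (Suc (J n)) / real (J n)) ^ a"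
      using ev
    proof eventually_elim
      case (elim n)
      have "A n / real n \<le> A (Suc (J n) ^ a) / real (J n ^ a)"
        using J[of n] elim A0 incseqD[OF incA less_imp_le[OF J(2)]]
        by (intro frac_le) (auto simp del: power_Suc of_nat_Suc of_nat_power)
      also have "\<dots> = B (Suc (J n)) * (real (Suc (J n)) / real (J n)) ^ a"
        using elim by (simp add: B_def power_divide)
      finally show ?case .
    qed
  qed
qed

text \<open>A strong law for nonnegative summands that share a conditional mean and have uniformly bounded \<open>q\<close>-th
  moments for some \<open>q > 1\<close>. The last hypothesis says that \<open>Y m\<close> has conditional mean \<open>c\<close> given the partial
  sum of its predecessors, which is all that a moment bound on the centred sums needs. The bound is
  linear in the number \<open>n\<close> of summands, so the means deviate with \<open>q\<close>-th moment of order
  \<open>n powr (1 - q)\<close>; this is summable along \<open>n = j ^ a\<close> for large \<open>a\<close>, and monotonicity of the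
  sums fills the gaps.\<close>

proposition strong_law_conditional_mean:
  fixes Y :: "nat \<Rightarrow> 's \<Rightarrow> real" and c K q :: real
  assumes "prob_space S"
    and [measurable]: "\<And>m. Y m \<in> borel_measurable S"
    and nonneg: "\<And>m s. 0 \<le> Y m s" and c: "0 \<le> c"
    and q: "1 < q" "q \<le> 2"
    and moment: "\<And>m. (\<integral>\<^sup>+s. ennreal (Y m s powr q) \<partial>S) \<le> ennreal K"
    and cond_mean: "\<And>m (\<phi> :: real \<Rightarrow> ennreal). \<phi> \<in> borel_measurable borel \<Longrightarrow>
      (\<integral>\<^sup>+s. \<phi> (\<Sum>i<m. Y i s) * ennreal (Y m s) \<partial>S) = ennreal c * (\<integral>\<^sup>+s. \<phi> (\<Sum>i<m. Y i s) \<partial>S)"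
  shows "AE s in S. (\<lambda>n. (\<Sum>i<n. Y i s) / real n) \<longlonglongrightarrow> c"
proof -
  interpret prob_space S by fact
  define A where "A n s = (\<Sum>i<n. Y i s)" for n s
  define R where "R n s = A n s - real n * c" for n s
  define K' where "K' = max K 0"
  define L where "L = 4 * (K' + c powr q)"
  have L0: "0 \<le> L" by (simp add: L_def K'_def)
  have [measurable]: "A n \<in> borel_measurable S" "R n \<in> borel_measurable S" for n
    unfolding A_def[abs_def] R_def[abs_def] by measurable
  have Yq: "integrable S (\<lambda>s. Y m s powr q)" "(\<integral>s. Y m s powr q \<partial>S) \<le> K'" for m
  proof -
    have le: "(\<integral>\<^sup>+s. ennreal (Y m s powr q) \<partial>S) \<le> ennreal K'"
      using moment[of m] by (rule order_trans) (auto simp: K'_def intro!: ennreal_leI)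
    show "integrable S (\<lambda>s. Y m s powr q)"
      by (rule integrableI_bounded) (use le in \<open>auto simp: top.not_eq_extremum[symmetric] top_unique\<close>)
    then have "ennreal (\<integral>s. Y m s powr q \<partial>S) \<le> ennreal K'"
      using le by (subst (asm) nn_integral_eq_integral) auto
    then show "(\<integral>s. Y m s powr q \<partial>S) \<le> K'"
      by (subst (asm) ennreal_le_iff) (auto simp: K'_def)
  qed
  have Dq: "integrable S (\<lambda>s. \<bar>Y m s - c\<bar> powr q)" "(\<integral>s. \<bar>Y m s - c\<bar> powr q \<partial>S) \<le> L" for m
  proof -
    have pt: "\<bar>Y m s - c\<bar> powr q \<le> 4 * (Y m s powr q + c powr q)" for s
    proof -
      have "\<bar>Y m s - c\<bar> powr q \<le> max (Y m s) c powr q"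
        using nonneg[of m s] c q by (intro powr_mono2) (auto simp: max_def)
      also have "\<dots> \<le> Y m s powr q + c powr q" by (simp add: max_def)
      also have "\<dots> \<le> 4 * (Y m s powr q + c powr q)" by simp
      finally show ?thesis .
    qed
    show int: "integrable S (\<lambda>s. \<bar>Y m s - c\<bar> powr q)"
      by (rule Bochner_Integration.integrable_bound[of _ "\<lambda>s. 4 * (Y m s powr q + c powr q)"])
        (use Yq pt in auto)
    have "(\<integral>s. \<bar>Y m s - c\<bar> powr q \<partial>S) \<le> (\<integral>s. 4 * (Y m s powr q + c powr q) \<partial>S)"
      using int Yq pt by (intro integral_mono) auto
    also have "\<dots> \<le> L" using Yq[of m] by (simp add: L_def prob_space)
    finally show "(\<integral>s. \<bar>Y m s - c\<bar> powr q \<partial>S) \<le> L" .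
  qed
  have Rq: "integrable S (\<lambda>s. \<bar>R n s\<bar> powr q) \<and> (\<integral>s. \<bar>R n s\<bar> powr q \<partial>S) \<le> 4 * L * real n" for n
  proof (induction n)
    case 0
    then show ?case by (simp add: R_def A_def)
  next
    case (Suc n)
    \<comment> \<open>The coefficient of the linear term in the expansion of \<open>\<bar>R n + D\<bar> powr q\<close>; its product with the
        centred summand integrates to zero.\<close>
    define g where "g x = q * (sgn x * \<bar>x\<bar> powr (q - 1))" for x :: real
    have [measurable]: "g \<in> borel_measurable borel" unfolding g_def[abs_def] by measurable
    have g_abs: "\<bar>g x\<bar> \<le> 2 * \<bar>x\<bar> powr (q - 1)" for x
      using q by (auto simp: g_def abs_mult sgn_if)
    have young: "x powr (q - 1) * y \<le> x powr q + y powr q" if "0 \<le> x" "0 \<le> y" for x y :: real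
    proof (cases "x \<le> y")
      case True
      then have "x powr (q - 1) * y \<le> y powr (q - 1) * y"
        using that q by (intro mult_right_mono powr_mono2) auto
      also have "\<dots> = y powr q" using that by (simp add: powr_diff)
      finally show ?thesis by (simp add: add_increasing)
    next
      case False
      then have "x powr (q - 1) * y \<le> x powr (q - 1) * x"
        using that q by (intro mult_left_mono) auto
      also have "\<dots> = x powr q" using that by (simp add: powr_diff)
      finally show ?thesis by (simp add: add_increasing2)
    qed
    have RS: "R (Suc n) s = R n s + (Y n s - c)" for s
      by (simp add: R_def A_def algebra_simps)
    have int_gY: "integrable S (\<lambda>s. g (R n s) * Y n s)"
    proof (rule Bochner_Integration.integrable_bound[of _ "\<lambda>s. 2 * (\<bar>R n s\<bar> powr q + Y n s powr q)"])
      show "AE s in S. norm (g (R n s) * Y n s) \<le> norm (2 * (\<bar>R n s\<bar> powr q + Y n s powr q))"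
      proof (rule AE_I2)
        fix s
        have "norm (g (R n s) * Y n s) \<le> 2 * \<bar>R n s\<bar> powr (q - 1) * Y n s"
          using g_abs[of "R n s"] nonneg[of n s] by (simp add: abs_mult mult_right_mono)
        also have "\<dots> \<le> 2 * (\<bar>R n s\<bar> powr q + Y n s powr q)"
          using young[of "\<bar>R n s\<bar>" "Y n s"] nonneg[of n s] by simp
        finally show "norm (g (R n s) * Y n s) \<le> norm (2 * (\<bar>R n s\<bar> powr q + Y n s powr q))" by simp
      qed
    qed (use Suc Yq in auto)
    have int_g: "integrable S (\<lambda>s. g (R n s))"
    proof (rule Bochner_Integration.integrable_bound[of _ "\<lambda>s. 2 * (\<bar>R n s\<bar> powr q + 1)"])
      show "AE s in S. norm (g (R n s)) \<le> norm (2 * (\<bar>R n s\<bar> powr q + 1))"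
      proof (rule AE_I2)
        fix s
        show "norm (g (R n s)) \<le> norm (2 * (\<bar>R n s\<bar> powr q + 1))"
          using g_abs[of "R n s"] young[of "\<bar>R n s\<bar>" 1] by simp
      qed
    qed (use Suc in auto)
    have part: "(\<integral>s. p (R n s) * Y n s \<partial>S) = c * (\<integral>s. p (R n s) \<partial>S)"
      if [measurable]: "p \<in> borel_measurable borel" and p: "\<And>x. 0 \<le> p x" for p :: "real \<Rightarrow> real"
    proof -
      have "(\<integral>\<^sup>+s. ennreal (p (R n s)) * ennreal (Y n s) \<partial>S) = ennreal c * (\<integral>\<^sup>+s. ennreal (p (R n s)) \<partial>S)"
        using cond_mean[of "\<lambda>x. ennreal (p (x - real n * c))" n] by (simp add: R_def A_def)
      then show ?thesis
        using p nonneg c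
        by (simp add: integral_eq_nn_integral ennreal_mult enn2real_mult)
    qed
    have "(\<integral>s. g (R n s) * (Y n s - c) \<partial>S) = 0"
    proof -
      define gp gm where "gp x = max 0 (g x)" and "gm x = max 0 (- g x)" for x
      have [measurable]: "gp \<in> borel_measurable borel" "gm \<in> borel_measurable borel"
        unfolding gp_def[abs_def] gm_def[abs_def] by measurable
      have g_split: "g x = gp x - gm x" for x by (auto simp: gp_def gm_def)
      have ints: "integrable S (\<lambda>s. gp (R n s) * Y n s)" "integrable S (\<lambda>s. gm (R n s) * Y n s)"
        "integrable S (\<lambda>s. gp (R n s))" "integrable S (\<lambda>s. gm (R n s))"
        using int_gY int_g
        by (auto elim!: Bochner_Integration.integrable_bound
            simp: gp_def gm_def abs_mult intro!: AE_I2 mult_right_mono)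
      have "(\<integral>s. g (R n s) * (Y n s - c) \<partial>S)
          = (\<integral>s. (gp (R n s) * Y n s - gm (R n s) * Y n s) - (c * gp (R n s) - c * gm (R n s)) \<partial>S)"
        by (intro Bochner_Integration.integral_cong) (auto simp: g_split algebra_simps)
      also have "\<dots> = 0" using ints part[of gp] part[of gm] by (simp add: gp_def gm_def)
      finally show ?thesis .
    qed
    moreover have int_gD: "integrable S (\<lambda>s. g (R n s) * (Y n s - c))"
      using int_gY int_g by (simp add: right_diff_distrib)
    moreover have le: "\<bar>R (Suc n) s\<bar> powr q \<le> \<bar>R n s\<bar> powr q + g (R n s) * (Y n s - c) + 4 * \<bar>Y n s - c\<bar> powr q" for s
      unfolding RS g_def by (rule abs_add_powr_le[OF q])
    moreover have int: "integrable S (\<lambda>s. \<bar>R (Suc n) s\<bar> powr q)"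
      by (rule Bochner_Integration.integrable_bound[of _
        "\<lambda>s. \<bar>R n s\<bar> powr q + g (R n s) * (Y n s - c) + 4 * \<bar>Y n s - c\<bar> powr q"])
        (use Suc Dq int_gD le in \<open>auto intro!: AE_I2 order_trans[OF le abs_ge_self]\<close>)
    moreover have "(\<integral>s. \<bar>R (Suc n) s\<bar> powr q \<partial>S)
        \<le> (\<integral>s. \<bar>R n s\<bar> powr q + g (R n s) * (Y n s - c) + 4 * \<bar>Y n s - c\<bar> powr q \<partial>S)"
      using Suc Dq int_gD int le by (intro integral_mono) auto
    moreover have "\<dots> = (\<integral>s. \<bar>R n s\<bar> powr q \<partial>S) + (\<integral>s. g (R n s) * (Y n s - c) \<partial>S)
        + 4 * (\<integral>s. \<bar>Y n s - c\<bar> powr q \<partial>S)"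
      using Suc Dq int_gD by simp
    moreover have "4 * L * real (Suc n) = 4 * L * real n + 4 * L" by (simp add: algebra_simps)
    ultimately show ?case
      using Suc.IH Dq(2)[of n] by linarith
  qed
  \<comment> \<open>With this exponent the moment bound along \<open>j ^ a\<close> decays at least like \<open>1 / j ^ 2\<close>.\<close>
  define a where "a = nat \<lceil>2 / (q - 1)\<rceil>"
  have a: "2 \<le> real a * (q - 1)"
  proof -
    have "2 / (q - 1) \<le> real a" unfolding a_def by linarith
    then show ?thesis using q by (simp add: field_simps)
  qed
  have a0: "a \<noteq> 0" using a q by (intro notI) simp
  define V where "V j s = \<bar>R (Suc j ^ a) s / real (Suc j ^ a)\<bar> powr q" for j s
  have [measurable]: "V j \<in> borel_measurable S" for j unfolding V_def[abs_def] by measurable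
  have V: "(\<integral>\<^sup>+s. ennreal (V j s) \<partial>S) \<le> ennreal (4 * L * (1 / real (Suc j) ^ 2))" for j
  proof -
    define n where "n = Suc j ^ a"
    have n: "0 < real n" by (simp add: n_def)
    have rn: "real n = real (Suc j) powr real a"
      by (subst powr_realpow) (simp_all add: n_def)
    have V_eq: "V j s = \<bar>R n s\<bar> powr q / real n powr q" for s
      using n by (simp add: V_def n_def abs_divide powr_divide)
    have "(\<integral>\<^sup>+s. ennreal (V j s) \<partial>S) = ennreal (\<integral>s. V j s \<partial>S)"
      using Rq[of n] by (intro nn_integral_eq_integral) (auto simp: V_eq)
    also have "(\<integral>s. V j s \<partial>S) = (\<integral>s. \<bar>R n s\<bar> powr q \<partial>S) / real n powr q"
      by (simp add: V_eq)
    also have "\<dots> \<le> 4 * L * real n / real n powr q"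
      using Rq[of n] by (intro divide_right_mono) auto
    also have "\<dots> = 4 * L * real n powr (1 - q)"
      using n by (simp add: powr_diff)
    also have "real n powr (1 - q) = real (Suc j) powr (- (real a * (q - 1)))"
      unfolding rn powr_powr by (rule arg_cong) (simp add: algebra_simps)
    also have "4 * L * real (Suc j) powr (- (real a * (q - 1))) \<le> 4 * L * real (Suc j) powr (-2)"
      using a L0 by (intro mult_left_mono powr_mono) auto
    also have "real (Suc j) powr (-2) = 1 / real (Suc j) ^ 2"
      by (subst powr_minus, subst powr_numeral) (auto simp: divide_inverse simp del: of_nat_Suc)
    finally show ?thesis by (simp add: ennreal_leI)
  qed
  have sums: "summable (\<lambda>j. 4 * L * (1 / real (Suc j) ^ 2))"
    using inverse_power_summable[of 2, where 'a=real]
    by (intro summable_mult) (subst summable_Suc_iff, simp add: inverse_eq_divide power_one_over)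
  have "(\<integral>\<^sup>+s. (\<Sum>j. ennreal (V j s)) \<partial>S) = (\<Sum>j. \<integral>\<^sup>+s. ennreal (V j s) \<partial>S)"
    by (rule nn_integral_suminf) measurable
  also have "\<dots> \<le> (\<Sum>j. ennreal (4 * L * (1 / real (Suc j) ^ 2)))"
    by (intro suminf_le V) auto
  also have "\<dots> < \<infinity>"
    using sums L0 by (subst suminf_ennreal2) auto
  finally have "AE s in S. (\<Sum>j. ennreal (V j s)) \<noteq> \<infinity>"
    by (intro nn_integral_noteq_infinite) auto
  then show ?thesis
  proof eventually_elim
    case (elim s)
    have "summable (\<lambda>j. V j s)"
      by (rule summable_suminf_not_top) (use elim in \<open>auto simp: V_def\<close>)
    then have "(\<lambda>j. V j s) \<longlonglongrightarrow> 0" by (rule summable_LIMSEQ_zero)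
    then have "(\<lambda>j. V j s powr (1 / q)) \<longlonglongrightarrow> 0 powr (1 / q)"
      using q by (intro tendsto_powr2) (auto simp: V_def)
    then have "(\<lambda>j. \<bar>R (Suc j ^ a) s / real (Suc j ^ a)\<bar>) \<longlonglongrightarrow> 0"
      using q by (simp add: V_def powr_powr del: of_nat_Suc of_nat_power power_Suc)
    then have "(\<lambda>j. R (Suc j ^ a) s / real (Suc j ^ a)) \<longlonglongrightarrow> 0"
      by (simp only: tendsto_rabs_zero_iff)
    moreover have "R (Suc j ^ a) s / real (Suc j ^ a) = A (Suc j ^ a) s / real (Suc j ^ a) - c" for j
      unfolding R_def by (subst diff_divide_distrib) simp
    ultimately have "(\<lambda>j. A (Suc j ^ a) s / real (Suc j ^ a)) \<longlonglongrightarrow> c"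
      by (simp only: LIM_zero_iff)
    then have "(\<lambda>n. A n s / real n) \<longlonglongrightarrow> c"
      using a0 nonneg by (intro LIMSEQ_mean_of_subsequence[of "\<lambda>n. A n s"]) (auto simp: A_def)
    then show ?case by (simp add: A_def)
  qed
qed


section \<open>The exponential martingale of simple processes\<close>

text \<open>Completing the square: an exponential tilt of a centred Gaussian density is a translate of the same
  density, so its mass is that of the untilted one.\<close>

lemma nn_integral_gaussian_tilt:
  fixes a :: "real ^ 'm"
  assumes "0 < \<delta>"
    and mass: "(\<integral>\<^sup>+x. ennreal (\<Prod>i\<in>UNIV. normal_density 0 (sqrt \<delta>) ((x::real^'m) $ i)) \<partial>lborel) = 1"
  shows "(\<integral>\<^sup>+x. ennreal (\<Prod>i\<in>UNIV. normal_density 0 (sqrt \<delta>) ((x::real^'m) $ i))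
            * ennreal (exp (a \<bullet> x - \<delta> / 2 * (a \<bullet> a))) \<partial>lborel) = 1"
proof -
  let ?n = "\<lambda>x::real^'m. \<Prod>i\<in>UNIV. normal_density 0 (sqrt \<delta>) (x $ i)"
  have [measurable]: "(\<lambda>x. ennreal (?n x)) \<in> borel_measurable borel" by measurable
  have tilt: "?n (\<delta> *\<^sub>R a + x) * exp (a \<bullet> (\<delta> *\<^sub>R a + x) - \<delta> / 2 * (a \<bullet> a)) = ?n x" for x
  proof -
    have "exp (a \<bullet> (\<delta> *\<^sub>R a + x) - \<delta> / 2 * (a \<bullet> a))
        = exp (\<Sum>i\<in>UNIV. a $ i * x $ i + \<delta> / 2 * (a $ i)^2)"
    proof (rule arg_cong[of _ _ exp])
      have "a \<bullet> (\<delta> *\<^sub>R a + x) - \<delta> / 2 * (a \<bullet> a)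
          = (\<Sum>i\<in>UNIV. a $ i * (\<delta> * a $ i + x $ i) - \<delta> / 2 * (a $ i * a $ i))"
        by (simp add: inner_vec_def sum_subtractf sum_distrib_left)
      also have "\<dots> = (\<Sum>i\<in>UNIV. a $ i * x $ i + \<delta> / 2 * (a $ i)^2)"
        by (intro sum.cong) (auto simp: field_simps power2_eq_square)
      finally show "a \<bullet> (\<delta> *\<^sub>R a + x) - \<delta> / 2 * (a \<bullet> a)
          = (\<Sum>i\<in>UNIV. a $ i * x $ i + \<delta> / 2 * (a $ i)^2)" .
    qed
    also have "\<dots> = (\<Prod>i\<in>UNIV. exp (a $ i * x $ i + \<delta> / 2 * (a $ i)^2))"
      by (simp add: exp_sum)
    finally have "?n (\<delta> *\<^sub>R a + x) * exp (a \<bullet> (\<delta> *\<^sub>R a + x) - \<delta> / 2 * (a \<bullet> a))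
        = (\<Prod>i\<in>UNIV. normal_density 0 (sqrt \<delta>) (\<delta> * a $ i + x $ i)
              * exp (a $ i * x $ i + \<delta> / 2 * (a $ i)^2))"
      by (simp add: prod.distrib)
    also have "\<dots> = ?n x"
    proof (intro prod.cong refl)
      fix i
      have "- ((\<delta> * a $ i + x $ i)^2) / (2 * \<delta>) + (a $ i * x $ i + \<delta> / 2 * (a $ i)^2)
          = - ((x $ i)^2) / (2 * \<delta>)"
        using assms(1) by (simp add: field_simps power2_eq_square)
      then show "normal_density 0 (sqrt \<delta>) (\<delta> * a $ i + x $ i) * exp (a $ i * x $ i + \<delta> / 2 * (a $ i)^2)
          = normal_density 0 (sqrt \<delta>) (x $ i)"
        using assms(1) by (simp add: normal_density_def exp_add[symmetric])
    qed
    finally show ?thesis .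
  qed
  have "(\<integral>\<^sup>+x. ennreal (?n x) * ennreal (exp (a \<bullet> x - \<delta> / 2 * (a \<bullet> a))) \<partial>lborel)
     = (\<integral>\<^sup>+x. ennreal (?n x) * ennreal (exp (a \<bullet> x - \<delta> / 2 * (a \<bullet> a))) \<partial>distr lborel borel ((+) (\<delta> *\<^sub>R a)))"
    by (simp add: lborel_distr_plus)
  also have "\<dots> = (\<integral>\<^sup>+x. ennreal (?n x) \<partial>lborel)"
    by (subst nn_integral_distr) (simp_all only: ennreal_mult''[OF exp_ge_zero, symmetric] tilt, measurable)
  finally show ?thesis using mass by simp
qed

text \<open>Independence of the increment from the past turns the left side into an iterated integral whose
  inner integral is the mass of a tilted Gaussian density.\<close>

lemma brownian_increment_exponential:
  fixes W :: "real \<Rightarrow> 'a \<Rightarrow> real ^ 'm"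
  assumes "prob_space Q" "filtration_upto T Q F" "brownian_motion T Q F W"
    and st: "0 \<le> s" "s < t" "t \<le> T"
    and G[measurable]: "G \<in> borel_measurable (F s)" and L[measurable]: "L \<in> borel_measurable (F s)"
  shows "(\<integral>\<^sup>+\<omega>. G \<omega> * ennreal (exp (L \<omega> \<bullet> (W t \<omega> - W s \<omega>) - (t - s) / 2 * (L \<omega> \<bullet> L \<omega>))) \<partial>Q)
    = (\<integral>\<^sup>+\<omega>. G \<omega> \<partial>Q)"
proof -
  interpret prob_space Q by fact
  have sub: "subalgebra Q (F r)" if "0 \<le> r" "r \<le> T" for r
    using assms(2) that by (auto simp: filtration_upto_def)
  have subs: "space (F s) = space Q" "sets (F s) \<subseteq> sets Q"
    using sub[of s] st by (auto simp: subalgebra_def)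
  define D where "D \<omega> = W t \<omega> - W s \<omega>" for \<omega>
  define f where "f x = ennreal (\<Prod>i\<in>UNIV. normal_density 0 (sqrt (t - s)) (x $ i))" for x :: "real^'m"
  have W: "W r \<in> borel_measurable Q" if "0 \<le> r" "r \<le> T" for r
  proof -
    have "W r \<in> borel_measurable (F r)" using assms(3) that by (simp add: brownian_motion_def)
    then show ?thesis by (rule measurable_from_subalg[OF sub[OF that]])
  qed
  have [measurable]: "D \<in> borel_measurable Q"
    using W[of s] W[of t] st unfolding D_def[abs_def] by auto
  have dist: "distributed Q lborel D f" and
    ind: "indep_set (sets (F s)) {D -` B \<inter> space Q | B. B \<in> sets borel}"
    using assms(3) st unfolding brownian_motion_def f_def[abs_def] D_def[abs_def] by auto
  have f[measurable]: "f \<in> borel_measurable lborel" and dD: "distr Q lborel D = density lborel f"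
    using dist by (auto simp: distributed_def)
  have mass: "(\<integral>\<^sup>+x. f x \<partial>lborel) = 1"
  proof -
    have "prob_space (distr Q lborel D)" by (rule prob_space_distr) simp
    then have "emeasure (density lborel f) (space (density lborel f)) = 1"
      unfolding dD by (rule prob_space.emeasure_space_1)
    then show ?thesis by (simp add: emeasure_density)
  qed
  have id[measurable]: "(\<lambda>x. x) \<in> measurable Q (F s)"
    using subs by (auto simp: measurable_def)
  interpret D: prob_space "distr Q lborel D" by (rule prob_space_distr) simp
  interpret I: prob_space "distr Q (F s) (\<lambda>x. x)" by (rule prob_space_distr) simp
  have pair: "distr Q (F s) (\<lambda>x. x) \<Otimes>\<^sub>M distr Q lborel D = distr Q (F s \<Otimes>\<^sub>M lborel) (\<lambda>x. (x, D x))"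
  proof (rule pair_measure_eqI)
    fix A B assume "A \<in> sets (distr Q (F s) (\<lambda>x. x))" "B \<in> sets (distr Q lborel D)"
    then have A: "A \<in> sets (F s)" "A \<in> sets Q" "A \<inter> space Q = A" and B: "B \<in> sets borel"
      using subs sets.sets_into_space[of A "F s"] by auto
    have "prob (A \<inter> (D -` B \<inter> space Q)) = prob A * prob (D -` B \<inter> space Q)"
      using ind A B unfolding indep_sets2_eq by blast
    moreover have "(\<lambda>x. (x, D x)) -` (A \<times> B) \<inter> space Q = A \<inter> (D -` B \<inter> space Q)" using A by auto
    ultimately show "emeasure (distr Q (F s) (\<lambda>x. x)) A * emeasure (distr Q lborel D) B
        = emeasure (distr Q (F s \<Otimes>\<^sub>M lborel) (\<lambda>x. (x, D x))) (A \<times> B)"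
      using A B by (simp add: emeasure_distr emeasure_eq_measure ennreal_mult)
  qed (auto intro: I.sigma_finite_measure_axioms D.sigma_finite_measure_axioms sets_pair_measure_cong)
  define H where "H = (\<lambda>(\<omega>, x). G \<omega> * ennreal (exp (L \<omega> \<bullet> x - (t - s) / 2 * (L \<omega> \<bullet> L \<omega>))))"
  have [measurable]: "H \<in> borel_measurable (F s \<Otimes>\<^sub>M lborel)"
    unfolding H_def by measurable
  have Hm: "H \<in> borel_measurable (distr Q (F s) (\<lambda>x. x) \<Otimes>\<^sub>M distr Q lborel D)"
    by measurable
  have "(\<integral>\<^sup>+\<omega>. H (\<omega>, D \<omega>) \<partial>Q) = (\<integral>\<^sup>+z. H z \<partial>distr Q (F s \<Otimes>\<^sub>M lborel) (\<lambda>x. (x, D x)))"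
    by (subst nn_integral_distr) auto
  also have "\<dots> = (\<integral>\<^sup>+\<omega>. (\<integral>\<^sup>+x. H (\<omega>, x) \<partial>distr Q lborel D) \<partial>distr Q (F s) (\<lambda>x. x))"
    unfolding pair[symmetric] by (rule D.nn_integral_fst[OF Hm, symmetric])
  also have "\<dots> = (\<integral>\<^sup>+\<omega>. G \<omega> \<partial>distr Q (F s) (\<lambda>x. x))"
  proof (rule nn_integral_cong)
    fix \<omega> assume "\<omega> \<in> space (distr Q (F s) (\<lambda>x. x))"
    have "(\<integral>\<^sup>+x. H (\<omega>, x) \<partial>distr Q lborel D) = (\<integral>\<^sup>+x. f x * H (\<omega>, x) \<partial>lborel)"
      unfolding dD by (subst nn_integral_density) (auto simp: H_def)
    also have "\<dots> = (\<integral>\<^sup>+x. G \<omega> * (f x * ennreal (exp (L \<omega> \<bullet> x - (t - s) / 2 * (L \<omega> \<bullet> L \<omega>)))) \<partial>lborel)"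
      by (simp add: H_def ac_simps)
    also have "\<dots> = G \<omega> * (\<integral>\<^sup>+x. f x * ennreal (exp (L \<omega> \<bullet> x - (t - s) / 2 * (L \<omega> \<bullet> L \<omega>))) \<partial>lborel)"
      by (rule nn_integral_cmult) measurable
    also have "\<dots> = G \<omega>"
      using nn_integral_gaussian_tilt[of "t - s" "L \<omega>"] mass st by (simp add: f_def)
    finally show "(\<integral>\<^sup>+x. H (\<omega>, x) \<partial>distr Q lborel D) = G \<omega>" .
  qed
  also have "\<dots> = (\<integral>\<^sup>+\<omega>. G \<omega> \<partial>Q)" by (subst nn_integral_distr) auto
  finally show ?thesis by (simp add: H_def D_def)
qed

text \<open>Exponential martingale of a step process that is constant between consecutive grid points; each
  induction step integrates out one Brownian increment.\<close>

lemma exponential_martingale_on_grid: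
  fixes W :: "real \<Rightarrow> 'a \<Rightarrow> real ^ 'm"
  assumes Q: "prob_space Q" "filtration_upto T Q F" "brownian_motion T Q F W"
    and grid: "\<And>i. i \<le> N \<Longrightarrow> \<sigma> i \<in> {0..T}" "\<And>i. i < N \<Longrightarrow> \<sigma> i < \<sigma> (Suc i)"
    and L: "\<And>i. i < N \<Longrightarrow> L i \<in> borel_measurable (F (\<sigma> i))"
  shows "(\<lambda>\<omega>. \<Sum>i<N. L i \<omega> \<bullet> (W (\<sigma> (Suc i)) \<omega> - W (\<sigma> i) \<omega>)
            - (\<sigma> (Suc i) - \<sigma> i) / 2 * (L i \<omega> \<bullet> L i \<omega>)) \<in> borel_measurable (F (\<sigma> N)) \<and>
    (\<integral>\<^sup>+\<omega>. ennreal (exp (\<Sum>i<N. L i \<omega> \<bullet> (W (\<sigma> (Suc i)) \<omega> - W (\<sigma> i) \<omega>)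
            - (\<sigma> (Suc i) - \<sigma> i) / 2 * (L i \<omega> \<bullet> L i \<omega>))) \<partial>Q) = 1"
  using grid L
proof (induction N)
  case 0
  show ?case by (simp add: prob_space.emeasure_space_1[OF Q(1)])
next
  case (Suc N)
  define X where "X = (\<lambda>\<omega>. \<Sum>i<N. L i \<omega> \<bullet> (W (\<sigma> (Suc i)) \<omega> - W (\<sigma> i) \<omega>)
            - (\<sigma> (Suc i) - \<sigma> i) / 2 * (L i \<omega> \<bullet> L i \<omega>))"
  have X[measurable]: "X \<in> borel_measurable (F (\<sigma> N))" and EX: "(\<integral>\<^sup>+\<omega>. ennreal (exp (X \<omega>)) \<partial>Q) = 1"
    using Suc by (auto simp: X_def)
  have range: "0 \<le> \<sigma> N" "\<sigma> N < \<sigma> (Suc N)" "\<sigma> (Suc N) \<le> T"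
    using Suc.prems by (auto simp: less_imp_le)
  have sub: "subalgebra (F (\<sigma> (Suc N))) (F (\<sigma> N))"
    using Q(2) range unfolding filtration_upto_def subalgebra_def by auto
  have "W (\<sigma> (Suc N)) \<in> borel_measurable (F (\<sigma> (Suc N)))" "W (\<sigma> N) \<in> borel_measurable (F (\<sigma> N))"
    using Q(3) range by (auto simp: brownian_motion_def)
  then have [measurable]: "W (\<sigma> (Suc N)) \<in> borel_measurable (F (\<sigma> (Suc N)))"
      "W (\<sigma> N) \<in> borel_measurable (F (\<sigma> (Suc N)))" "L N \<in> borel_measurable (F (\<sigma> (Suc N)))"
      "X \<in> borel_measurable (F (\<sigma> (Suc N)))"
    using Suc.prems(3)[of N] X by (auto intro: measurable_from_subalg[OF sub])
  have [measurable]: "L N \<in> borel_measurable (F (\<sigma> N))" using Suc.prems(3) by simp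
  have "(\<lambda>\<omega>. X \<omega> + (L N \<omega> \<bullet> (W (\<sigma> (Suc N)) \<omega> - W (\<sigma> N) \<omega>)
            - (\<sigma> (Suc N) - \<sigma> N) / 2 * (L N \<omega> \<bullet> L N \<omega>))) \<in> borel_measurable (F (\<sigma> (Suc N)))"
    by measurable
  moreover have "(\<integral>\<^sup>+\<omega>. ennreal (exp (X \<omega> + (L N \<omega> \<bullet> (W (\<sigma> (Suc N)) \<omega> - W (\<sigma> N) \<omega>)
            - (\<sigma> (Suc N) - \<sigma> N) / 2 * (L N \<omega> \<bullet> L N \<omega>)))) \<partial>Q) = 1"
    using brownian_increment_exponential[OF Q range, of "\<lambda>\<omega>. ennreal (exp (X \<omega>))" "L N"] EX
    by (simp add: exp_add ennreal_mult)
  ultimately show ?case by (simp add: X_def)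
qed

lemma grid_less_iff:
  fixes \<sigma> :: "nat \<Rightarrow> real"
  assumes "\<And>i. i < N \<Longrightarrow> \<sigma> i < \<sigma> (Suc i)" "p \<le> N" "q \<le> N"
  shows "\<sigma> p < \<sigma> q \<longleftrightarrow> p < q"
proof -
  have *: "\<sigma> a < \<sigma> b" if "a < b" "b \<le> N" for a b
    using that
  proof (induction b)
    case (Suc b)
    then show ?case
      using assms(1)[of b] by (cases "a = b") (auto intro: less_trans)
  qed simp
  show ?thesis using *[of p q] *[of q p] assms(2,3) by (cases p q rule: linorder_cases) auto
qed

text \<open>Two simple processes with different partitions can only be subtracted after passing to a common
  grid, obtained by sorting the union of their partition points.\<close>

lemma finite_set_as_grid:
  fixes G :: "real set"
  assumes "finite G" "G \<noteq> {}"
  obtains \<sigma> :: "nat \<Rightarrow> real" and N where "\<And>i. i < N \<Longrightarrow> \<sigma> i < \<sigma> (Suc i)" "\<sigma> ` {..N} = G"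
proof
  let ?l = "sorted_list_of_set G"
  have len: "length ?l = Suc (card G - 1)" using assms by (simp add: card_gt_0_iff)
  show "?l ! i < ?l ! Suc i" if "i < card G - 1" for i
    by (rule sorted_wrt_nth_less[OF strict_sorted_list_of_set[of G]]) (use that len in auto)
  have "(!) ?l ` {..card G - 1} = set ?l"
    unfolding set_conv_nth len by (auto simp: less_Suc_eq_le)
  then show "(!) ?l ` {..card G - 1} = G" using assms by simp
qed

lemma grid_telescope:
  fixes \<sigma> :: "nat \<Rightarrow> real" and V :: "real \<Rightarrow> 'b::real_normed_vector"
  assumes grid: "\<And>i. i < N \<Longrightarrow> \<sigma> i < \<sigma> (Suc i)" and pq: "p \<le> q" "q \<le> N"
  shows "(\<Sum>i<N. indicator {\<sigma> p<..\<sigma> q} (\<sigma> (Suc i)) *\<^sub>R (V (\<sigma> (Suc i)) - V (\<sigma> i))) = V (\<sigma> q) - V (\<sigma> p)"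
proof -
  have "(indicator {\<sigma> p<..\<sigma> q} (\<sigma> (Suc i)) :: real) = indicator {p..<q} i" if "i < N" for i
    using grid_less_iff[of N \<sigma> p "Suc i"] grid_less_iff[of N \<sigma> q "Suc i"] grid pq that
    by (auto simp: indicator_def not_less[symmetric])
  then have "(\<Sum>i<N. indicator {\<sigma> p<..\<sigma> q} (\<sigma> (Suc i)) *\<^sub>R (V (\<sigma> (Suc i)) - V (\<sigma> i)))
     = (\<Sum>i<N. indicator {p..<q} i *\<^sub>R (V (\<sigma> (Suc i)) - V (\<sigma> i)))"
    by (intro sum.cong) auto
  also have "\<dots> = (\<Sum>i\<in>{p..<q}. V (\<sigma> (Suc i)) - V (\<sigma> i))"
    using pq by (intro sum.mono_neutral_cong_right) (auto simp: indicator_def)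
  also have "\<dots> = V (\<sigma> q) - V (\<sigma> p)"
    using sum_Suc_diff'[OF pq(1), of "\<lambda>i. V (\<sigma> i)"] by simp
  finally show ?thesis .
qed

lemma simple_process_times:
  assumes "simple_process F t n \<tau> \<xi>" "i \<le> n"
  shows "0 \<le> \<tau> i" "\<tau> i \<le> t" 
proof -
  have mono: "\<tau> a \<le> \<tau> b" if "a \<le> b" "b \<le> n" for a b
    using that
  proof (induction b)
    case (Suc b)
    have "\<tau> b \<le> \<tau> (Suc b)" using assms(1) Suc.prems by (simp add: simple_process_def)
    then show ?case
      using Suc by (cases "a = Suc b") auto
  qed simp
  show "0 \<le> \<tau> i" "\<tau> i \<le> t"
    using mono[of 0 i] mono[of i n] assms by (auto simp: simple_process_def)
qed

text \<open>A simple process read off on a refinement \<open>\<sigma>\<close> of its partition: on each cell it equals its value at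
  the right endpoint, and that value is known at the left endpoint.\<close>

context
  fixes F :: "real \<Rightarrow> 'a measure" and T :: real and n :: nat and \<tau> :: "nat \<Rightarrow> real"
    and \<xi> :: "nat \<Rightarrow> 'a \<Rightarrow> real ^ 'm" and \<sigma> :: "nat \<Rightarrow> real" and N :: nat
  assumes simple: "simple_process F T n \<tau> \<xi>"
    and grid: "\<And>i. i < N \<Longrightarrow> \<sigma> i < \<sigma> (Suc i)"
    and refines: "\<tau> ` {..n} \<subseteq> \<sigma> ` {..N}"
begin

lemma simple_integral_on_refinement:
  "simple_integral_wrt V n \<tau> \<xi> \<omega>
    = (\<Sum>i<N. simple_value n \<tau> \<xi> (\<sigma> (Suc i)) \<omega> \<bullet> (V (\<sigma> (Suc i)) \<omega> - V (\<sigma> i) \<omega>))"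
proof -
  have "\<xi> j \<omega> \<bullet> (V (\<tau> (Suc j)) \<omega> - V (\<tau> j) \<omega>)
      = (\<Sum>i<N. (indicator {\<tau> j<..\<tau> (Suc j)} (\<sigma> (Suc i)) *\<^sub>R \<xi> j \<omega>) \<bullet> (V (\<sigma> (Suc i)) \<omega> - V (\<sigma> i) \<omega>))"
    if "j < n" for j
  proof -
    have "\<tau> j \<in> \<sigma> ` {..N}" "\<tau> (Suc j) \<in> \<sigma> ` {..N}"
      using refines that by (auto simp: image_subset_iff)
    then obtain p q where pq: "\<tau> j = \<sigma> p" "p \<le> N" "\<tau> (Suc j) = \<sigma> q" "q \<le> N"
      by auto
    moreover have "\<tau> j \<le> \<tau> (Suc j)" using simple that by (simp add: simple_process_def)
    ultimately have "p \<le> q" using grid_less_iff[of N \<sigma> q p] grid by (simp add: not_less[symmetric])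
    then have "\<xi> j \<omega> \<bullet> (V (\<tau> (Suc j)) \<omega> - V (\<tau> j) \<omega>)
      = \<xi> j \<omega> \<bullet> (\<Sum>i<N. indicator {\<sigma> p<..\<sigma> q} (\<sigma> (Suc i)) *\<^sub>R (V (\<sigma> (Suc i)) \<omega> - V (\<sigma> i) \<omega>))"
      using grid_telescope[of N \<sigma> p q "\<lambda>t. V t \<omega>"] grid pq by simp
    then show ?thesis by (simp add: inner_sum_right pq)
  qed
  then have "simple_integral_wrt V n \<tau> \<xi> \<omega>
    = (\<Sum>j<n. \<Sum>i<N. (indicator {\<tau> j<..\<tau> (Suc j)} (\<sigma> (Suc i)) *\<^sub>R \<xi> j \<omega>) \<bullet> (V (\<sigma> (Suc i)) \<omega> - V (\<sigma> i) \<omega>))"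
    by (simp add: simple_integral_wrt_def)
  then show ?thesis
    by (subst (asm) sum.swap) (simp add: simple_value_def inner_sum_left)
qed

lemma simple_value_on_refinement:
  assumes "i < N" "\<sigma> i < s" "s \<le> \<sigma> (Suc i)"
  shows "simple_value n \<tau> \<xi> s \<omega> = simple_value n \<tau> \<xi> (\<sigma> (Suc i)) \<omega>"
proof -
  have key: "(\<sigma> p < s \<longleftrightarrow> \<sigma> p < \<sigma> (Suc i)) \<and> (s \<le> \<sigma> p \<longleftrightarrow> \<sigma> (Suc i) \<le> \<sigma> p)" if "p \<le> N" for p
  proof (cases "p \<le> i")
    case True
    then have "\<sigma> p \<le> \<sigma> i" using grid_less_iff[of N \<sigma> i p] grid that assms(1) by (auto simp: not_less[symmetric])
    then show ?thesis using assms by auto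
  next
    case False
    then have "\<sigma> (Suc i) \<le> \<sigma> p"
      using grid_less_iff[of N \<sigma> p "Suc i"] grid that assms(1) by (auto simp: not_less[symmetric])
    then show ?thesis using assms by auto
  qed
  have "(indicator {\<tau> j<..\<tau> (Suc j)} s :: real) = indicator {\<tau> j<..\<tau> (Suc j)} (\<sigma> (Suc i))" if "j < n" for j
  proof -
    have "\<tau> j \<in> \<sigma> ` {..N}" "\<tau> (Suc j) \<in> \<sigma> ` {..N}"
      using refines that by (auto simp: image_subset_iff)
    then obtain p q where pq: "\<tau> j = \<sigma> p" "p \<le> N" "\<tau> (Suc j) = \<sigma> q" "q \<le> N"
      by auto
    then show ?thesis using key[of p] key[of q] by (simp add: indicator_def)
  qed
  then show ?thesis by (simp add: simple_value_def)
qed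

lemma simple_value_refinement_measurable:
  assumes F: "filtration_upto T M F" and i: "i < N" and \<sigma>: "\<sigma> i \<in> {0..T}"
  shows "simple_value n \<tau> \<xi> (\<sigma> (Suc i)) \<in> borel_measurable (F (\<sigma> i))"
proof -
  have "(\<lambda>\<omega>. indicator {\<tau> j<..\<tau> (Suc j)} (\<sigma> (Suc i)) *\<^sub>R \<xi> j \<omega>) \<in> borel_measurable (F (\<sigma> i))"
    if j: "j < n" for j
  proof (cases "\<tau> j < \<sigma> (Suc i)")
    case True
    have "\<tau> j \<in> \<sigma> ` {..N}" using refines j by (auto simp: image_subset_iff)
    then obtain p where p: "\<tau> j = \<sigma> p" "p \<le> N" by auto
    then have "p \<le> i" using True grid_less_iff[of N \<sigma> p "Suc i"] grid i by auto
    then have "\<tau> j \<le> \<sigma> i"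
      using grid_less_iff[of N \<sigma> i p] grid p i by (auto simp: not_less[symmetric])
    then have "subalgebra (F (\<sigma> i)) (F (\<tau> j))"
      using F \<sigma> simple_process_times[OF simple, of j] j
      by (auto simp: filtration_upto_def subalgebra_def)
    moreover have "\<xi> j \<in> borel_measurable (F (\<tau> j))"
      using simple j by (simp add: simple_process_def)
    ultimately have "\<xi> j \<in> borel_measurable (F (\<sigma> i))" by (rule measurable_from_subalg)
    then show ?thesis by measurable
  qed (simp add: indicator_def)
  then show ?thesis
    unfolding simple_value_def[abs_def] by (intro borel_measurable_sum) auto
qed

end

text \<open>Turns time into a finite measure space, as the pathwise mean-square limits below require.\<close>

abbreviation time_measure :: "real \<Rightarrow> real measure" where
  "time_measure T \<equiv> restrict_space lborel {0..T}"

lemma finite_time_measure: "finite_measure (time_measure T)"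
  by (rule finite_measureI) (simp add: space_restrict_space emeasure_restrict_space emeasure_lborel_Icc_eq)

text \<open>On the common grid the difference of the two processes is a step process, and its energy is a finite
  sum, so the exponential martingale on that grid applies. The case of two processes, rather than one,
  is what allows comparing two approximations of the same stochastic integral.\<close>

lemma simple_difference_exponential:
  fixes W :: "real \<Rightarrow> 'a \<Rightarrow> real ^ 'm"
  assumes Q: "prob_space Q" "filtration_upto T Q F" "brownian_motion T Q F W"
    and simple: "simple_process F T n \<tau> \<xi>" "simple_process F T n' \<tau>' \<xi>'"
  defines "X \<equiv> \<lambda>\<omega>. simple_integral_wrt W n \<tau> \<xi> \<omega> - simple_integral_wrt W n' \<tau>' \<xi>' \<omega>
      - (\<integral>s. (norm (simple_value n \<tau> \<xi> s \<omega> - simple_value n' \<tau>' \<xi>' s \<omega>))^2 \<partial>time_measure T) / 2"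
  shows "X \<in> borel_measurable Q \<and> (\<integral>\<^sup>+\<omega>. ennreal (exp (X \<omega>)) \<partial>Q) = 1"
proof -
  obtain \<sigma> :: "nat \<Rightarrow> real" and N where grid: "\<And>i. i < N \<Longrightarrow> \<sigma> i < \<sigma> (Suc i)"
    and \<sigma>: "\<sigma> ` {..N} = \<tau> ` {..n} \<union> \<tau>' ` {..n'}"
    by (rule finite_set_as_grid[of "\<tau> ` {..n} \<union> \<tau>' ` {..n'}"]) auto
  have ref: "\<tau> ` {..n} \<subseteq> \<sigma> ` {..N}" "\<tau>' ` {..n'} \<subseteq> \<sigma> ` {..N}" using \<sigma> by auto
  have \<sigma>T: "\<sigma> i \<in> {0..T}" if "i \<le> N" for i
  proof -
    have "\<sigma> i \<in> \<tau> ` {..n} \<union> \<tau>' ` {..n'}" using that by (subst \<sigma>[symmetric]) auto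
    then show ?thesis using simple_process_times[OF simple(1)] simple_process_times[OF simple(2)] by auto
  qed
  have ends: "\<sigma> 0 = 0" "\<sigma> N = T"
  proof -
    have "\<tau> 0 = 0" "\<tau> n = T" using simple(1) by (auto simp: simple_process_def)
    moreover have "\<tau> 0 \<in> \<sigma> ` {..N}" "\<tau> n \<in> \<sigma> ` {..N}" using ref(1) by auto
    ultimately have "0 \<in> \<sigma> ` {..N}" "T \<in> \<sigma> ` {..N}" by auto
    then obtain p q where "p \<le> N" "\<sigma> p = 0" "q \<le> N" "\<sigma> q = T" by auto
    then have "\<not> 0 < \<sigma> 0" "\<not> \<sigma> N < T"
      using grid_less_iff[of N \<sigma> p 0] grid_less_iff[of N \<sigma> N q] grid by auto
    then show "\<sigma> 0 = 0" "\<sigma> N = T" using \<sigma>T[of 0] \<sigma>T[of N] by auto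
  qed
  have less: "\<sigma> p < \<sigma> q \<longleftrightarrow> p < q" if "p \<le> N" "q \<le> N" for p q
    by (rule grid_less_iff[where N = N]) (use grid that in auto)
  define L where "L i \<omega> = simple_value n \<tau> \<xi> (\<sigma> (Suc i)) \<omega> - simple_value n' \<tau>' \<xi>' (\<sigma> (Suc i)) \<omega>" for i \<omega>
  have Lm: "L i \<in> borel_measurable (F (\<sigma> i))" if "i < N" for i
    unfolding L_def[abs_def]
    using simple_value_refinement_measurable[where \<sigma> = \<sigma> and N = N, OF simple(1) grid ref(1) Q(2) that \<sigma>T]
      simple_value_refinement_measurable[where \<sigma> = \<sigma> and N = N, OF simple(2) grid ref(2) Q(2) that \<sigma>T] that
    by (intro borel_measurable_diff) simp_all
  have energy: "(\<integral>s. (norm (simple_value n \<tau> \<xi> s \<omega> - simple_value n' \<tau>' \<xi>' s \<omega>))^2 \<partial>time_measure T)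
      = (\<Sum>i<N. (\<sigma> (Suc i) - \<sigma> i) * (L i \<omega> \<bullet> L i \<omega>))" for \<omega>
  proof -
    \<comment> \<open>Time zero lies in no cell of the grid, but it is a null set.\<close>
    have step: "indicator {0..T} s * (norm (simple_value n \<tau> \<xi> s \<omega> - simple_value n' \<tau>' \<xi>' s \<omega>))^2
        = (\<Sum>i<N. indicator {\<sigma> i<..\<sigma> (Suc i)} s * (L i \<omega> \<bullet> L i \<omega>))" if "s \<noteq> 0" for s
    proof (cases "s \<in> {0..T}")
      case False
      then have "(indicator {\<sigma> i<..\<sigma> (Suc i)} s :: real) = 0" if "i < N" for i
        using \<sigma>T[of i] \<sigma>T[of "Suc i"] that by (auto simp: indicator_def)
      then have "(\<Sum>i<N. indicator {\<sigma> i<..\<sigma> (Suc i)} s * (L i \<omega> \<bullet> L i \<omega>)) = 0"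
        by (intro sum.neutral) simp
      then show ?thesis using False by simp
    next
      case True
      with that have s: "0 < s" "s \<le> T" by auto
      \<comment> \<open>the cell containing \<open>s\<close> ends at the first grid point not before \<open>s\<close>\<close>
      define k where "k = (LEAST k. s \<le> \<sigma> k)"
      have "s \<le> \<sigma> N" using s ends by simp
      then have k: "s \<le> \<sigma> k" "k \<le> N"
        unfolding k_def using LeastI[of "\<lambda>k. s \<le> \<sigma> k" N] Least_le[of "\<lambda>k. s \<le> \<sigma> k" N] by blast+
      have kmin: "\<sigma> j < s" if "j < k" for j
        using not_less_Least[of j "\<lambda>k. s \<le> \<sigma> k"] that unfolding k_def by linarith
      have "k \<noteq> 0" using k(1) s ends by (intro notI) simp
      then obtain i where i: "k = Suc i" by (cases k) auto
      have iN: "i < N" "\<sigma> i < s" "s \<le> \<sigma> (Suc i)" using k kmin i by auto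
      have e1: "simple_value n \<tau> \<xi> s \<omega> = simple_value n \<tau> \<xi> (\<sigma> (Suc i)) \<omega>"
        by (rule simple_value_on_refinement[where \<sigma> = \<sigma> and N = N, OF simple(1) grid ref(1) iN])
      have e2: "simple_value n' \<tau>' \<xi>' s \<omega> = simple_value n' \<tau>' \<xi>' (\<sigma> (Suc i)) \<omega>"
        by (rule simple_value_on_refinement[where \<sigma> = \<sigma> and N = N, OF simple(2) grid ref(2) iN])
      have "(\<Sum>j<N. indicator {\<sigma> j<..\<sigma> (Suc j)} s * (L j \<omega> \<bullet> L j \<omega>))
          = (\<Sum>j<N. if j = i then L i \<omega> \<bullet> L i \<omega> else 0)"
      proof (rule sum.cong[OF refl])
        fix j assume j: "j \<in> {..<N}"
        have "j = i" if js: "\<sigma> j < s" "s \<le> \<sigma> (Suc j)"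
        proof -
          have "\<sigma> j < \<sigma> (Suc i)" "\<sigma> i < \<sigma> (Suc j)" using js iN by linarith+
          then show "j = i" using less[of j "Suc i"] less[of i "Suc j"] iN j by simp
        qed
        then have "(\<sigma> j < s \<and> s \<le> \<sigma> (Suc j)) = (j = i)" using iN by blast
        then show "indicator {\<sigma> j<..\<sigma> (Suc j)} s * (L j \<omega> \<bullet> L j \<omega>) = (if j = i then L i \<omega> \<bullet> L i \<omega> else 0)"
          by (simp add: indicator_def)
      qed
      also have "\<dots> = L i \<omega> \<bullet> L i \<omega>" using iN by simp
      finally show ?thesis
        using True e1 e2 by (simp add: L_def power2_norm_eq_inner)
    qed
    have "(\<integral>s. (norm (simple_value n \<tau> \<xi> s \<omega> - simple_value n' \<tau>' \<xi>' s \<omega>))^2 \<partial>time_measure T)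
        = (\<integral>s. indicator {0..T} s * (norm (simple_value n \<tau> \<xi> s \<omega> - simple_value n' \<tau>' \<xi>' s \<omega>))^2 \<partial>lborel)"
      by (subst integral_restrict_space) auto
    also have "\<dots> = (\<integral>s. (\<Sum>i<N. indicator {\<sigma> i<..\<sigma> (Suc i)} s * (L i \<omega> \<bullet> L i \<omega>)) \<partial>lborel)"
    proof (rule integral_cong_AE)
      show "AE s in lborel. indicator {0..T} s * (norm (simple_value n \<tau> \<xi> s \<omega> - simple_value n' \<tau>' \<xi>' s \<omega>))^2
          = (\<Sum>i<N. indicator {\<sigma> i<..\<sigma> (Suc i)} s * (L i \<omega> \<bullet> L i \<omega>))"
        using AE_lborel_singleton[of 0] by eventually_elim (rule step)
    qed (unfold simple_value_def, measurable)
    also have "\<dots> = (\<Sum>i<N. (\<sigma> (Suc i) - \<sigma> i) * (L i \<omega> \<bullet> L i \<omega>))"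
    proof -
      have "has_bochner_integral lborel (\<lambda>s. indicator {\<sigma> i<..\<sigma> (Suc i)} s * (L i \<omega> \<bullet> L i \<omega>))
          ((\<sigma> (Suc i) - \<sigma> i) * (L i \<omega> \<bullet> L i \<omega>))" if "i < N" for i
      proof (rule has_bochner_integral_mult_left)
        have "\<sigma> i \<le> \<sigma> (Suc i)" using grid[OF that] by simp
        then show "has_bochner_integral lborel (indicator {\<sigma> i<..\<sigma> (Suc i)}) (\<sigma> (Suc i) - \<sigma> i)"
          using has_bochner_integral_real_indicator[of "{\<sigma> i<..\<sigma> (Suc i)}" lborel] by simp
      qed
      then show ?thesis
        by (intro has_bochner_integral_integral_eq has_bochner_integral_sum) simp
    qed
    finally show ?thesis .
  qed
  have si:
    "simple_integral_wrt W n \<tau> \<xi> \<omega>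
      = (\<Sum>i<N. simple_value n \<tau> \<xi> (\<sigma> (Suc i)) \<omega> \<bullet> (W (\<sigma> (Suc i)) \<omega> - W (\<sigma> i) \<omega>))"
    "simple_integral_wrt W n' \<tau>' \<xi>' \<omega>
      = (\<Sum>i<N. simple_value n' \<tau>' \<xi>' (\<sigma> (Suc i)) \<omega> \<bullet> (W (\<sigma> (Suc i)) \<omega> - W (\<sigma> i) \<omega>))" for \<omega>
    by (rule simple_integral_on_refinement[OF simple(1) _ ref(1)]; use grid in blast)
      (rule simple_integral_on_refinement[OF simple(2) _ ref(2)]; use grid in blast)
  have X: "X \<omega> = (\<Sum>i<N. L i \<omega> \<bullet> (W (\<sigma> (Suc i)) \<omega> - W (\<sigma> i) \<omega>) - (\<sigma> (Suc i) - \<sigma> i) / 2 * (L i \<omega> \<bullet> L i \<omega>))" for \<omega>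
    unfolding X_def energy si sum_divide_distrib sum_subtractf[symmetric]
    by (intro sum.cong refl) (simp add: L_def inner_diff_left)
  have "X \<in> borel_measurable (F (\<sigma> N)) \<and> (\<integral>\<^sup>+\<omega>. ennreal (exp (X \<omega>)) \<partial>Q) = 1"
    using exponential_martingale_on_grid[where \<sigma> = \<sigma> and N = N and L = L, OF Q \<sigma>T grid Lm] unfolding X[abs_def] by simp
  moreover have "subalgebra Q (F (\<sigma> N))" using Q(2) \<sigma>T[of N] by (simp add: filtration_upto_def)
  ultimately show ?thesis by (blast intro: measurable_from_subalg)
qed


section \<open>Limits of simple stochastic integrals\<close>

text \<open>Almost everywhere limits carry over between equivalent measures, and they can be combined path by path
  with the bound on the control. Therefore the limits in probability that define stochastic integrals
  are replaced by almost everywhere limits along subsequences.\<close>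

lemma AE_subsequence_of_tendsto_0_in_prob:
  assumes "finite_measure M" and [measurable]: "\<And>j. Z j \<in> borel_measurable M"
    and lim: "tendsto_0_in_prob M Z"
  obtains r :: "nat \<Rightarrow> nat" where "strict_mono r" "AE \<omega> in M. (\<lambda>k. Z (r k) \<omega>) \<longlonglongrightarrow> 0"
proof -
  interpret finite_measure M by fact
  define P where "P k j \<longleftrightarrow> measure M {\<omega> \<in> space M. ennreal ((1/2)^k) < Z j \<omega>} < (1/2)^k" for k j :: nat
  have P: "\<exists>j>i. P k j" for k i
  proof -
    have "(\<lambda>j. measure M {\<omega> \<in> space M. ennreal ((1/2)^k) < Z j \<omega>}) \<longlonglongrightarrow> 0"
      using lim by (simp add: tendsto_0_in_prob_def)
    then have "eventually (P k) sequentially"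
      unfolding P_def by (rule order_tendstoD) simp
    then obtain n where "\<And>j. n \<le> j \<Longrightarrow> P k j" by (auto simp: eventually_sequentially)
    then show ?thesis by (intro exI[of _ "max n (Suc i)"]) auto
  qed
  then obtain r where r: "\<And>k. P k (r k)" "\<And>k. r k < r (Suc k)"
    using dependent_nat_choice[of P "\<lambda>k i j. i < j"] by blast
  show thesis
  proof
    show "strict_mono r" using r(2) by (simp add: strict_mono_Suc_iff)
    define A where "A k = {\<omega> \<in> space M. ennreal ((1/2)^k) < Z (r k) \<omega>}" for k
    have "AE \<omega> in M. eventually (\<lambda>k. \<omega> \<in> space M - A k) sequentially"
    proof (rule borel_cantelli_AE1)
      show "A k \<in> sets M" for k unfolding A_def by measurable
      show "emeasure M (A k) < \<infinity>" for k by (simp add: less_top[symmetric])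
      show "summable (\<lambda>k. measure M (A k))"
        by (rule summable_comparison_test[of _ "\<lambda>k. (1/2)^k"])
          (use r(1) in \<open>auto simp: A_def P_def intro!: exI[of _ 0] less_imp_le\<close>)
    qed
    then show "AE \<omega> in M. (\<lambda>k. Z (r k) \<omega>) \<longlonglongrightarrow> 0"
    proof eventually_elim
      case (elim \<omega>)
      have "(\<lambda>k. (1/2::real)^k) \<longlonglongrightarrow> 0" by (rule LIMSEQ_realpow_zero) auto
      then have half: "(\<lambda>k. ennreal ((1/2)^k)) \<longlonglongrightarrow> 0"
        using tendsto_ennrealI by fastforce
      show ?case
      proof (rule tendsto_sandwich[OF _ _ tendsto_const half])
        show "\<forall>\<^sub>F k in sequentially. Z (r k) \<omega> \<le> ennreal ((1/2)^k)"
          using elim by eventually_elim (auto simp: A_def not_less)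
      qed simp
    qed
  qed
qed

lemma integrable_bounded_finite_measure:
  fixes f :: "'s \<Rightarrow> 'b::{banach, second_countable_topology}"
  assumes "finite_measure M" "f \<in> borel_measurable M" "\<And>x. x \<in> space M \<Longrightarrow> norm (f x) \<le> B"
  shows "integrable M f"
  using assms by (intro finite_measure.integrable_const_bound[of M f B]) auto

text \<open>The pathwise limits needed for the drift and for the energy. Mean-square convergence gives mean
  convergence on a finite measure space because the variance is nonnegative, and the limit \<open>g\<close> is bounded.\<close>

lemma L2_tendsto_imp_inner_tendsto:
  fixes f :: "nat \<Rightarrow> 's \<Rightarrow> 'b::euclidean_space"
  assumes M: "finite_measure M"
    and [measurable]: "\<And>j. f j \<in> borel_measurable M" "g \<in> borel_measurable M"
    and fB: "\<And>j x. x \<in> space M \<Longrightarrow> norm (f j x) \<le> B j" and gC: "\<And>x. x \<in> space M \<Longrightarrow> norm (g x) \<le> C"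
    and lim: "(\<lambda>j. \<integral>\<^sup>+x. ennreal ((norm (f j x - g x))^2) \<partial>M) \<longlonglongrightarrow> 0"
  shows "(\<lambda>j. \<integral>x. (norm (f j x - g x))^2 \<partial>M) \<longlonglongrightarrow> 0"
    "(\<lambda>j. \<integral>x. f j x \<bullet> g x \<partial>M) \<longlonglongrightarrow> (\<integral>x. g x \<bullet> g x \<partial>M)"
    "(\<lambda>j. \<integral>x. (norm (f j x))^2 \<partial>M) \<longlonglongrightarrow> (\<integral>x. g x \<bullet> g x \<partial>M)"
proof -
  interpret finite_measure M by fact
  define d where "d j = (\<integral>x. (norm (f j x - g x))^2 \<partial>M)" for j
  define e where "e j = (\<integral>x. norm (f j x - g x) \<partial>M)" for j
  define m where "m = measure M (space M)"
  have diffB: "norm (f j x - g x) \<le> B j + C" if "x \<in> space M" for j x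
    using norm_triangle_ineq4[of "f j x" "g x"] fB[OF that, of j] gC[OF that] by linarith
  have int2: "integrable M (\<lambda>x. (norm (f j x - g x))^2)" for j
    using diffB by (intro integrable_bounded_finite_measure[OF M, of _ "(B j + C)^2"])
      (auto intro!: power_mono)
  have int1: "integrable M (\<lambda>x. norm (f j x - g x))" for j
    using diffB by (intro integrable_bounded_finite_measure[OF M, of _ "B j + C"]) auto
  have intgg: "integrable M (\<lambda>x. g x \<bullet> g x)"
    using gC by (intro integrable_bounded_finite_measure[OF M, of _ "C^2"])
      (auto simp: dot_square_norm intro!: power_mono)
  have intfg: "integrable M (\<lambda>x. (f j x - g x) \<bullet> g x)" for j
  proof (intro integrable_bounded_finite_measure[OF M, of _ "(B j + C) * C"])
    fix x assume x: "x \<in> space M"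
    have "\<bar>(f j x - g x) \<bullet> g x\<bar> \<le> norm (f j x - g x) * norm (g x)" by (rule Cauchy_Schwarz_ineq2)
    also have "\<dots> \<le> (B j + C) * C"
      using diffB[OF x, of j] gC[OF x] norm_ge_zero[of "f j x - g x"]
      by (intro mult_mono norm_ge_zero) linarith+
    finally show "norm ((f j x - g x) \<bullet> g x) \<le> (B j + C) * C" by simp
  qed measurable
  have d0: "0 \<le> d j" for j by (simp add: d_def)
  have "(\<lambda>j. ennreal (d j)) \<longlonglongrightarrow> ennreal 0"
    using lim int2 by (simp add: d_def nn_integral_eq_integral)
  then have d: "d \<longlonglongrightarrow> 0" using d0 by (subst (asm) tendsto_ennreal_iff) auto
  then show "(\<lambda>j. \<integral>x. (norm (f j x - g x))^2 \<partial>M) \<longlonglongrightarrow> 0" unfolding d_def[abs_def] .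
  \<comment> \<open>the variance of \<open>norm (f j - g)\<close> is nonnegative\<close>
  have e_sq: "(e j)^2 \<le> m * d j" for j
  proof (cases "m = 0")
    case True
    have "e j \<le> (\<integral>x. B j + C \<partial>M)" unfolding e_def using int1 diffB by (intro integral_mono) auto
    also have "\<dots> = 0" using True by (simp add: m_def)
    finally have "e j = 0" by (intro antisym) (simp_all add: e_def)
    then show ?thesis using True by simp
  next
    case False
    then have m: "0 < m" by (simp add: m_def zero_less_measure_iff)
    have "0 \<le> (\<integral>x. (m * norm (f j x - g x) - e j)^2 \<partial>M)" by simp
    also have "\<dots> = (\<integral>x. m^2 * (norm (f j x - g x))^2 - (2 * m * e j) * norm (f j x - g x) + (e j)^2 \<partial>M)"
      by (intro Bochner_Integration.integral_cong) (auto simp: power2_eq_square algebra_simps)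
    also have "\<dots> = m^2 * d j - 2 * m * e j * e j + (e j)^2 * m"
      using int1 int2 by (simp add: d_def e_def m_def)
    also have "\<dots> = m * (m * d j - (e j)^2)" by (simp add: power2_eq_square algebra_simps)
    finally show ?thesis using m by (simp add: zero_le_mult_iff)
  qed
  have "(\<lambda>j. m * d j) \<longlonglongrightarrow> 0" using tendsto_mult_left[OF d, of m] by simp
  then have "(\<lambda>j. (e j)^2) \<longlonglongrightarrow> 0"
    by (rule tendsto_sandwich[where f = "\<lambda>_. 0" and h = "\<lambda>j. m * d j", rotated 3]) (simp_all add: e_sq)
  then have e: "e \<longlonglongrightarrow> 0" by (simp add: power_tendsto_0_iff)
  have cross: "(\<lambda>j. \<integral>x. (f j x - g x) \<bullet> g x \<partial>M) \<longlonglongrightarrow> 0"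
  proof (rule tendsto_rabs_zero_cancel, rule tendsto_sandwich[where f = "\<lambda>_. 0" and h = "\<lambda>j. C * e j"])
    show "(\<lambda>j. C * e j) \<longlonglongrightarrow> 0" using tendsto_mult_left[OF e, of C] by simp
    show "\<forall>\<^sub>F j in sequentially. \<bar>\<integral>x. (f j x - g x) \<bullet> g x \<partial>M\<bar> \<le> C * e j"
    proof (rule always_eventually, rule allI)
      fix j
      have "\<bar>\<integral>x. (f j x - g x) \<bullet> g x \<partial>M\<bar> \<le> (\<integral>x. \<bar>(f j x - g x) \<bullet> g x\<bar> \<partial>M)"
        by (rule integral_abs_bound)
      also have "\<dots> \<le> (\<integral>x. C * norm (f j x - g x) \<partial>M)"
      proof (rule integral_mono)
        fix x assume x: "x \<in> space M"
        have "\<bar>(f j x - g x) \<bullet> g x\<bar> \<le> norm (f j x - g x) * norm (g x)" by (rule Cauchy_Schwarz_ineq2)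
        also have "\<dots> \<le> norm (f j x - g x) * C" using gC[OF x] by (intro mult_left_mono) auto
        finally show "\<bar>(f j x - g x) \<bullet> g x\<bar> \<le> C * norm (f j x - g x)" by (simp add: mult.commute)
      qed (use intfg int1 in auto)
      finally show "\<bar>\<integral>x. (f j x - g x) \<bullet> g x \<partial>M\<bar> \<le> C * e j" by (simp add: e_def)
    qed
  qed auto
  have fg: "(\<integral>x. f j x \<bullet> g x \<partial>M) = (\<integral>x. (f j x - g x) \<bullet> g x \<partial>M) + (\<integral>x. g x \<bullet> g x \<partial>M)" for j
    using intfg[of j] intgg by (subst Bochner_Integration.integral_add[symmetric]) (auto simp: inner_diff_left)
  show fg_lim: "(\<lambda>j. \<integral>x. f j x \<bullet> g x \<partial>M) \<longlonglongrightarrow> (\<integral>x. g x \<bullet> g x \<partial>M)"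
    using tendsto_add[OF cross tendsto_const[of "\<integral>x. g x \<bullet> g x \<partial>M"]] by (simp add: fg)
  have "(\<integral>x. (norm (f j x))^2 \<partial>M) = d j + 2 * (\<integral>x. (f j x - g x) \<bullet> g x \<partial>M) + (\<integral>x. g x \<bullet> g x \<partial>M)" for j
  proof -
    have "(\<integral>x. (norm (f j x))^2 \<partial>M)
        = (\<integral>x. (norm (f j x - g x))^2 + 2 * ((f j x - g x) \<bullet> g x) + g x \<bullet> g x \<partial>M)"
      by (intro Bochner_Integration.integral_cong)
        (auto simp: power2_norm_eq_inner inner_diff_left inner_diff_right inner_commute algebra_simps)
    then show ?thesis using int2 intfg intgg by (simp add: d_def)
  qed
  then have "(\<lambda>j. \<integral>x. (norm (f j x))^2 \<partial>M) = (\<lambda>j. d j + 2 * (\<integral>x. f j x \<bullet> g x \<partial>M) - (\<integral>x. g x \<bullet> g x \<partial>M))"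
    by (simp add: fg algebra_simps)
  moreover have "(\<lambda>j. d j + 2 * (\<integral>x. f j x \<bullet> g x \<partial>M) - (\<integral>x. g x \<bullet> g x \<partial>M))
      \<longlonglongrightarrow> 0 + 2 * (\<integral>x. g x \<bullet> g x \<partial>M) - (\<integral>x. g x \<bullet> g x \<partial>M)"
    by (intro tendsto_intros d fg_lim)
  ultimately show "(\<lambda>j. \<integral>x. (norm (f j x))^2 \<partial>M) \<longlonglongrightarrow> (\<integral>x. g x \<bullet> g x \<partial>M)"
    by simp
qed

lemma simple_process_component_measurable:
  assumes "simple_process F T n \<tau> \<xi>" "\<And>t. t \<in> {0..T} \<Longrightarrow> subalgebra M (F t)" "i < n"
  shows "\<xi> i \<in> borel_measurable M"
proof -
  have "subalgebra M (F (\<tau> i))"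
    using simple_process_times[OF assms(1), of i] assms(2,3) by simp
  moreover have "\<xi> i \<in> borel_measurable (F (\<tau> i))" using assms by (simp add: simple_process_def)
  ultimately show ?thesis by (rule measurable_from_subalg)
qed

lemma simple_value_measurable:
  assumes "simple_process F T n \<tau> \<xi>" "\<And>t. t \<in> {0..T} \<Longrightarrow> subalgebra M (F t)"
  shows "(\<lambda>(s, \<omega>). simple_value n \<tau> \<xi> s \<omega>) \<in> borel_measurable (time_measure T \<Otimes>\<^sub>M M)"
proof -
  have "(\<lambda>z. indicator {\<tau> i<..\<tau> (Suc i)} (fst z) *\<^sub>R \<xi> i (snd z)) \<in> borel_measurable (time_measure T \<Otimes>\<^sub>M M)"
    if "i < n" for i
  proof -
    have [measurable]: "\<xi> i \<in> borel_measurable M"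
      using simple_process_component_measurable[OF assms that] .
    have [measurable]: "(indicator {\<tau> i<..\<tau> (Suc i)} :: real \<Rightarrow> real) \<in> borel_measurable (time_measure T)"
      by (intro measurable_restrict_space1) auto
    show ?thesis by measurable
  qed
  then show ?thesis
    unfolding simple_value_def split_beta by (intro borel_measurable_sum) auto
qed

lemma simple_integral_measurable:
  assumes "simple_process F T n \<tau> \<xi>" "\<And>t. t \<in> {0..T} \<Longrightarrow> subalgebra M (F t)"
    and V: "\<And>t. t \<in> {0..T} \<Longrightarrow> V t \<in> borel_measurable M"
  shows "simple_integral_wrt V n \<tau> \<xi> \<in> borel_measurable M"
proof -
  have "V (\<tau> i) \<in> borel_measurable M" if "i \<le> n" for i
    using V simple_process_times[OF assms(1) that] by simp
  then show ?thesis
    unfolding simple_integral_wrt_def[abs_def]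
    by (intro borel_measurable_sum borel_measurable_inner borel_measurable_diff
        simple_process_component_measurable[OF assms(1,2)]) auto
qed

lemma norm_simple_value_le: "norm (simple_value n \<tau> \<xi> s \<omega>) \<le> (\<Sum>i<n. norm (\<xi> i \<omega>))"
  unfolding simple_value_def by (intro sum_norm_le) (simp add: indicator_def)

lemma sets_time_measure: "sets (time_measure T) = sets (restrict_space borel {0..T})"
  by (rule sets_restrict_space_cong) simp

lemma adapted_process_time_measurable:
  assumes "adapted_process T M F Y"
  shows "(\<lambda>(s, \<omega>). Y s \<omega>) \<in> borel_measurable (time_measure T \<Otimes>\<^sub>M M)"
  using assms unfolding adapted_process_def
  by (subst measurable_cong_sets[OF sets_pair_measure_cong[OF sets_time_measure refl] refl]) simp

text \<open>Extracting a subsequence twice makes both convergences in the definition of the stochastic integral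
  hold almost everywhere along one sequence of simple processes.\<close>

lemma ito_integral_AE_approximation:
  fixes V :: "real \<Rightarrow> 'a \<Rightarrow> real ^ 'm"
  assumes "finite_measure M"
    and sub: "\<And>t. t \<in> {0..T} \<Longrightarrow> subalgebra M (F t)"
    and V: "\<And>t. t \<in> {0..T} \<Longrightarrow> V t \<in> borel_measurable M"
    and ito: "is_ito_integral M F V T H I"
  obtains n \<tau> \<xi> where "\<And>j. simple_process F T (n j) (\<tau> j) (\<xi> j)"
    "AE \<omega> in M. (\<lambda>j. \<integral>\<^sup>+s. ennreal ((norm (simple_value (n j) (\<tau> j) (\<xi> j) s \<omega> - H s \<omega>))^2) \<partial>time_measure T) \<longlonglongrightarrow> 0"
    "AE \<omega> in M. (\<lambda>j. simple_integral_wrt V (n j) (\<tau> j) (\<xi> j) \<omega>) \<longlonglongrightarrow> I \<omega>"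
proof -
  interpret finite_measure M by fact
  interpret time: finite_measure "time_measure T" by (rule finite_time_measure)
  have H[measurable]: "(\<lambda>(s, \<omega>). H s \<omega>) \<in> borel_measurable (time_measure T \<Otimes>\<^sub>M M)"
    using ito by (intro adapted_process_time_measurable) (auto simp: is_ito_integral_def)
  have [measurable]: "I \<in> borel_measurable M" using ito by (simp add: is_ito_integral_def)
  obtain n \<tau> \<xi> where simple: "\<And>j. simple_process F T (n j) (\<tau> j) (\<xi> j)"
    and c1: "tendsto_0_in_prob M (\<lambda>j \<omega>. \<integral>\<^sup>+ s\<in>{0..T}. ennreal (norm (simple_value (n j) (\<tau> j) (\<xi> j) s \<omega> - H s \<omega>) ^ 2) \<partial>lborel)"
    and c2: "tendsto_0_in_prob M (\<lambda>j \<omega>. ennreal \<bar>simple_integral_wrt V (n j) (\<tau> j) (\<xi> j) \<omega> - I \<omega>\<bar>)"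
    using ito unfolding is_ito_integral_def by blast
  define Z1 where "Z1 j \<omega> = (\<integral>\<^sup>+s. ennreal ((norm (simple_value (n j) (\<tau> j) (\<xi> j) s \<omega> - H s \<omega>))^2) \<partial>time_measure T)" for j \<omega>
  define Z2 where "Z2 j \<omega> = ennreal \<bar>simple_integral_wrt V (n j) (\<tau> j) (\<xi> j) \<omega> - I \<omega>\<bar>" for j \<omega>
  have Z1_eq: "Z1 j \<omega> = (\<integral>\<^sup>+ s\<in>{0..T}. ennreal (norm (simple_value (n j) (\<tau> j) (\<xi> j) s \<omega> - H s \<omega>) ^ 2) \<partial>lborel)" for j \<omega>
    unfolding Z1_def by (subst nn_integral_restrict_space) auto
  have [measurable]: "Z1 j \<in> borel_measurable M" for j
  proof -
    have [measurable]: "(\<lambda>(s, \<omega>). simple_value (n j) (\<tau> j) (\<xi> j) s \<omega>) \<in> borel_measurable (time_measure T \<Otimes>\<^sub>M M)"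
      by (rule simple_value_measurable[OF simple sub])
    show ?thesis unfolding Z1_def[abs_def] by measurable
  qed
  have [measurable]: "Z2 j \<in> borel_measurable M" for j
  proof -
    have [measurable]: "simple_integral_wrt V (n j) (\<tau> j) (\<xi> j) \<in> borel_measurable M"
      by (rule simple_integral_measurable[OF simple sub V])
    show ?thesis unfolding Z2_def[abs_def] by measurable
  qed
  have "tendsto_0_in_prob M Z1" using c1 unfolding Z1_eq[symmetric] .
  then obtain r1 where r1: "strict_mono r1" "AE \<omega> in M. (\<lambda>k. Z1 (r1 k) \<omega>) \<longlonglongrightarrow> 0"
    by (rule AE_subsequence_of_tendsto_0_in_prob[rotated 2]) (simp_all add: finite_measure_axioms)
  have "tendsto_0_in_prob M (\<lambda>j. Z2 (r1 j))"
    using c2 unfolding Z2_def[symmetric] tendsto_0_in_prob_def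
    by (auto intro: LIMSEQ_subseq_LIMSEQ[OF _ r1(1), unfolded comp_def])
  then obtain r2 where r2: "strict_mono r2" "AE \<omega> in M. (\<lambda>k. Z2 (r1 (r2 k)) \<omega>) \<longlonglongrightarrow> 0"
    by (rule AE_subsequence_of_tendsto_0_in_prob[rotated 2]) (simp_all add: finite_measure_axioms)
  define r where "r k = r1 (r2 k)" for k
  show thesis
  proof (rule that[of "\<lambda>k. n (r k)" "\<lambda>k. \<tau> (r k)" "\<lambda>k. \<xi> (r k)"])
    show "simple_process F T (n (r j)) (\<tau> (r j)) (\<xi> (r j))" for j by (rule simple)
    show "AE \<omega> in M. (\<lambda>j. \<integral>\<^sup>+s. ennreal ((norm (simple_value (n (r j)) (\<tau> (r j)) (\<xi> (r j)) s \<omega> - H s \<omega>))^2) \<partial>time_measure T) \<longlonglongrightarrow> 0"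
      using r1(2)
    proof eventually_elim
      case (elim \<omega>)
      then have "(\<lambda>k. Z1 (r k) \<omega>) \<longlonglongrightarrow> 0"
        using LIMSEQ_subseq_LIMSEQ[OF elim r2(1)] by (simp add: r_def comp_def)
      then show ?case by (simp add: Z1_def)
    qed
    show "AE \<omega> in M. (\<lambda>j. simple_integral_wrt V (n (r j)) (\<tau> (r j)) (\<xi> (r j)) \<omega>) \<longlonglongrightarrow> I \<omega>"
      using r2(2)
    proof eventually_elim
      case (elim \<omega>)
      then have "(\<lambda>k. ennreal \<bar>simple_integral_wrt V (n (r k)) (\<tau> (r k)) (\<xi> (r k)) \<omega> - I \<omega>\<bar>) \<longlonglongrightarrow> ennreal 0"
        by (simp add: Z2_def r_def)
      then have "(\<lambda>k. \<bar>simple_integral_wrt V (n (r k)) (\<tau> (r k)) (\<xi> (r k)) \<omega> - I \<omega>\<bar>) \<longlonglongrightarrow> 0"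
        by (subst (asm) tendsto_ennreal_iff) auto
      then show ?case by (simp add: tendsto_rabs_zero_iff LIM_zero_iff)
    qed
  qed
qed

text \<open>Fatou's lemma keeps half of the exponential martingale property in the limit, and an upper bound is
  all that is used: with \<open>V = 0\<close> it identifies stochastic integrals, with \<open>V\<close> the energy of the control it
  bounds the mean of the importance weight.\<close>

lemma exponential_limit_le_one:
  fixes W :: "real \<Rightarrow> 'a \<Rightarrow> real ^ 'm"
  assumes Q: "prob_space Q" "filtration_upto T Q F" "brownian_motion T Q F W"
    and simple: "\<And>j. simple_process F T (n j) (\<tau> j) (\<xi> j)" "\<And>j. simple_process F T (n' j) (\<tau>' j) (\<xi>' j)"
    and R: "AE \<omega> in Q. (\<lambda>j. simple_integral_wrt W (n j) (\<tau> j) (\<xi> j) \<omega>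
        - simple_integral_wrt W (n' j) (\<tau>' j) (\<xi>' j) \<omega>) \<longlonglongrightarrow> R \<omega>"
    and V: "AE \<omega> in Q. (\<lambda>j. \<integral>s. (norm (simple_value (n j) (\<tau> j) (\<xi> j) s \<omega>
        - simple_value (n' j) (\<tau>' j) (\<xi>' j) s \<omega>))^2 \<partial>time_measure T) \<longlonglongrightarrow> V \<omega>"
  shows "(\<integral>\<^sup>+\<omega>. ennreal (exp (R \<omega> - V \<omega> / 2)) \<partial>Q) \<le> 1"
proof -
  define X where "X j \<omega> = simple_integral_wrt W (n j) (\<tau> j) (\<xi> j) \<omega> - simple_integral_wrt W (n' j) (\<tau>' j) (\<xi>' j) \<omega>
    - (\<integral>s. (norm (simple_value (n j) (\<tau> j) (\<xi> j) s \<omega> - simple_value (n' j) (\<tau>' j) (\<xi>' j) s \<omega>))^2 \<partial>time_measure T) / 2"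
    for j \<omega>
  have [measurable]: "X j \<in> borel_measurable Q" and EX: "(\<integral>\<^sup>+\<omega>. ennreal (exp (X j \<omega>)) \<partial>Q) = 1" for j
    using simple_difference_exponential[OF Q simple(1)[of j] simple(2)[of j]] unfolding X_def[abs_def] by auto
  have "(\<integral>\<^sup>+\<omega>. ennreal (exp (R \<omega> - V \<omega> / 2)) \<partial>Q) = (\<integral>\<^sup>+\<omega>. liminf (\<lambda>j. ennreal (exp (X j \<omega>))) \<partial>Q)"
  proof (rule nn_integral_cong_AE)
    show "AE \<omega> in Q. ennreal (exp (R \<omega> - V \<omega> / 2)) = liminf (\<lambda>j. ennreal (exp (X j \<omega>)))"
      using R V
    proof eventually_elim
      case (elim \<omega>)
      have "(\<lambda>j. ennreal (exp (X j \<omega>))) \<longlonglongrightarrow> ennreal (exp (R \<omega> - V \<omega> / 2))"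
        unfolding X_def by (intro tendsto_ennrealI tendsto_exp tendsto_diff tendsto_divide elim tendsto_const) auto
      from lim_imp_Liminf[OF trivial_limit_sequentially this] show ?case by (rule sym)
    qed
  qed
  also have "\<dots> \<le> liminf (\<lambda>j. \<integral>\<^sup>+\<omega>. ennreal (exp (X j \<omega>)) \<partial>Q)"
    by (rule nn_integral_liminf) measurable
  also have "\<dots> = 1" by (simp add: EX Liminf_const)
  finally show ?thesis .
qed

text \<open>Since \<open>exp x + exp (- x) - 2\<close> is nonnegative and vanishes only at zero, the two bounds force \<open>D\<close> to vanish.\<close>

lemma AE_eq_0_if_exponentials_le_one:
  assumes "prob_space Q" and [measurable]: "D \<in> borel_measurable Q"
    and "(\<integral>\<^sup>+\<omega>. ennreal (exp (D \<omega>)) \<partial>Q) \<le> 1" "(\<integral>\<^sup>+\<omega>. ennreal (exp (- D \<omega>)) \<partial>Q) \<le> 1"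
  shows "AE \<omega> in Q. D \<omega> = (0::real)"
proof -
  interpret prob_space Q by fact
  have int: "integrable Q (\<lambda>\<omega>. exp (D \<omega>))" "integrable Q (\<lambda>\<omega>. exp (- D \<omega>))"
    using assms by (auto intro!: integrableI_bounded intro: le_less_trans)
  have le: "(\<integral>\<omega>. exp (D \<omega>) \<partial>Q) \<le> 1" "(\<integral>\<omega>. exp (- D \<omega>) \<partial>Q) \<le> 1"
    using assms int by (simp_all add: nn_integral_eq_integral)
  define c where "c \<omega> = exp (D \<omega>) + exp (- D \<omega>) - 2" for \<omega>
  have c0: "0 \<le> c \<omega>" for \<omega>
    using exp_ge_add_one_self[of "D \<omega>"] exp_ge_add_one_self[of "- D \<omega>"] unfolding c_def by linarith
  have "(\<integral>\<omega>. c \<omega> \<partial>Q) \<le> 0" using int le by (simp add: c_def prob_space)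
  moreover have "0 \<le> (\<integral>\<omega>. c \<omega> \<partial>Q)" using c0 by simp
  moreover have "integrable Q c" using int unfolding c_def[abs_def] by auto
  ultimately have "AE \<omega> in Q. c \<omega> = 0"
    using c0 integral_nonneg_eq_0_iff_AE[of Q c] by (auto intro: antisym)
  then show ?thesis
  proof eventually_elim
    case (elim \<omega>)
    have "(exp (D \<omega>) - 1)^2 = exp (D \<omega>) * c \<omega>"
      by (simp add: c_def power2_eq_square algebra_simps exp_minus)
    then show ?case using elim by simp
  qed
qed


section \<open>The importance weight of a bounded control\<close>

text \<open>Shifting the integrator by the drift \<open>\<integral> u dt\<close> changes the integral of a simple process by its pairing
  with \<open>u\<close>.\<close>

lemma simple_integral_shifted_noise:
  fixes W u :: "real \<Rightarrow> 'a \<Rightarrow> real ^ 'm"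
  assumes simple: "simple_process F T n \<tau> \<xi>" and int: "integrable (time_measure T) (\<lambda>s. u s \<omega>)"
  shows "simple_integral_wrt (shifted_noise W u) n \<tau> \<xi> \<omega>
    = simple_integral_wrt W n \<tau> \<xi> \<omega> - (\<integral>s. simple_value n \<tau> \<xi> s \<omega> \<bullet> u s \<omega> \<partial>time_measure T)"
proof -
  have upto: "(LINT s:{0..b}|lborel. u s \<omega>) = (\<integral>s. indicator {0..b} s *\<^sub>R u s \<omega> \<partial>time_measure T)"
    if "b \<le> T" for b
    unfolding set_lebesgue_integral_def
    by (subst integral_restrict_space) (use that in \<open>auto intro!: Bochner_Integration.integral_cong simp: indicator_def\<close>)
  have ind_meas: "A \<inter> {0..T} \<in> sets (time_measure T)" if "A \<in> sets borel" for A
    using that by (subst sets_restrict_space_iff) auto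
  have ind_int: "integrable (time_measure T) (\<lambda>s. indicator A s *\<^sub>R u s \<omega>)" if "A \<in> sets borel" for A
  proof -
    have "integrable (time_measure T) (\<lambda>s. indicator (A \<inter> {0..T}) s *\<^sub>R u s \<omega>)"
      by (rule integrable_mult_indicator[OF ind_meas[OF that] int])
    then show ?thesis
      by (rule Bochner_Integration.integrable_cong[THEN iffD1, rotated 2])
        (auto simp: space_restrict_space indicator_def)
  qed
  have "shifted_noise W u (\<tau> (Suc i)) \<omega> - shifted_noise W u (\<tau> i) \<omega>
      = (W (\<tau> (Suc i)) \<omega> - W (\<tau> i) \<omega>) - (\<integral>s. indicator {\<tau> i<..\<tau> (Suc i)} s *\<^sub>R u s \<omega> \<partial>time_measure T)"
    if "i < n" for i
  proof -
    have t: "0 \<le> \<tau> i" "\<tau> i \<le> \<tau> (Suc i)" "\<tau> i \<le> T" "\<tau> (Suc i) \<le> T"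
      using simple_process_times[OF simple, of i] simple_process_times[OF simple, of "Suc i"] simple that
      by (auto simp: simple_process_def)
    have "(\<integral>s. indicator {\<tau> i<..\<tau> (Suc i)} s *\<^sub>R u s \<omega> \<partial>time_measure T)
        = (\<integral>s. indicator {0..\<tau> (Suc i)} s *\<^sub>R u s \<omega> - indicator {0..\<tau> i} s *\<^sub>R u s \<omega> \<partial>time_measure T)"
      using t by (intro Bochner_Integration.integral_cong) (auto simp: indicator_def space_restrict_space)
    also have "\<dots> = (LINT s:{0..\<tau> (Suc i)}|lborel. u s \<omega>) - (LINT s:{0..\<tau> i}|lborel. u s \<omega>)"
      using ind_int t by (simp add: upto)
    finally show ?thesis by (simp add: shifted_noise_def)
  qed
  then have "simple_integral_wrt (shifted_noise W u) n \<tau> \<xi> \<omega> = simple_integral_wrt W n \<tau> \<xi> \<omega>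
      - (\<Sum>i<n. \<xi> i \<omega> \<bullet> (\<integral>s. indicator {\<tau> i<..\<tau> (Suc i)} s *\<^sub>R u s \<omega> \<partial>time_measure T))"
    by (simp add: simple_integral_wrt_def inner_diff_right sum_subtractf)
  also have "(\<Sum>i<n. \<xi> i \<omega> \<bullet> (\<integral>s. indicator {\<tau> i<..\<tau> (Suc i)} s *\<^sub>R u s \<omega> \<partial>time_measure T))
      = (\<Sum>i<n. \<integral>s. \<xi> i \<omega> \<bullet> (indicator {\<tau> i<..\<tau> (Suc i)} s *\<^sub>R u s \<omega>) \<partial>time_measure T)"
    by (intro sum.cong refl integral_inner_right[symmetric] ind_int) simp
  also have "\<dots> = (\<integral>s. (\<Sum>i<n. \<xi> i \<omega> \<bullet> (indicator {\<tau> i<..\<tau> (Suc i)} s *\<^sub>R u s \<omega>)) \<partial>time_measure T)"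
    by (intro Bochner_Integration.integral_sum[symmetric] integrable_inner_right ind_int) simp
  also have "\<dots> = (\<integral>s. simple_value n \<tau> \<xi> s \<omega> \<bullet> u s \<omega> \<partial>time_measure T)"
    by (simp add: simple_value_def inner_sum_left)
  finally show ?thesis .
qed

text \<open>The proposal has density \<open>exp (I - E / 2)\<close> with the stochastic integral \<open>I\<close> taken under \<open>Q\<close>, whereas the
  weight is \<open>exp (- J - E / 2)\<close> with the integral \<open>J\<close> taken under the proposal against the shifted noise.
  The weight is the reciprocal of the density exactly when \<open>J = I - E\<close>. To see this, take simple
  approximations of \<open>I\<close> and of \<open>J\<close>; both converge almost everywhere under \<open>Q\<close>, because the proposal is
  equivalent to \<open>Q\<close>. Both sequences of simple processes converge to \<open>u\<close>, so the energy of their difference tends to zero,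
  while the integrals of their difference against \<open>W\<close> tend to \<open>D = I - (J + E)\<close>. Hence
  \<open>exp D\<close> and \<open>exp (- D)\<close> have mean at most one under \<open>Q\<close>, and \<open>D = 0\<close>.

  The bound on the mean of the weight \<open>exp (- I + E / 2)\<close> is the exponential bound for \<open>- u\<close>, at the price
  of a factor \<open>exp E\<close>, which is bounded because the control is.\<close>

proposition girsanov_importance_weight:
  fixes W u :: "real \<Rightarrow> 'a \<Rightarrow> real ^ 'm"
  assumes Q: "prob_space Q" "filtration_upto T Q F" "brownian_motion T Q F W" and T: "0 < T"
    and control: "girsanov_control T Q F W u"
    and bound: "control_sup_norm T (girsanov_measure T Q F W u) u < ereal C"
    and weight: "is_importance_weight T Q F W u Z" and [measurable]: "Z \<in> borel_measurable Q"
  shows "AE \<omega> in Q. 0 < Z \<omega>"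
    and "girsanov_measure T Q F W u = density Q (\<lambda>\<omega>. ennreal (1 / Z \<omega>))"
    and "(\<integral>\<^sup>+\<omega>. ennreal (Z \<omega>) \<partial>Q) \<le> ennreal (exp (C\<^sup>2 * T))"
proof -
  interpret prob_space Q by fact
  interpret time: finite_measure "time_measure T" by (rule finite_time_measure)
  define P where "P = girsanov_measure T Q F W u"
  define I where "I = ito_integral Q F W T u"
  define E where "E = energy T u"
  have sub: "subalgebra Q (F t)" if "t \<in> {0..T}" for t
    using Q(2) that by (simp add: filtration_upto_def)
  have Wm: "W t \<in> borel_measurable Q" if "t \<in> {0..T}" for t
    using Q(3) that by (intro measurable_from_subalg[OF sub[OF that]]) (simp add: brownian_motion_def)
  have "\<exists>I. is_ito_integral Q F W T u I" using control by (simp add: girsanov_control_def)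
  then have I_ito: "is_ito_integral Q F W T u I" unfolding I_def ito_integral_def by (rule someI_ex)
  then have I_meas[measurable]: "I \<in> borel_measurable Q" by (simp add: is_ito_integral_def)
  have um[measurable]: "(\<lambda>(s, \<omega>). u s \<omega>) \<in> borel_measurable (time_measure T \<Otimes>\<^sub>M Q)"
    using control by (intro adapted_process_time_measurable[where F = F]) (simp add: girsanov_control_def)
  have u_path[measurable]: "(\<lambda>s. u s \<omega>) \<in> borel_measurable (time_measure T)" if "\<omega> \<in> space Q" for \<omega>
    using that by measurable
  have E_eq: "E \<omega> = (\<integral>s. u s \<omega> \<bullet> u s \<omega> \<partial>time_measure T)" for \<omega>
    unfolding E_def energy_def set_lebesgue_integral_def by (subst integral_restrict_space) auto
  have E_meas[measurable]: "E \<in> borel_measurable Q"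
    unfolding E_eq[abs_def] by measurable
  have P_def': "P = density Q (\<lambda>\<omega>. ennreal (exp (I \<omega> - E \<omega> / 2)))"
    by (simp add: P_def girsanov_measure_def I_def E_def)
  have sets_P[measurable_cong]: "sets P = sets Q" and space_P: "space P = space Q" by (simp_all add: P_def')
  \<comment> \<open>The density is strictly positive, so null sets of the proposal are null sets of \<open>Q\<close>.\<close>
  have P_imp_Q: "AE \<omega> in Q. R \<omega>" if "AE \<omega> in P. R \<omega>" for R
    using that unfolding P_def' by (subst (asm) AE_density) auto
  interpret P: prob_space P using control by (simp add: P_def girsanov_control_def)
  have subP: "subalgebra P (F t)" if "t \<in> {0..T}" for t
    using sub[OF that] by (simp add: subalgebra_def space_P sets_P)
  obtain A where A: "0 \<le> A" "A < C" and A_bound: "AE \<omega> in P. \<forall>t\<in>{0..T}. norm (u t \<omega>) < A"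
    using bound unfolding control_sup_norm_def Inf_less_iff P_def by auto
  have u_bound: "AE \<omega> in Q. \<forall>t\<in>{0..T}. norm (u t \<omega>) \<le> C"
    using P_imp_Q[OF A_bound] by eventually_elim (use A in fastforce)
  obtain J where J_ito: "is_ito_integral P F (shifted_noise W u) T u J"
    and J_Z: "AE \<omega> in P. Z \<omega> = exp (- J \<omega> - E \<omega> / 2)"
    using weight unfolding is_importance_weight_def P_def[symmetric] E_def[symmetric] by blast
  have J_meas[measurable]: "J \<in> borel_measurable Q"
    using J_ito sets_P by (auto simp: is_ito_integral_def cong: measurable_cong_sets)
  have shifted_meas: "shifted_noise W u t \<in> borel_measurable P" if t: "t \<in> {0..T}" for t
  proof -
    have "(LINT s:{0..t}|lborel. u s \<omega>) = (\<integral>s. indicator ({0..t} \<inter> {0..T}) s *\<^sub>R u s \<omega> \<partial>time_measure T)" for \<omega>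
      unfolding set_lebesgue_integral_def
      by (subst integral_restrict_space) (use t in \<open>auto intro!: Bochner_Integration.integral_cong simp: indicator_def\<close>)
    moreover have [measurable]: "{0..t} \<inter> {0..T} \<in> sets (time_measure T)"
      by (subst sets_restrict_space_iff) auto
    moreover have "(\<lambda>\<omega>. W t \<omega> - (\<integral>s. indicator ({0..t} \<inter> {0..T}) s *\<^sub>R u s \<omega> \<partial>time_measure T)) \<in> borel_measurable Q"
      using Wm[OF t] by measurable
    ultimately show ?thesis
      by (simp add: shifted_noise_def[abs_def] sets_P cong: measurable_cong_sets)
  qed
  obtain n \<tau> \<xi> where H: "\<And>j. simple_process F T (n j) (\<tau> j) (\<xi> j)"
    and H_u: "AE \<omega> in Q. (\<lambda>j. \<integral>\<^sup>+s. ennreal ((norm (simple_value (n j) (\<tau> j) (\<xi> j) s \<omega> - u s \<omega>))^2) \<partial>time_measure T) \<longlonglongrightarrow> 0"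
    and H_I: "AE \<omega> in Q. (\<lambda>j. simple_integral_wrt W (n j) (\<tau> j) (\<xi> j) \<omega>) \<longlonglongrightarrow> I \<omega>"
    by (rule ito_integral_AE_approximation[OF finite_measure_axioms sub Wm I_ito]) blast+
  obtain n' \<tau>' \<xi>' where K: "\<And>j. simple_process F T (n' j) (\<tau>' j) (\<xi>' j)"
    and K_u': "AE \<omega> in P. (\<lambda>j. \<integral>\<^sup>+s. ennreal ((norm (simple_value (n' j) (\<tau>' j) (\<xi>' j) s \<omega> - u s \<omega>))^2) \<partial>time_measure T) \<longlonglongrightarrow> 0"
    and K_J': "AE \<omega> in P. (\<lambda>j. simple_integral_wrt (shifted_noise W u) (n' j) (\<tau>' j) (\<xi>' j) \<omega>) \<longlonglongrightarrow> J \<omega>"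
    by (rule ito_integral_AE_approximation[OF P.finite_measure_axioms subP shifted_meas J_ito]) blast+
  note K_u = P_imp_Q[OF K_u'] and K_J = P_imp_Q[OF K_J']
  have path_meas: "(\<lambda>s. simple_value m \<theta> \<zeta> s \<omega>) \<in> borel_measurable (time_measure T)"
    for m and \<theta> :: "nat \<Rightarrow> real" and \<zeta> :: "nat \<Rightarrow> 'a \<Rightarrow> real ^ 'm" and \<omega>
    unfolding simple_value_def
    by (intro borel_measurable_sum borel_measurable_scaleR borel_measurable_const measurable_restrict_space1) auto
  have path_limits:
    "(\<lambda>j. \<integral>s. (norm (simple_value (m j) (\<theta> j) (\<zeta> j) s \<omega> - u s \<omega>))^2 \<partial>time_measure T) \<longlonglongrightarrow> 0"
    "(\<lambda>j. \<integral>s. simple_value (m j) (\<theta> j) (\<zeta> j) s \<omega> \<bullet> u s \<omega> \<partial>time_measure T) \<longlonglongrightarrow> E \<omega>"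
    "(\<lambda>j. \<integral>s. (norm (simple_value (m j) (\<theta> j) (\<zeta> j) s \<omega>))^2 \<partial>time_measure T) \<longlonglongrightarrow> E \<omega>"
    if "(\<lambda>j. \<integral>\<^sup>+s. ennreal ((norm (simple_value (m j) (\<theta> j) (\<zeta> j) s \<omega> - u s \<omega>))^2) \<partial>time_measure T) \<longlonglongrightarrow> 0"
      "\<omega> \<in> space Q" "\<forall>t\<in>{0..T}. norm (u t \<omega>) \<le> C"
    for m and \<theta> :: "nat \<Rightarrow> nat \<Rightarrow> real" and \<zeta> :: "nat \<Rightarrow> nat \<Rightarrow> 'a \<Rightarrow> real ^ 'm" and \<omega>
    unfolding E_eq
    using L2_tendsto_imp_inner_tendsto[OF time.finite_measure_axioms path_meas u_path[OF that(2)]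
        norm_simple_value_le _ that(1), of C] that(3)
    by (auto simp: space_restrict_space)
  have int_u: "integrable (time_measure T) (\<lambda>s. u s \<omega>)"
    if "\<omega> \<in> space Q" "\<forall>t\<in>{0..T}. norm (u t \<omega>) \<le> C" for \<omega>
    using that by (intro integrable_bounded_finite_measure[OF time.finite_measure_axioms, where B = C] u_path)
      (auto simp: space_restrict_space)
  define D where "D \<omega> = I \<omega> - (J \<omega> + E \<omega>)" for \<omega>
  have [measurable]: "D \<in> borel_measurable Q" unfolding D_def[abs_def] by measurable
  have HK: "AE \<omega> in Q. (\<lambda>j. simple_integral_wrt W (n j) (\<tau> j) (\<xi> j) \<omega>
        - simple_integral_wrt W (n' j) (\<tau>' j) (\<xi>' j) \<omega>) \<longlonglongrightarrow> D \<omega>"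
    using H_I K_J K_u u_bound AE_space
  proof eventually_elim
    case (elim \<omega>)
    have "(\<lambda>j. simple_integral_wrt (shifted_noise W u) (n' j) (\<tau>' j) (\<xi>' j) \<omega>
        + (\<integral>s. simple_value (n' j) (\<tau>' j) (\<xi>' j) s \<omega> \<bullet> u s \<omega> \<partial>time_measure T)) \<longlonglongrightarrow> J \<omega> + E \<omega>"
      using elim by (intro tendsto_add path_limits)
    then have "(\<lambda>j. simple_integral_wrt W (n' j) (\<tau>' j) (\<xi>' j) \<omega>) \<longlonglongrightarrow> J \<omega> + E \<omega>"
      using simple_integral_shifted_noise[OF K int_u] elim by simp
    then show ?case unfolding D_def using elim by (intro tendsto_diff)
  qed
  have gap: "AE \<omega> in Q. (\<lambda>j. \<integral>s. (norm (simple_value (n j) (\<tau> j) (\<xi> j) s \<omega>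
        - simple_value (n' j) (\<tau>' j) (\<xi>' j) s \<omega>))^2 \<partial>time_measure T) \<longlonglongrightarrow> 0"
    using H_u K_u u_bound AE_space
  proof eventually_elim
    case (elim \<omega>)
    define h where "h j s = simple_value (n j) (\<tau> j) (\<xi> j) s \<omega>" for j s
    define k where "k j s = simple_value (n' j) (\<tau>' j) (\<xi>' j) s \<omega>" for j s
    have [measurable]: "h j \<in> borel_measurable (time_measure T)" "k j \<in> borel_measurable (time_measure T)" for j
      unfolding h_def[abs_def] k_def[abs_def] by (rule path_meas)+
    have [measurable]: "(\<lambda>s. u s \<omega>) \<in> borel_measurable (time_measure T)" using elim u_path by simp
    have sq_int: "integrable (time_measure T) (\<lambda>s. (norm (x s - y s))^2)"
      if [measurable]: "x \<in> borel_measurable (time_measure T)" "y \<in> borel_measurable (time_measure T)"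
      and b: "\<And>s. s \<in> {0..T} \<Longrightarrow> norm (x s) \<le> b" "\<And>s. s \<in> {0..T} \<Longrightarrow> norm (y s) \<le> c"
      for x y :: "real \<Rightarrow> real ^ 'm" and b c
    proof (rule integrable_bounded_finite_measure[OF time.finite_measure_axioms, where B = "(b + c)^2"])
      fix s assume "s \<in> space (time_measure T)"
      then have "norm (x s - y s) \<le> b + c"
        using b[of s] norm_triangle_ineq4[of "x s" "y s"] by (simp add: space_restrict_space)
      then show "norm ((norm (x s - y s))^2) \<le> (b + c)^2" by (simp add: power_mono)
    qed measurable
    have hb: "norm (h j s) \<le> (\<Sum>i<n j. norm (\<xi> j i \<omega>))" and kb: "norm (k j s) \<le> (\<Sum>i<n' j. norm (\<xi>' j i \<omega>))" for j s
      unfolding h_def k_def by (rule norm_simple_value_le)+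
    have le: "(\<integral>s. (norm (h j s - k j s))^2 \<partial>time_measure T)
        \<le> 2 * (\<integral>s. (norm (h j s - u s \<omega>))^2 \<partial>time_measure T) + 2 * (\<integral>s. (norm (k j s - u s \<omega>))^2 \<partial>time_measure T)" for j
    proof -
      have ints: "integrable (time_measure T) (\<lambda>s. (norm (h j s - k j s))^2)"
        "integrable (time_measure T) (\<lambda>s. (norm (h j s - u s \<omega>))^2)"
        "integrable (time_measure T) (\<lambda>s. (norm (k j s - u s \<omega>))^2)"
        using elim hb kb by (auto intro!: sq_int)
      have "(norm (h j s - k j s))^2 \<le> 2 * (norm (h j s - u s \<omega>))^2 + 2 * (norm (k j s - u s \<omega>))^2" for s
      proof -
        have "norm (h j s - k j s) \<le> norm (h j s - u s \<omega>) + norm (k j s - u s \<omega>)"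
          using norm_triangle_ineq4[of "h j s - u s \<omega>" "k j s - u s \<omega>"] by simp
        then have "(norm (h j s - k j s))^2 \<le> (norm (h j s - u s \<omega>) + norm (k j s - u s \<omega>))^2"
          by (intro power_mono) auto
        also have "\<dots> \<le> 2 * (norm (h j s - u s \<omega>))^2 + 2 * (norm (k j s - u s \<omega>))^2"
          using sum_squares_bound[of "norm (h j s - u s \<omega>)" "norm (k j s - u s \<omega>)"]
          by (simp add: power2_sum)
        finally show ?thesis .
      qed
      then have "(\<integral>s. (norm (h j s - k j s))^2 \<partial>time_measure T)
          \<le> (\<integral>s. 2 * (norm (h j s - u s \<omega>))^2 + 2 * (norm (k j s - u s \<omega>))^2 \<partial>time_measure T)"
        using ints by (intro integral_mono) auto
      then show ?thesis using ints by simp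
    qed
    have lim: "(\<lambda>j. 2 * (\<integral>s. (norm (h j s - u s \<omega>))^2 \<partial>time_measure T)
          + 2 * (\<integral>s. (norm (k j s - u s \<omega>))^2 \<partial>time_measure T)) \<longlonglongrightarrow> 2 * 0 + 2 * 0"
      unfolding h_def k_def using elim by (intro tendsto_add tendsto_mult tendsto_const path_limits)
    have "(\<lambda>j. \<integral>s. (norm (h j s - k j s))^2 \<partial>time_measure T) \<longlonglongrightarrow> 0"
      by (rule tendsto_sandwich[where f = "\<lambda>_. 0", OF _ _ tendsto_const lim[simplified]]) (use le in simp_all)
    then show ?case by (simp add: h_def k_def)
  qed
  have gap': "AE \<omega> in Q. (\<lambda>j. \<integral>s. (norm (simple_value (n' j) (\<tau>' j) (\<xi>' j) s \<omega>
        - simple_value (n j) (\<tau> j) (\<xi> j) s \<omega>))^2 \<partial>time_measure T) \<longlonglongrightarrow> 0"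
    using gap by (simp add: norm_minus_commute)
  have KH: "AE \<omega> in Q. (\<lambda>j. simple_integral_wrt W (n' j) (\<tau>' j) (\<xi>' j) \<omega>
        - simple_integral_wrt W (n j) (\<tau> j) (\<xi> j) \<omega>) \<longlonglongrightarrow> - D \<omega>"
    using HK by eventually_elim (drule tendsto_minus, simp)
  have D0: "AE \<omega> in Q. D \<omega> = 0"
    using exponential_limit_le_one[OF Q H K HK gap] exponential_limit_le_one[OF Q K H KH gap']
    by (intro AE_eq_0_if_exponentials_le_one[OF Q(1)]) simp_all
  have Z_eq: "AE \<omega> in Q. Z \<omega> = exp (- I \<omega> + E \<omega> / 2)"
    using P_imp_Q[OF J_Z] D0 by eventually_elim (auto simp: D_def)
  then show "AE \<omega> in Q. 0 < Z \<omega>" by eventually_elim simp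
  show "girsanov_measure T Q F W u = density Q (\<lambda>\<omega>. ennreal (1 / Z \<omega>))"
    unfolding P_def[symmetric] P_def'
  proof (rule density_cong)
    show "AE \<omega> in Q. ennreal (exp (I \<omega> - E \<omega> / 2)) = ennreal (1 / Z \<omega>)"
      using Z_eq by eventually_elim (simp add: exp_minus[symmetric] inverse_eq_divide[symmetric])
  qed measurable
  \<comment> \<open>The integral of \<open>- u\<close> is the limit of differences between the zero process and the approximations of \<open>I\<close>.\<close>
  define zero :: "nat \<Rightarrow> 'a \<Rightarrow> real ^ 'm" where "zero i \<omega> = 0" for i \<omega>
  define ends where "ends i = (if i = 0 then 0 else T)" for i :: nat
  have zero: "simple_process F T 1 ends zero"
    using T by (simp add: simple_process_def ends_def zero_def[abs_def] image_constant_conv)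
  have zero_val: "simple_value 1 ends zero s \<omega> = 0" "simple_integral_wrt W 1 ends zero \<omega> = 0" for s \<omega>
    by (simp_all add: simple_value_def simple_integral_wrt_def zero_def)
  have mass: "(\<integral>\<^sup>+\<omega>. ennreal (exp (- I \<omega> - E \<omega> / 2)) \<partial>Q) \<le> 1"
  proof (rule exponential_limit_le_one[OF Q zero H])
    show "AE \<omega> in Q. (\<lambda>j. simple_integral_wrt W 1 ends zero \<omega> - simple_integral_wrt W (n j) (\<tau> j) (\<xi> j) \<omega>)
        \<longlonglongrightarrow> - I \<omega>"
      using H_I unfolding zero_val diff_0 by eventually_elim (rule tendsto_minus)
    show "AE \<omega> in Q. (\<lambda>j. \<integral>s. (norm (simple_value 1 ends zero s \<omega> - simple_value (n j) (\<tau> j) (\<xi> j) s \<omega>))\<^sup>2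
         \<partial>time_measure T) \<longlonglongrightarrow> E \<omega>"
      using H_u u_bound AE_space unfolding zero_val diff_0 norm_minus_cancel
      by eventually_elim (rule path_limits(3))
  qed
  have "AE \<omega> in Q. ennreal (Z \<omega>) \<le> ennreal (exp (C\<^sup>2 * T)) * ennreal (exp (- I \<omega> - E \<omega> / 2))"
    using Z_eq u_bound AE_space
  proof eventually_elim
    case (elim \<omega>)
    have uu: "\<bar>u s \<omega> \<bullet> u s \<omega>\<bar> \<le> C\<^sup>2" if "s \<in> {0..T}" for s
      using elim that by (auto simp: dot_square_norm intro!: power_mono)
    have "E \<omega> \<le> (\<integral>s. C\<^sup>2 \<partial>time_measure T)"
      unfolding E_eq
    proof (rule integral_mono)
      show "integrable (time_measure T) (\<lambda>s. u s \<omega> \<bullet> u s \<omega>)"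
        using elim u_path[of \<omega>] uu
        by (intro integrable_bounded_finite_measure[OF time.finite_measure_axioms, where B = "C\<^sup>2"])
          (auto simp: space_restrict_space)
    qed (use uu in \<open>auto simp: space_restrict_space abs_le_iff\<close>)
    also have "\<dots> = C\<^sup>2 * T"
      using T by (simp add: space_restrict_space measure_restrict_space)
    finally have "exp (- I \<omega> + E \<omega> / 2) \<le> exp (C\<^sup>2 * T) * exp (- I \<omega> - E \<omega> / 2)"
      by (simp add: exp_add[symmetric])
    then show ?case using elim by (simp add: ennreal_mult[symmetric])
  qed
  then have "(\<integral>\<^sup>+\<omega>. ennreal (Z \<omega>) \<partial>Q)
      \<le> (\<integral>\<^sup>+\<omega>. ennreal (exp (C\<^sup>2 * T)) * ennreal (exp (- I \<omega> - E \<omega> / 2)) \<partial>Q)"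
    by (rule nn_integral_mono_AE)
  also have "\<dots> = ennreal (exp (C\<^sup>2 * T)) * (\<integral>\<^sup>+\<omega>. ennreal (exp (- I \<omega> - E \<omega> / 2)) \<partial>Q)"
    by (rule nn_integral_cmult) measurable
  also have "\<dots> \<le> ennreal (exp (C\<^sup>2 * T)) * 1" using mass by (rule mult_left_mono) simp
  finally show "(\<integral>\<^sup>+\<omega>. ennreal (Z \<omega>) \<partial>Q) \<le> ennreal (exp (C\<^sup>2 * T))" by simp
qed


section \<open>The law of adaptively drawn samples\<close>

definition draws :: "(nat \<Rightarrow> nat \<Rightarrow> 's \<Rightarrow> 'a) \<Rightarrow> (nat \<times> nat) set \<Rightarrow> 's \<Rightarrow> nat \<times> nat \<Rightarrow> 'a" where
  "draws \<xi> J s = (\<lambda>i\<in>J. \<xi> (fst i) (snd i) s)"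

lemma history_eq_draws: "history N \<xi> k s = draws \<xi> (past N k) s"
  by (auto simp: history_def draws_def restrict_def fun_eq_iff)

text \<open>Histories of different iterations, and everything drawn before a given sample, are restrictions of one
  family indexed by pairs of iteration and sample number.\<close>

lemma draws_restrict: "I \<subseteq> J \<Longrightarrow> restrict (draws \<xi> J s) I = draws \<xi> I s"
  by (auto simp: draws_def restrict_def fun_eq_iff)

text \<open>What the convergence proof needs to know about the sampling scheme: the weight \<open>Z k x\<close> is positive, its
  reciprocal is the density of the proposal chosen after history \<open>x\<close>, and given the history the draws of
  an iteration are independent with that law.\<close>

locale adaptive_sampling = Q: prob_space Q + S: prob_space S
  for Q :: "'a measure" and S :: "'s measure" +
  fixes N :: "nat \<Rightarrow> nat" and \<xi> :: "nat \<Rightarrow> nat \<Rightarrow> 's \<Rightarrow> 'a" and Z :: "nat \<Rightarrow> (nat \<times> nat \<Rightarrow> 'a) \<Rightarrow> 'a \<Rightarrow> real"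
  assumes draw_measurable: "\<And>k n. 1 \<le> k \<Longrightarrow> n \<in> {1..N k} \<Longrightarrow> \<xi> k n \<in> S \<rightarrow>\<^sub>M Q"
    and weight_measurable: "\<And>k. 1 \<le> k \<Longrightarrow>
      (\<lambda>(x, \<omega>). Z k x \<omega>) \<in> borel_measurable (history_space Q N k \<Otimes>\<^sub>M Q)"
    and weight_pos: "\<And>k x. 1 \<le> k \<Longrightarrow> x \<in> space (history_space Q N k) \<Longrightarrow> AE \<omega> in Q. 0 < Z k x \<omega>"
    and proposal_prob: "\<And>k x. 1 \<le> k \<Longrightarrow> x \<in> space (history_space Q N k) \<Longrightarrow>
      prob_space (density Q (\<lambda>\<omega>. ennreal (1 / Z k x \<omega>)))"
    and cond_law: "\<And>k A. 1 \<le> k \<Longrightarrow> (\<And>n. n \<in> {1..N k} \<Longrightarrow> A n \<in> sets Q) \<Longrightarrow>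
      AE s in S. real_cond_exp S (history_algebra Q N S \<xi> k)
          (indicator {s \<in> space S. \<forall>n\<in>{1..N k}. \<xi> k n s \<in> A n}) s =
        (\<Prod>n=1..N k. measure (density Q (\<lambda>\<omega>. ennreal (1 / Z k (history N \<xi> k s) \<omega>))) (A n))"
begin

lemma draws_measurable:
  assumes "\<And>k n. (k, n) \<in> J \<Longrightarrow> 1 \<le> k \<and> n \<in> {1..N k}"
  shows "draws \<xi> J \<in> S \<rightarrow>\<^sub>M (\<Pi>\<^sub>M i\<in>J. Q)"
  unfolding draws_def[abs_def]
  by (intro measurable_restrict draw_measurable) (use assms in \<open>auto simp: prod_eq_iff\<close>)

lemma past_valid: "(l, n) \<in> past N k \<Longrightarrow> 1 \<le> l \<and> n \<in> {1..N l}"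
  by (auto simp: past_def)

lemma history_measurable: "history N \<xi> k \<in> S \<rightarrow>\<^sub>M history_space Q N k"
  using draws_measurable[of "past N k", OF past_valid] unfolding history_eq_draws[abs_def] history_space_def .

lemma finite_past: "finite (past N k)"
  by (auto simp: past_def)

definition proposal :: "nat \<Rightarrow> (nat \<times> nat \<Rightarrow> 'a) \<Rightarrow> 'a measure" where
  "proposal k x = density Q (\<lambda>\<omega>. ennreal (1 / Z k x \<omega>))"

lemma weight_slice_measurable:
  assumes "1 \<le> k" "x \<in> space (history_space Q N k)"
  shows "Z k x \<in> borel_measurable Q"
proof -
  have "(\<lambda>\<omega>. (case (x, \<omega>) of (x, \<omega>) \<Rightarrow> Z k x \<omega>)) \<in> borel_measurable Q"
    by (rule measurable_compose[OF _ weight_measurable[OF assms(1)]]) (use assms(2) in measurable)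
  then show ?thesis by simp
qed

lemma emeasure_proposal:
  assumes "1 \<le> k" "x \<in> space (history_space Q N k)" "A \<in> sets Q"
  shows "emeasure (proposal k x) A = (\<integral>\<^sup>+\<omega>. ennreal (1 / Z k x \<omega>) * indicator A \<omega> \<partial>Q)"
  unfolding proposal_def using assms weight_slice_measurable[OF assms(1,2)]
  by (intro emeasure_density) auto

lemma history_subalgebra: "subalgebra S (history_algebra Q N S \<xi> k)"
  unfolding subalgebra_def history_algebra_def
  using measurable_sets[OF history_measurable, of _ k] measurable_space[OF history_measurable, of _ k]
  by (auto simp: sets_vimage_algebra2)

lemma history_measurable_algebra:
  "history N \<xi> k \<in> history_algebra Q N S \<xi> k \<rightarrow>\<^sub>M history_space Q N k"
  unfolding history_algebra_def
  by (rule measurable_vimage_algebra1) (use measurable_space[OF history_measurable] in auto)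

lemma proposal_measure_measurable:
  assumes "1 \<le> k" "A \<in> sets Q"
  shows "(\<lambda>x. measure (proposal k x) A) \<in> borel_measurable (history_space Q N k)"
proof -
  note weight_measurable[OF assms(1), measurable] assms(2)[measurable]
  have "(\<lambda>x. enn2real (\<integral>\<^sup>+\<omega>. ennreal (1 / Z k x \<omega>) * indicator A \<omega> \<partial>Q)) \<in> borel_measurable (history_space Q N k)"
    by measurable
  then show ?thesis
    by (rule measurable_cong[THEN iffD1, rotated]) (simp add: measure_def emeasure_proposal[OF assms(1) _ assms(2)])
qed

text \<open>Only the first \<open>n\<close> draws of the iteration are constrained; the others range over the whole space, which
  has probability one under every proposal.\<close>

lemma conditional_draws:
  assumes k: "1 \<le> k" and n: "n \<le> N k" and A: "\<And>m. m \<in> {1..n} \<Longrightarrow> A m \<in> sets Q"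
    and f: "f \<in> borel_measurable (history_algebra Q N S \<xi> k)" and f1: "\<And>s. s \<in> space S \<Longrightarrow> \<bar>f s\<bar> \<le> (1::real)"
  shows "(\<integral>s. f s * (\<Prod>m=1..n. measure (proposal k (history N \<xi> k s)) (A m)) \<partial>S)
    = (\<integral>s. f s * indicator {s \<in> space S. \<forall>m\<in>{1..n}. \<xi> k m s \<in> A m} s \<partial>S)"
proof -
  let ?H = "history_algebra Q N S \<xi> k"
  interpret H: finite_measure_subalgebra S ?H
    by unfold_locales (rule history_subalgebra)
  define A' where "A' m = (if m \<le> n then A m else space Q)" for m
  have A'_sets: "A' m \<in> sets Q" if "m \<in> {1..N k}" for m using A that by (auto simp: A'_def)
  define E where "E = {s \<in> space S. \<forall>m\<in>{1..n}. \<xi> k m s \<in> A m}"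
  have "\<xi> k m s \<in> space Q" if "m \<in> {1..N k}" "s \<in> space S" for m s
    using measurable_space[OF draw_measurable[OF k that(1)] that(2)] .
  then have E_eq: "{s \<in> space S. \<forall>m\<in>{1..N k}. \<xi> k m s \<in> A' m} = E"
    using n unfolding E_def A'_def by auto
  have E_sets: "E \<in> sets S"
  proof -
    have "{s \<in> space S. \<xi> k m s \<in> A m} \<in> sets S" if "m \<in> {1..n}" for m
      using measurable_sets[OF draw_measurable[OF k, of m] A[OF that]] that n
      by (simp add: vimage_def Int_def conj_commute)
    then show ?thesis unfolding E_def by (intro sets.sets_Collect_finite_All) auto
  qed
  have prod: "(\<Prod>m=1..N k. measure (proposal k (history N \<xi> k s)) (A' m))
      = (\<Prod>m=1..n. measure (proposal k (history N \<xi> k s)) (A m))" if "s \<in> space S" for s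
  proof (rule prod.mono_neutral_cong_right)
    have "prob_space (proposal k (history N \<xi> k s))"
      using proposal_prob[OF k measurable_space[OF history_measurable that]] by (simp add: proposal_def)
    from prob_space.prob_space[OF this]
    show "\<forall>m\<in>{1..N k} - {1..n}. measure (proposal k (history N \<xi> k s)) (A' m) = 1"
      by (auto simp: A'_def proposal_def)
  qed (use n in \<open>auto simp: A'_def\<close>)
  have cond: "AE s in S. real_cond_exp S ?H (indicator E) s = (\<Prod>m=1..N k. measure (proposal k (history N \<xi> k s)) (A' m))"
    unfolding E_eq[symmetric] proposal_def by (rule cond_law[OF k]) (rule A'_sets)
  have "AE s in S. real_cond_exp S ?H (indicator E) s = (\<Prod>m=1..n. measure (proposal k (history N \<xi> k s)) (A m))"
    using cond AE_space by eventually_elim (simp only: prod)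
  then have "(\<integral>s. f s * (\<Prod>m=1..n. measure (proposal k (history N \<xi> k s)) (A m)) \<partial>S)
      = (\<integral>s. f s * real_cond_exp S ?H (indicator E) s \<partial>S)"
  proof (intro integral_cong_AE)
    have [measurable]: "f \<in> borel_measurable S" by (rule measurable_from_subalg[OF history_subalgebra f])
    have [measurable]: "(\<lambda>s. measure (proposal k (history N \<xi> k s)) (A m)) \<in> borel_measurable S"
      if "m \<in> {1..n}" for m
      by (rule measurable_compose[OF history_measurable proposal_measure_measurable[OF k A[OF that]]])
    show "(\<lambda>s. f s * (\<Prod>m=1..n. measure (proposal k (history N \<xi> k s)) (A m))) \<in> borel_measurable S"
      by measurable
    show "(\<lambda>s. f s * real_cond_exp S ?H (indicator E) s) \<in> borel_measurable S" by measurable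
  qed auto
  also have "\<dots> = (\<integral>s. f s * indicator E s \<partial>S)"
  proof (rule H.real_cond_exp_intg)
    have [measurable]: "f \<in> borel_measurable S" by (rule measurable_from_subalg[OF history_subalgebra f])
    show "integrable S (\<lambda>s. f s * indicator E s)"
      using E_sets f1 by (intro S.integrable_const_bound[of _ 1] AE_I2) (auto simp: abs_mult indicator_def)
  qed (use f E_sets in auto)
  finally show ?thesis unfolding E_def .
qed

text \<open>The indices of all samples drawn before the \<open>n\<close>-th sample of iteration \<open>k\<close>.\<close>

definition before :: "nat \<Rightarrow> nat \<Rightarrow> (nat \<times> nat) set" where
  "before k n = past N k \<union> {k} \<times> {1..<n}"

lemma before_valid: "1 \<le> k \<Longrightarrow> n \<le> Suc (N k) \<Longrightarrow> (l, m) \<in> before k n \<Longrightarrow> 1 \<le> l \<and> m \<in> {1..N l}"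
  using past_valid by (auto simp: before_def)

text \<open>Both sides equal the integral, over the histories in the box, of the product of the proposal masses of
  the first \<open>n\<close> sets: on the left these are the probabilities of all \<open>n\<close> draws, on the right the \<open>n\<close>-th
  mass is a factor measurable with respect to the history and the others come from the first \<open>n - 1\<close> draws.\<close>

lemma next_draw_on_boxes:
  assumes k: "1 \<le> k" and n: "n \<in> {1..N k}" and A: "\<And>i. i \<in> insert (k, n) (before k n) \<Longrightarrow> A i \<in> sets Q"
  shows "emeasure S {s \<in> space S. \<forall>i\<in>insert (k, n) (before k n). \<xi> (fst i) (snd i) s \<in> A i}
    = (\<integral>\<^sup>+s. indicator {s \<in> space S. \<forall>i\<in>before k n. \<xi> (fst i) (snd i) s \<in> A i} s
        * emeasure (proposal k (history N \<xi> k s)) (A (k, n)) \<partial>S)"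
proof -
  let ?p = "\<lambda>m s. measure (proposal k (history N \<xi> k s)) (A (k, m))"
  let ?C = "\<lambda>j. {s \<in> space S. \<forall>m\<in>{1..j}. \<xi> k m s \<in> A (k, m)}"
  define B where "B = {s \<in> space S. \<forall>i\<in>past N k. \<xi> (fst i) (snd i) s \<in> A i}"
  have A_k: "A (k, m) \<in> sets Q" if "m \<in> {1..n}" for m
    using A[of "(k, m)"] that by (cases "m = n") (auto simp: before_def)
  have hist_prob: "prob_space (proposal k (history N \<xi> k s))" if "s \<in> space S" for s
    using proposal_prob[OF k measurable_space[OF history_measurable that]] by (simp add: proposal_def)
  have p_meas: "?p m \<in> borel_measurable (history_algebra Q N S \<xi> k)" if "m \<in> {1..n}" for m
    by (rule measurable_compose[OF history_measurable_algebra proposal_measure_measurable[OF k A_k[OF that]]])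
  have B_hist: "B \<in> sets (history_algebra Q N S \<xi> k)"
  proof -
    have "history N \<xi> k -` (\<Pi>\<^sub>E i\<in>past N k. A i) \<inter> space (history_algebra Q N S \<xi> k) \<in> sets (history_algebra Q N S \<xi> k)"
      using A by (intro measurable_sets[OF history_measurable_algebra])
        (auto simp: history_space_def before_def intro!: sets_PiM_I_finite finite_past)
    moreover have "history N \<xi> k -` (\<Pi>\<^sub>E i\<in>past N k. A i) \<inter> space (history_algebra Q N S \<xi> k) = B"
      by (force simp: B_def history_eq_draws draws_def history_algebra_def PiE_iff)
    ultimately show ?thesis by simp
  qed
  have B_S: "B \<in> sets S" using B_hist history_subalgebra by (auto simp: subalgebra_def)
  have C_S: "?C j \<in> sets S" if "j \<le> n" for j
  proof -
    have "{s \<in> space S. \<xi> k m s \<in> A (k, m)} \<in> sets S" if "m \<in> {1..j}" for m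
      using measurable_sets[OF draw_measurable[OF k, of m] A_k[of m]] that n \<open>j \<le> n\<close>
      by (simp add: vimage_def Int_def conj_commute)
    then show ?thesis by (intro sets.sets_Collect_finite_All) auto
  qed
  have box: "{s \<in> space S. \<forall>i\<in>before k j. \<xi> (fst i) (snd i) s \<in> A i} = B \<inter> ?C (j - 1)" for j
  proof -
    have "{1..<j} = {1..j - 1}" by auto
    then show ?thesis unfolding B_def before_def by (auto simp: ball_Un simp del: One_nat_def)
  qed
  have box': "{s \<in> space S. \<forall>i\<in>insert (k, n) (before k n). \<xi> (fst i) (snd i) s \<in> A i} = B \<inter> ?C n"
  proof -
    have "insert (k, n) (before k n) = before k (Suc n)" using n by (auto simp: before_def)
    then show ?thesis using box[of "Suc n"] by simp
  qed
  have prod_n: "(\<Prod>m=1..n. ?p m s) = ?p n s * (\<Prod>m=1..n-1. ?p m s)" for s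
    using n by (cases n) (auto simp: mult.commute)
  have "measure S (B \<inter> ?C n) = (\<integral>s. indicator B s * indicator (?C n) s \<partial>S)"
    using B_S C_S[of n] by (simp add: indicator_inter_arith[symmetric])
  also have "\<dots> = (\<integral>s. indicator B s * (\<Prod>m=1..n. ?p m s) \<partial>S)"
    using n A_k B_hist by (intro conditional_draws[symmetric] k) (auto simp: indicator_def)
  also have "\<dots> = (\<integral>s. (indicator B s * ?p n s) * (\<Prod>m=1..n-1. ?p m s) \<partial>S)"
    by (simp only: prod_n mult.assoc)
  also have "\<dots> = (\<integral>s. (indicator B s * ?p n s) * indicator (?C (n - 1)) s \<partial>S)"
  proof (intro conditional_draws k)
    show "(\<lambda>s. indicator B s * ?p n s) \<in> borel_measurable (history_algebra Q N S \<xi> k)"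
      using B_hist p_meas[of n] n by auto
    show "\<bar>indicator B s * ?p n s\<bar> \<le> 1" if "s \<in> space S" for s
      using prob_space.prob_le_1[OF hist_prob[OF that]] by (auto simp: indicator_def)
  qed (use n A_k in auto)
  finally have eq: "measure S (B \<inter> ?C n) = (\<integral>s. indicator (B \<inter> ?C (n - 1)) s * ?p n s \<partial>S)"
    by (simp add: indicator_inter_arith ac_simps)
  have p_meas_S: "?p n \<in> borel_measurable S"
    by (rule measurable_from_subalg[OF history_subalgebra p_meas]) (use n in auto)
  have "emeasure S (B \<inter> ?C n) = ennreal (\<integral>s. indicator (B \<inter> ?C (n - 1)) s * ?p n s \<partial>S)"
    using eq by (simp add: S.emeasure_eq_measure)
  also have "\<dots> = (\<integral>\<^sup>+s. ennreal (indicator (B \<inter> ?C (n - 1)) s * ?p n s) \<partial>S)"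
  proof (rule nn_integral_eq_integral[symmetric])
    show "integrable S (\<lambda>s. indicator (B \<inter> ?C (n - 1)) s * ?p n s)"
      using B_S C_S[of "n - 1"] p_meas_S prob_space.prob_le_1[OF hist_prob]
      by (intro S.integrable_const_bound[of _ 1] AE_I2) (auto simp: indicator_def)
  qed auto
  also have "\<dots> = (\<integral>\<^sup>+s. indicator (B \<inter> ?C (n - 1)) s * emeasure (proposal k (history N \<xi> k s)) (A (k, n)) \<partial>S)"
    using hist_prob
    by (intro nn_integral_cong) (auto simp: indicator_def prob_space.finite_measure finite_measure.emeasure_eq_measure)
  finally show ?thesis unfolding box' box[of n] .
qed

text \<open>Given everything drawn before it, the \<open>n\<close>-th sample of iteration \<open>k\<close> has law \<open>proposal k\<close> of the history,
  also given the earlier samples of the same iteration. The two sides are the integrals of \<open>\<phi>\<close> under two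
  finite measures on a finite product space, and these agree on boxes.\<close>

proposition nn_integral_next_draw:
  assumes k: "1 \<le> k" and n: "n \<in> {1..N k}"
    and \<phi>[measurable]: "\<phi> \<in> borel_measurable (\<Pi>\<^sub>M i\<in>insert (k, n) (before k n). Q)"
  shows "(\<integral>\<^sup>+s. \<phi> (draws \<xi> (insert (k, n) (before k n)) s) \<partial>S)
    = (\<integral>\<^sup>+s. (\<integral>\<^sup>+\<omega>. ennreal (1 / Z k (history N \<xi> k s) \<omega>) * \<phi> ((draws \<xi> (before k n) s)((k, n) := \<omega>)) \<partial>Q) \<partial>S)"
proof -
  let ?J = "before k n" and ?J' = "insert (k, n) (before k n)"
  let ?P = "\<Pi>\<^sub>M i\<in>?J'. Q"
  have fin: "finite ?J'" by (auto simp: before_def finite_past)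
  have notin: "(k, n) \<notin> ?J" by (auto simp: before_def past_def)
  have [measurable]: "draws \<xi> ?J \<in> S \<rightarrow>\<^sub>M (\<Pi>\<^sub>M i\<in>?J. Q)"
    using before_valid[OF k, of n] n by (intro draws_measurable) auto
  have [measurable]: "draws \<xi> ?J' \<in> S \<rightarrow>\<^sub>M ?P"
    using before_valid[OF k, of n] n k by (intro draws_measurable) auto
  have [measurable]: "(\<lambda>(s, \<omega>). (draws \<xi> ?J s)((k, n) := \<omega>)) \<in> (S \<Otimes>\<^sub>M Q) \<rightarrow>\<^sub>M ?P"
    unfolding split_beta by (intro measurable_fun_upd[of _ ?J]) auto
  have dens[measurable]: "(\<lambda>(s, \<omega>). ennreal (1 / Z k (history N \<xi> k s) \<omega>)) \<in> borel_measurable (S \<Otimes>\<^sub>M Q)"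
  proof -
    have hist: "(\<lambda>z. (history N \<xi> k (fst z), snd z)) \<in> (S \<Otimes>\<^sub>M Q) \<rightarrow>\<^sub>M (history_space Q N k \<Otimes>\<^sub>M Q)"
      using history_measurable by measurable
    have [measurable]: "(\<lambda>z. Z k (history N \<xi> k (fst z)) (snd z)) \<in> borel_measurable (S \<Otimes>\<^sub>M Q)"
      using measurable_compose[OF hist weight_measurable[OF k]] by simp
    show ?thesis unfolding split_beta by measurable
  qed
  define M1 where "M1 = distr S ?P (draws \<xi> ?J')"
  define M2 where "M2 = distr (density (S \<Otimes>\<^sub>M Q) (\<lambda>(s, \<omega>). ennreal (1 / Z k (history N \<xi> k s) \<omega>))) ?P
      (\<lambda>(s, \<omega>). (draws \<xi> ?J s)((k, n) := \<omega>))"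
  have M2_int: "(\<integral>\<^sup>+x. \<psi> x \<partial>M2)
      = (\<integral>\<^sup>+s. (\<integral>\<^sup>+\<omega>. ennreal (1 / Z k (history N \<xi> k s) \<omega>) * \<psi> ((draws \<xi> ?J s)((k, n) := \<omega>)) \<partial>Q) \<partial>S)"
    if [measurable]: "\<psi> \<in> borel_measurable ?P" for \<psi>
  proof -
    let ?u = "\<lambda>z. (draws \<xi> ?J (fst z))((k, n) := snd z)"
    have u: "?u \<in> (S \<Otimes>\<^sub>M Q) \<rightarrow>\<^sub>M ?P" by (intro measurable_fun_upd[of _ ?J]) auto
    have d: "(\<lambda>z. ennreal (1 / Z k (history N \<xi> k (fst z)) (snd z))) \<in> borel_measurable (S \<Otimes>\<^sub>M Q)"
      using dens by (simp add: split_beta)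
    have \<psi>u: "(\<lambda>z. \<psi> (?u z)) \<in> borel_measurable (S \<Otimes>\<^sub>M Q)" by (rule measurable_compose[OF u that])
    have "(\<integral>\<^sup>+x. \<psi> x \<partial>M2) = (\<integral>\<^sup>+z. ennreal (1 / Z k (history N \<xi> k (fst z)) (snd z)) * \<psi> (?u z) \<partial>(S \<Otimes>\<^sub>M Q))"
      unfolding M2_def split_beta using u d \<psi>u that
      by (simp add: nn_integral_distr nn_integral_density)
    also have "\<dots> = (\<integral>\<^sup>+s. (\<integral>\<^sup>+\<omega>. ennreal (1 / Z k (history N \<xi> k s) \<omega>) * \<psi> ((draws \<xi> ?J s)((k, n) := \<omega>)) \<partial>Q) \<partial>S)"
      using Q.nn_integral_fst[OF borel_measurable_times_ennreal[OF d \<psi>u]] by simp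
    finally show ?thesis .
  qed
  have "M1 = M2"
  proof (rule measure_eqI_PiM_finite[OF fin])
    show "sets M1 = sets ?P" "sets M2 = sets ?P" by (simp_all add: M1_def M2_def)
    show "range (\<lambda>_::nat. space ?P) \<subseteq> prod_algebra ?J' (\<lambda>_. Q)"
      using prod_algebraI_finite[OF fin, of "\<lambda>_. space Q" "\<lambda>_. Q"] by (simp add: space_PiM)
    show "(\<Union>i::nat. space ?P) = space ?P" by simp
    show "emeasure M1 (space ?P) \<noteq> \<infinity>"
      unfolding M1_def by (subst emeasure_distr) auto
    fix A assume A: "\<And>i. i \<in> ?J' \<Longrightarrow> A i \<in> sets Q"
    then have box[measurable]: "Pi\<^sub>E ?J' A \<in> sets ?P" by (intro sets_PiM_I_finite fin)
    have "emeasure M1 (Pi\<^sub>E ?J' A) = emeasure S {s \<in> space S. \<forall>i\<in>?J'. \<xi> (fst i) (snd i) s \<in> A i}"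
    proof -
      have "draws \<xi> ?J' -` Pi\<^sub>E ?J' A \<inter> space S = {s \<in> space S. \<forall>i\<in>?J'. \<xi> (fst i) (snd i) s \<in> A i}"
        by (force simp: draws_def PiE_iff)
      then show ?thesis unfolding M1_def by (subst emeasure_distr) simp_all
    qed
    also have "\<dots> = (\<integral>\<^sup>+s. indicator {s \<in> space S. \<forall>i\<in>?J. \<xi> (fst i) (snd i) s \<in> A i} s
        * emeasure (proposal k (history N \<xi> k s)) (A (k, n)) \<partial>S)"
      by (rule next_draw_on_boxes[OF k n A])
    also have "\<dots> = (\<integral>\<^sup>+x. indicator (Pi\<^sub>E ?J' A) x \<partial>M2)"
    proof (subst M2_int, measurable, rule nn_integral_cong)
      fix s assume s: "s \<in> space S"
      have hs: "history N \<xi> k s \<in> space (history_space Q N k)" by (rule measurable_space[OF history_measurable s])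
      have ind: "indicator (Pi\<^sub>E ?J' A) ((draws \<xi> ?J s)((k, n) := \<omega>))
          = (indicator {s \<in> space S. \<forall>i\<in>?J. \<xi> (fst i) (snd i) s \<in> A i} s * indicator (A (k, n)) \<omega> :: ennreal)" for \<omega>
      proof -
        let ?x = "(draws \<xi> ?J s)((k, n) := \<omega>)"
        have val: "?x i = \<xi> (fst i) (snd i) s" if "i \<in> ?J" for i
          using that notin by (cases "i = (k, n)") (simp_all add: draws_def)
        have ext: "?x \<in> extensional ?J'" by (simp add: draws_def extensional_def)
        have "?x \<in> Pi\<^sub>E ?J' A \<longleftrightarrow> (\<forall>i\<in>?J. \<xi> (fst i) (snd i) s \<in> A i) \<and> \<omega> \<in> A (k, n)"
          unfolding PiE_iff Set.ball_simps(7) using ext val by (metis fun_upd_same)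
        then show ?thesis using s by (simp add: indicator_def)
      qed
      show "indicator {s \<in> space S. \<forall>i\<in>?J. \<xi> (fst i) (snd i) s \<in> A i} s * emeasure (proposal k (history N \<xi> k s)) (A (k, n))
        = (\<integral>\<^sup>+\<omega>. ennreal (1 / Z k (history N \<xi> k s) \<omega>) * indicator (Pi\<^sub>E ?J' A) ((draws \<xi> ?J s)((k, n) := \<omega>)) \<partial>Q)"
        unfolding ind emeasure_proposal[OF k hs A[OF insertI1]]
        using weight_slice_measurable[OF k hs] A[OF insertI1]
        by (subst nn_integral_cmult[symmetric]) (auto intro!: nn_integral_cong simp: ac_simps)
    qed
    also have "\<dots> = emeasure M2 (Pi\<^sub>E ?J' A)" by (simp add: M2_def)
    finally show "emeasure M1 (Pi\<^sub>E ?J' A) = emeasure M2 (Pi\<^sub>E ?J' A)" .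
  qed
  moreover have "(\<integral>\<^sup>+s. \<phi> (draws \<xi> ?J' s) \<partial>S) = (\<integral>\<^sup>+x. \<phi> x \<partial>M1)"
    unfolding M1_def by (subst nn_integral_distr) auto
  ultimately show ?thesis using M2_int[OF \<phi>] by simp
qed

end


section \<open>Consistency for nonnegative integrands\<close>

text \<open>The strong law concerns a single sequence, so the samples are enumerated in the order in which they
  are drawn. An iteration without samples occupies no place in the enumeration; this is why an
  index is found through the first iteration at which the running total exceeds it.\<close>

definition total_draws :: "(nat \<Rightarrow> nat) \<Rightarrow> nat \<Rightarrow> nat" where
  "total_draws N k = (\<Sum>l=1..k. N l)"

definition draw_index :: "(nat \<Rightarrow> nat) \<Rightarrow> nat \<Rightarrow> nat \<times> nat" where
  "draw_index N m = (let k = (LEAST k. m < total_draws N k) in (k, Suc (m - total_draws N (k - 1))))"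

lemma total_draws_Suc: "total_draws N (Suc k) = total_draws N k + N (Suc k)"
  by (simp add: total_draws_def)

lemma total_draws_mono: "j \<le> k \<Longrightarrow> total_draws N j \<le> total_draws N k"
  unfolding total_draws_def by (intro sum_mono2) auto

lemma draw_index_eq:
  assumes "i < N (Suc k)"
  shows "draw_index N (total_draws N k + i) = (Suc k, Suc i)"
proof -
  have "(LEAST j. total_draws N k + i < total_draws N j) = Suc k"
  proof (rule Least_equality)
    show "total_draws N k + i < total_draws N (Suc k)" using assms by (simp add: total_draws_Suc)
    show "Suc k \<le> j" if "total_draws N k + i < total_draws N j" for j
    proof (rule ccontr)
      assume "\<not> Suc k \<le> j"
      then show False using total_draws_mono[of j k N] that by simp
    qed
  qed
  then show ?thesis by (simp add: draw_index_def)
qed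

lemma draw_index_cases:
  assumes "filterlim (total_draws N) at_top sequentially"
  obtains k i where "m = total_draws N k + i" "i < N (Suc k)"
proof -
  have "eventually (\<lambda>k. Suc m \<le> total_draws N k) sequentially"
    using assms by (simp add: filterlim_at_top)
  then have "\<exists>k. Suc m \<le> total_draws N k" by (rule eventually_happens'[OF sequentially_bot])
  then obtain k0 where "m < total_draws N k0" by (auto simp: Suc_le_eq)
  then have L: "m < total_draws N (LEAST k. m < total_draws N k)" by (rule LeastI)
  moreover have "(LEAST k. m < total_draws N k) \<noteq> 0" using L by (intro notI) (simp add: total_draws_def)
  then obtain k where k: "(LEAST k. m < total_draws N k) = Suc k" by (cases "LEAST k. m < total_draws N k") auto
  moreover have "\<not> m < total_draws N k" by (rule not_less_Least) (simp add: k)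
  ultimately show thesis using that[of k "m - total_draws N k"] by (simp add: total_draws_Suc)
qed

lemma past_Suc: "past N (Suc (Suc k)) = past N (Suc k) \<union> {Suc k} \<times> {1..N (Suc k)}"
  by (auto simp: past_def less_Suc_eq)

text \<open>The predecessors of a sample in the enumeration are exactly the samples drawn before it.\<close>

lemma draw_index_image:
  "i \<le> N (Suc k) \<Longrightarrow> draw_index N ` {..<total_draws N k + i} = past N (Suc k) \<union> {Suc k} \<times> {1..<Suc i}"
proof (induction k arbitrary: i)
  case k: 0
  from k show ?case
  proof (induction i)
    case (Suc i)
    then show ?case using draw_index_eq[of i N 0]
      by (auto simp: lessThan_Suc total_draws_def past_def less_Suc_eq)
  qed (auto simp: total_draws_def past_def)
next
  case k: (Suc k)
  from k.prems show ?case
  proof (induction i)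
    case 0
    have "draw_index N ` {..<total_draws N (Suc k)} = past N (Suc (Suc k))"
      using k.IH[of "N (Suc k)"] unfolding past_Suc total_draws_Suc by auto
    then show ?case by simp
  next
    case (Suc i)
    then show ?case using draw_index_eq[of i N "Suc k"] by (auto simp: lessThan_Suc less_Suc_eq)
  qed
qed

lemma sum_draw_index:
  fixes y :: "nat \<times> nat \<Rightarrow> real"
  shows "(\<Sum>m<total_draws N k. y (draw_index N m)) = (\<Sum>l=1..k. \<Sum>n=1..N l. y (l, n))"
proof (induction k)
  case (Suc k)
  have "(\<Sum>m<total_draws N k + i. y (draw_index N m))
      = (\<Sum>m<total_draws N k. y (draw_index N m)) + (\<Sum>n=1..i. y (Suc k, n))" if "i \<le> N (Suc k)" for i
    using that by (induction i) (simp_all add: draw_index_eq)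
  from this[of "N (Suc k)"] show ?case using Suc by (simp add: total_draws_Suc)
qed (simp add: total_draws_def)

context adaptive_sampling
begin

lemma weight_of_earlier_measurable:
  assumes k: "1 \<le> k" and "past N k \<subseteq> J"
  shows "(\<lambda>(x, \<omega>). Z k (restrict x (past N k)) \<omega>) \<in> borel_measurable ((\<Pi>\<^sub>M i\<in>J. Q) \<Otimes>\<^sub>M Q)"
proof -
  have [measurable]: "(\<lambda>x. restrict x (past N k)) \<in> (\<Pi>\<^sub>M i\<in>J. Q) \<rightarrow>\<^sub>M history_space Q N k"
    unfolding history_space_def by (rule measurable_restrict_subset[OF assms(2)])
  have "(\<lambda>z. (restrict (fst z) (past N k), snd z)) \<in> ((\<Pi>\<^sub>M i\<in>J. Q) \<Otimes>\<^sub>M Q) \<rightarrow>\<^sub>M (history_space Q N k \<Otimes>\<^sub>M Q)"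
    by measurable
  from measurable_compose[OF this weight_measurable[OF k]] show ?thesis by (simp add: split_beta)
qed

text \<open>The law of the next draw, in terms of the earlier draws and the new one as separate arguments.\<close>

lemma nn_integral_next_draw_pair:
  assumes k: "1 \<le> k" and n: "n \<in> {1..N k}"
    and \<psi>: "(\<lambda>(x, \<omega>). \<psi> x \<omega>) \<in> borel_measurable ((\<Pi>\<^sub>M i\<in>before k n. Q) \<Otimes>\<^sub>M Q)"
  shows "(\<integral>\<^sup>+s. \<psi> (draws \<xi> (before k n) s) (\<xi> k n s) \<partial>S)
    = (\<integral>\<^sup>+s. (\<integral>\<^sup>+\<omega>. ennreal (1 / Z k (history N \<xi> k s) \<omega>) * \<psi> (draws \<xi> (before k n) s) \<omega> \<partial>Q) \<partial>S)"
proof -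
  let ?J = "before k n" and ?J' = "insert (k, n) (before k n)"
  have notin: "(k, n) \<notin> ?J" by (auto simp: before_def past_def)
  have "(\<lambda>x. (restrict x ?J, x (k, n))) \<in> (\<Pi>\<^sub>M i\<in>?J'. Q) \<rightarrow>\<^sub>M ((\<Pi>\<^sub>M i\<in>?J. Q) \<Otimes>\<^sub>M Q)"
    by (intro measurable_Pair measurable_restrict_subset measurable_component_singleton) auto
  from measurable_compose[OF this \<psi>]
  have "(\<lambda>x. \<psi> (restrict x ?J) (x (k, n))) \<in> borel_measurable (\<Pi>\<^sub>M i\<in>?J'. Q)" by simp
  note eq = nn_integral_next_draw[OF k n this]
  have "restrict (draws \<xi> ?J' s) ?J = draws \<xi> ?J s" for s by (rule draws_restrict) auto
  moreover have "draws \<xi> ?J' s (k, n) = \<xi> k n s" for s by (simp add: draws_def)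
  moreover have "restrict ((draws \<xi> ?J s)((k, n) := \<omega>)) ?J = draws \<xi> ?J s" for s \<omega>
    using notin by (auto simp: draws_def restrict_def fun_eq_iff)
  ultimately show ?thesis using eq by simp
qed

lemma history_of_before: "restrict (draws \<xi> (before k n) s) (past N k) = history N \<xi> k s"
  unfolding history_eq_draws by (rule draws_restrict) (auto simp: before_def)

text \<open>For each history the weight is positive \<open>Q\<close>-almost everywhere, and the law of the draw has a density with
  respect to \<open>Q\<close>.\<close>

lemma AE_weight_pos:
  assumes k: "1 \<le> k" and n: "n \<in> {1..N k}"
  shows "AE s in S. 0 < Z k (history N \<xi> k s) (\<xi> k n s)"
proof -
  let ?J = "before k n"
  define \<psi> where "\<psi> x \<omega> = (indicator {z. z \<le> 0} (Z k (restrict x (past N k)) \<omega>) :: ennreal)" for x \<omega>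
  note weight_of_earlier_measurable[OF k, of ?J, measurable]
  have [measurable]: "(\<lambda>(x, \<omega>). \<psi> x \<omega>) \<in> borel_measurable ((\<Pi>\<^sub>M i\<in>?J. Q) \<Otimes>\<^sub>M Q)"
    unfolding \<psi>_def using weight_of_earlier_measurable[OF k, of ?J] by (simp add: before_def split_beta)
  have [measurable]: "draws \<xi> ?J \<in> S \<rightarrow>\<^sub>M (\<Pi>\<^sub>M i\<in>?J. Q)"
    using before_valid[OF k, of n] n by (intro draws_measurable) auto
  have [measurable]: "\<xi> k n \<in> S \<rightarrow>\<^sub>M Q" by (rule draw_measurable[OF k n])
  have "(\<integral>\<^sup>+s. \<psi> (draws \<xi> ?J s) (\<xi> k n s) \<partial>S)
     = (\<integral>\<^sup>+s. (\<integral>\<^sup>+\<omega>. ennreal (1 / Z k (history N \<xi> k s) \<omega>) * \<psi> (draws \<xi> ?J s) \<omega> \<partial>Q) \<partial>S)"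
    by (rule nn_integral_next_draw_pair[OF k n]) measurable
  also have "\<dots> = (\<integral>\<^sup>+s. 0 \<partial>S)"
  proof (rule nn_integral_cong)
    fix s assume "s \<in> space S"
    then have hs: "history N \<xi> k s \<in> space (history_space Q N k)" by (rule measurable_space[OF history_measurable])
    have "(\<integral>\<^sup>+\<omega>. ennreal (1 / Z k (history N \<xi> k s) \<omega>) * \<psi> (draws \<xi> ?J s) \<omega> \<partial>Q) = (\<integral>\<^sup>+\<omega>. 0 \<partial>Q)"
      by (rule nn_integral_cong_AE) (use weight_pos[OF k hs] in \<open>eventually_elim; simp add: \<psi>_def history_of_before\<close>)
    then show "(\<integral>\<^sup>+\<omega>. ennreal (1 / Z k (history N \<xi> k s) \<omega>) * \<psi> (draws \<xi> ?J s) \<omega> \<partial>Q) = 0" by simp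
  qed
  finally have "(\<integral>\<^sup>+s. \<psi> (draws \<xi> ?J s) (\<xi> k n s) \<partial>S) = 0" by simp
  then have "AE s in S. \<psi> (draws \<xi> ?J s) (\<xi> k n s) = 0"
    by (subst (asm) nn_integral_0_iff_AE) measurable
  then show ?thesis
    by eventually_elim (auto simp: \<psi>_def history_of_before indicator_def not_le split: if_splits)
qed

text \<open>Truncating the weight at zero changes it only on a null set, but makes the summands of the
  estimator nonnegative everywhere.\<close>

definition weighted :: "('a \<Rightarrow> real) \<Rightarrow> nat \<times> nat \<Rightarrow> (nat \<times> nat \<Rightarrow> 'a) \<Rightarrow> real" where
  "weighted f i x = f (x i) * max 0 (Z (fst i) (restrict x (past N (fst i))) (x i))"

lemma weighted_measurable:
  assumes [measurable]: "f \<in> borel_measurable Q" and "1 \<le> fst i" "i \<in> J" "past N (fst i) \<subseteq> J"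
  shows "weighted f i \<in> borel_measurable (\<Pi>\<^sub>M i\<in>J. Q)"
proof -
  have [measurable]: "(\<lambda>x. x i) \<in> (\<Pi>\<^sub>M i\<in>J. Q) \<rightarrow>\<^sub>M Q"
    using assms(3) by (rule measurable_component_singleton)
  have "(\<lambda>x. (x, x i)) \<in> (\<Pi>\<^sub>M i\<in>J. Q) \<rightarrow>\<^sub>M ((\<Pi>\<^sub>M i\<in>J. Q) \<Otimes>\<^sub>M Q)" by measurable
  from measurable_compose[OF this weight_of_earlier_measurable[OF assms(2,4)]]
  have [measurable]: "(\<lambda>x. Z (fst i) (restrict x (past N (fst i))) (x i)) \<in> borel_measurable (\<Pi>\<^sub>M i\<in>J. Q)"
    by simp
  show ?thesis unfolding weighted_def[abs_def] by measurable
qed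

lemma weighted_draws:
  assumes "(k, n) \<in> J" "past N k \<subseteq> J"
  shows "weighted f (k, n) (draws \<xi> J s) = f (\<xi> k n s) * max 0 (Z k (history N \<xi> k s) (\<xi> k n s))"
  unfolding weighted_def using assms by (simp add: draws_restrict history_eq_draws) (simp add: draws_def)

text \<open>Integrating the weighted sample \<open>f * Z\<close> against the proposal density \<open>1 / Z\<close> gives the integral of \<open>f\<close> under
  \<open>Q\<close>, whatever the history. So in the order of drawing all weighted samples have the same conditional mean
  \<open>c\<close> given their predecessors, the moment hypothesis bounds their \<open>q\<close>-th moments, and the
  strong law applies. The estimators are the means along the subsequence of running totals.\<close>

proposition flat_amis_consistent_nonneg:
  assumes f[measurable]: "f \<in> borel_measurable Q" and f0: "\<And>\<omega>. 0 \<le> f \<omega>"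
    and c: "0 \<le> c" "(\<integral>\<^sup>+\<omega>. ennreal (f \<omega>) \<partial>Q) = ennreal c"
    and q: "1 < q" "q \<le> 2"
    and moment: "\<And>k x. 1 \<le> k \<Longrightarrow> x \<in> space (history_space Q N k) \<Longrightarrow>
      (\<integral>\<^sup>+\<omega>. ennreal (1 / Z k x \<omega>) * ennreal ((f \<omega> * max 0 (Z k x \<omega>)) powr q) \<partial>Q) \<le> ennreal K"
    and total: "filterlim (total_draws N) at_top sequentially"
  shows "AE s in S. (\<lambda>k. flat_amis_estimator N \<xi> Z f k s) \<longlonglongrightarrow> c"
proof -
  define y where "y i s = f (\<xi> (fst i) (snd i) s) * max 0 (Z (fst i) (history N \<xi> (fst i) s) (\<xi> (fst i) (snd i) s))" for i s
  define Y where "Y m = y (draw_index N m)" for m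
  have y_draws: "y i s = weighted f i (draws \<xi> J s)" if "i \<in> J" "past N (fst i) \<subseteq> J" for i J s
    using weighted_draws[of "fst i" "snd i" J f s] that by (simp add: y_def)
  have index: "\<exists>k n. draw_index N m = (k, n) \<and> 1 \<le> k \<and> n \<in> {1..N k} \<and> draw_index N ` {..<m} = before k n" for m
  proof -
    obtain k i where ki: "m = total_draws N k + i" "i < N (Suc k)" by (rule draw_index_cases[OF total])
    then show ?thesis
      using draw_index_eq[of i N k] draw_index_image[of i N k] by (auto simp: before_def)
  qed
  have past_before: "past N (fst i) \<subseteq> before k n" if "i \<in> before k n" for i k n
    using that by (auto simp: before_def past_def)
  have valid: "1 \<le> fst i" if "1 \<le> k" "i \<in> before k n" for i k n
    using that by (auto simp: before_def past_def)
  \<comment> \<open>A partial sum is a function of the samples drawn before the next one.\<close>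
  have partial: "\<exists>g \<in> borel_measurable (\<Pi>\<^sub>M i\<in>before k n. Q). \<forall>s. (\<Sum>i<m. Y i s) = g (draws \<xi> (before k n) s)"
    if "draw_index N ` {..<m} = before k n" "1 \<le> k" for m k n
  proof (intro bexI[of _ "\<lambda>x. \<Sum>i<m. weighted f (draw_index N i) x"] allI)
    have mem: "draw_index N i \<in> before k n" if "i < m" for i
      using that \<open>draw_index N ` {..<m} = before k n\<close> by blast
    show "(\<Sum>i<m. Y i s) = (\<Sum>i<m. weighted f (draw_index N i) (draws \<xi> (before k n) s))" for s
      using mem past_before by (intro sum.cong refl) (simp add: Y_def y_draws)
    show "(\<lambda>x. \<Sum>i<m. weighted f (draw_index N i) x) \<in> borel_measurable (\<Pi>\<^sub>M i\<in>before k n. Q)"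
      by (intro borel_measurable_sum weighted_measurable f valid[OF \<open>1 \<le> k\<close> mem] past_before[OF mem] mem) simp_all
  qed
  have draws_before: "draws \<xi> (before k n) \<in> S \<rightarrow>\<^sub>M (\<Pi>\<^sub>M i\<in>before k n. Q)" if "1 \<le> k" "n \<in> {1..N k}" for k n
    using before_valid[OF that(1), of n] that by (intro draws_measurable) auto
  have y_meas: "y (k, n) \<in> borel_measurable S" if "1 \<le> k" "n \<in> {1..N k}" for k n
  proof -
    have "draws \<xi> (insert (k, n) (before k n)) \<in> S \<rightarrow>\<^sub>M (\<Pi>\<^sub>M i\<in>insert (k, n) (before k n). Q)"
      using before_valid[OF that(1), of n] that by (intro draws_measurable) auto
    moreover have "weighted f (k, n) \<in> borel_measurable (\<Pi>\<^sub>M i\<in>insert (k, n) (before k n). Q)"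
      using that by (intro weighted_measurable f) (auto simp: before_def)
    ultimately have "(\<lambda>s. weighted f (k, n) (draws \<xi> (insert (k, n) (before k n)) s)) \<in> borel_measurable S"
      by (rule measurable_compose)
    moreover have "y (k, n) = (\<lambda>s. weighted f (k, n) (draws \<xi> (insert (k, n) (before k n)) s))"
      by (rule ext, rule y_draws) (auto simp: before_def)
    ultimately show ?thesis by simp
  qed
  have w_meas: "(\<lambda>(x, \<omega>). f \<omega> * max 0 (Z k (restrict x (past N k)) \<omega>))
      \<in> borel_measurable ((\<Pi>\<^sub>M i\<in>before k n. Q) \<Otimes>\<^sub>M Q)" if "1 \<le> k" for k n
  proof -
    have [measurable]: "(\<lambda>(x, \<omega>). Z k (restrict x (past N k)) \<omega>) \<in> borel_measurable ((\<Pi>\<^sub>M i\<in>before k n. Q) \<Otimes>\<^sub>M Q)"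
      by (rule weight_of_earlier_measurable[OF that]) (auto simp: before_def)
    show ?thesis by measurable
  qed
  have "AE s in S. (\<lambda>m. (\<Sum>i<m. Y i s) / real m) \<longlonglongrightarrow> c"
  proof (rule strong_law_conditional_mean[where q = q and K = K])
    show "prob_space S" by (rule S.prob_space_axioms)
    show "Y m \<in> borel_measurable S" for m
      using index[of m] y_meas unfolding Y_def by auto
    show "0 \<le> Y m s" for m s by (simp add: Y_def y_def f0)
    show "(\<integral>\<^sup>+s. ennreal (Y m s powr q) \<partial>S) \<le> ennreal K" for m
    proof -
      obtain k n where m: "draw_index N m = (k, n)" and k: "1 \<le> k" and n: "n \<in> {1..N k}"
        using index[of m] by blast
      define \<psi> where "\<psi> x \<omega> = ennreal ((f \<omega> * max 0 (Z k (restrict x (past N k)) \<omega>)) powr q)" for x \<omega>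
      have "(\<lambda>(x, \<omega>). \<psi> x \<omega>) \<in> borel_measurable ((\<Pi>\<^sub>M i\<in>before k n. Q) \<Otimes>\<^sub>M Q)"
        unfolding \<psi>_def using w_meas[OF k, of n] by measurable
      from nn_integral_next_draw_pair[OF k n this]
      have "(\<integral>\<^sup>+s. ennreal (Y m s powr q) \<partial>S)
          = (\<integral>\<^sup>+s. (\<integral>\<^sup>+\<omega>. ennreal (1 / Z k (history N \<xi> k s) \<omega>)
              * ennreal ((f \<omega> * max 0 (Z k (history N \<xi> k s) \<omega>)) powr q) \<partial>Q) \<partial>S)"
        by (simp add: \<psi>_def history_of_before Y_def y_def m)
      also have "\<dots> \<le> (\<integral>\<^sup>+s. ennreal K \<partial>S)"
        by (intro nn_integral_mono moment k measurable_space[OF history_measurable])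
      also have "\<dots> = ennreal K" by (simp add: S.emeasure_space_1)
      finally show ?thesis .
    qed
    show "(\<integral>\<^sup>+s. \<phi> (\<Sum>i<m. Y i s) * ennreal (Y m s) \<partial>S) = ennreal c * (\<integral>\<^sup>+s. \<phi> (\<Sum>i<m. Y i s) \<partial>S)"
      if [measurable]: "\<phi> \<in> borel_measurable borel" for m and \<phi> :: "real \<Rightarrow> ennreal"
    proof -
      obtain k n where m: "draw_index N m = (k, n)" and k: "1 \<le> k" and n: "n \<in> {1..N k}"
        and J: "draw_index N ` {..<m} = before k n"
        using index[of m] by blast
      obtain g where g[measurable]: "g \<in> borel_measurable (\<Pi>\<^sub>M i\<in>before k n. Q)"
        and sum: "\<And>s. (\<Sum>i<m. Y i s) = g (draws \<xi> (before k n) s)"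
        using partial[OF J k] by blast
      define \<psi> where "\<psi> x \<omega> = \<phi> (g x) * ennreal (f \<omega> * max 0 (Z k (restrict x (past N k)) \<omega>))" for x \<omega>
      have "(\<lambda>(x, \<omega>). \<psi> x \<omega>) \<in> borel_measurable ((\<Pi>\<^sub>M i\<in>before k n. Q) \<Otimes>\<^sub>M Q)"
        unfolding \<psi>_def using w_meas[OF k, of n] by measurable
      from nn_integral_next_draw_pair[OF k n this]
      have "(\<integral>\<^sup>+s. \<phi> (\<Sum>i<m. Y i s) * ennreal (Y m s) \<partial>S)
          = (\<integral>\<^sup>+s. (\<integral>\<^sup>+\<omega>. ennreal (1 / Z k (history N \<xi> k s) \<omega>) * (\<phi> (\<Sum>i<m. Y i s)
              * ennreal (f \<omega> * max 0 (Z k (history N \<xi> k s) \<omega>))) \<partial>Q) \<partial>S)"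
        by (simp add: \<psi>_def history_of_before Y_def[of m] y_def m sum)
      also have "\<dots> = (\<integral>\<^sup>+s. ennreal c * \<phi> (\<Sum>i<m. Y i s) \<partial>S)"
      proof (rule nn_integral_cong)
        fix s assume "s \<in> space S"
        then have hs: "history N \<xi> k s \<in> space (history_space Q N k)" by (rule measurable_space[OF history_measurable])
        have "(\<integral>\<^sup>+\<omega>. ennreal (1 / Z k (history N \<xi> k s) \<omega>) * (\<phi> (\<Sum>i<m. Y i s)
              * ennreal (f \<omega> * max 0 (Z k (history N \<xi> k s) \<omega>))) \<partial>Q)
            = (\<integral>\<^sup>+\<omega>. \<phi> (\<Sum>i<m. Y i s) * ennreal (f \<omega>) \<partial>Q)"
        proof (rule nn_integral_cong_AE)
          show "AE \<omega> in Q. ennreal (1 / Z k (history N \<xi> k s) \<omega>) * (\<phi> (\<Sum>i<m. Y i s)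
              * ennreal (f \<omega> * max 0 (Z k (history N \<xi> k s) \<omega>))) = \<phi> (\<Sum>i<m. Y i s) * ennreal (f \<omega>)"
            using weight_pos[OF k hs]
          proof eventually_elim
            case (elim \<omega>)
            have "ennreal (1 / Z k (history N \<xi> k s) \<omega>) * ennreal (f \<omega> * max 0 (Z k (history N \<xi> k s) \<omega>)) = ennreal (f \<omega>)"
              using elim f0[of \<omega>] by (simp add: ennreal_mult[symmetric])
            then show ?case by (metis mult.assoc mult.commute)
          qed
        qed
        also have "\<dots> = \<phi> (\<Sum>i<m. Y i s) * ennreal c" by (subst nn_integral_cmult) (simp_all add: c)
        finally show "(\<integral>\<^sup>+\<omega>. ennreal (1 / Z k (history N \<xi> k s) \<omega>) * (\<phi> (\<Sum>i<m. Y i s)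
              * ennreal (f \<omega> * max 0 (Z k (history N \<xi> k s) \<omega>))) \<partial>Q) = ennreal c * \<phi> (\<Sum>i<m. Y i s)"
          by (simp add: mult.commute)
      qed
      also have "\<dots> = ennreal c * (\<integral>\<^sup>+s. \<phi> (\<Sum>i<m. Y i s) \<partial>S)"
      proof (rule nn_integral_cmult)
        have "(\<lambda>s. g (draws \<xi> (before k n) s)) \<in> borel_measurable S"
          by (rule measurable_compose[OF draws_before[OF k n] g])
        then show "(\<lambda>s. \<phi> (\<Sum>i<m. Y i s)) \<in> borel_measurable S" unfolding sum by measurable
      qed
      finally show ?thesis .
    qed
  qed (use c q in auto)
  moreover have "AE s in S. \<forall>k\<ge>1. \<forall>n\<in>{1..N k}. 0 < Z k (history N \<xi> k s) (\<xi> k n s)"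
    by (simp only: AE_all_countable AE_ball_countable countable_finite finite_atLeastAtMost)
      (use AE_weight_pos in \<open>auto simp: AE_all_countable AE_ball_countable\<close>)
  ultimately show ?thesis
  proof eventually_elim
    case (elim s)
    have "flat_amis_estimator N \<xi> Z f k s = (\<Sum>i<total_draws N k. Y i s) / real (total_draws N k)" for k
      unfolding flat_amis_estimator_def Y_def sum_draw_index[of "\<lambda>i. y i s" N k] total_draws_def[symmetric]
      using elim(2) by (intro arg_cong2[where f = "(/)"] sum.cong refl) (auto simp: y_def max_def less_imp_le)
    then show ?case using filterlim_compose[OF elim(1) total] by simp
  qed
qed

end


section \<open>Consistency of flat-AMIS\<close>

text \<open>The exponent \<open>q = 2 * r / (r + 1)\<close> is the one for which \<open>a powr q * z powr (q - 1)\<close> is a geometric mean of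
  \<open>a powr r\<close> and \<open>z\<close> with weights adding up to one. It lies strictly between one and two, and only the first
  moment of the weight \<open>z\<close> under \<open>Q\<close> enters the resulting bound.\<close>

lemma weighted_moment_interpolation:
  fixes a z r :: real
  assumes "0 \<le> a" "0 < z" "1 < r"
  shows "1 / z * (a * z) powr (2 * r / (r + 1)) \<le> a powr r + z"
proof (cases "a = 0")
  case False
  then have a: "0 < a" using assms by simp
  have r1: "2 * r / (r + 1) - 1 = (r - 1) / (r + 1)" using assms(3) by (simp add: field_simps)
  have "1 / z * (a * z) powr (2 * r / (r + 1)) = a powr (2 * r / (r + 1)) * z powr (2 * r / (r + 1) - 1)"
    using assms a by (simp add: powr_mult powr_diff)
  also have "\<dots> = (a powr r) powr (2 / (r + 1)) * z powr ((r - 1) / (r + 1))"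
    unfolding r1 by (simp add: powr_powr mult.commute)
  also have "\<dots> \<le> 2 / (r + 1) * a powr r + (r - 1) / (r + 1) * z"
  proof (rule Youngs_inequality_0)
    have "2 / (r + 1) + (r - 1) / (r + 1) = (r + 1) / (r + 1)" by (simp add: add_divide_distrib[symmetric])
    then show "2 / (r + 1) + (r - 1) / (r + 1) = 1" using assms(3) by simp
  qed (use assms a in auto)
  also have "\<dots> \<le> 1 * a powr r + 1 * z"
    using assms by (intro add_mono mult_right_mono) auto
  finally show ?thesis by simp
qed (use assms in simp)

theorem theorem4:
  fixes T :: real
    and Q :: "'a measure"
    and F :: "real \<Rightarrow> 'a measure"
    and W :: "real \<Rightarrow> 'a \<Rightarrow> real ^ 'm"
    and \<mu> :: "real \<Rightarrow> 'a \<Rightarrow> real ^ 'd"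
    and \<sigma> :: "real \<Rightarrow> 'a \<Rightarrow> real ^ 'm ^ 'd"
    and X :: "real \<Rightarrow> 'a \<Rightarrow> real ^ 'd"
    and h :: "(real \<Rightarrow> real ^ 'd) \<Rightarrow> real"
    and \<U> :: "(real \<Rightarrow> 'a \<Rightarrow> real ^ 'm) set"
    and N :: "nat \<Rightarrow> nat"
    and S :: "'s measure"
    and \<xi> :: "nat \<Rightarrow> nat \<Rightarrow> 's \<Rightarrow> 'a"
    and U :: "nat \<Rightarrow> (nat \<times> nat \<Rightarrow> 'a) \<Rightarrow> real \<Rightarrow> 'a \<Rightarrow> real ^ 'm"
    and Z :: "nat \<Rightarrow> (nat \<times> nat \<Rightarrow> 'a) \<Rightarrow> 'a \<Rightarrow> real"
  assumes "0 < T"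
    and "prob_space Q"
    and "filtration_upto T Q F"
    and "brownian_motion T Q F W"
    and "ito_process T Q F W \<mu> \<sigma> X"
    and "h \<in> borel_measurable (\<Pi>\<^sub>M t\<in>{0..T}. borel)"
    and "\<forall>u\<in>\<U>. girsanov_control T Q F W u"
    and "\<exists>C::real. \<forall>u\<in>\<U>. control_sup_norm T (girsanov_measure T Q F W u) u < ereal C"
    and "\<exists>r>1. integrable Q (\<lambda>\<omega>. \<bar>h (path_upto T X \<omega>)\<bar> powr r)"
    and "amis_sampling T Q F W \<U> N S \<xi> U Z"
    and "filterlim (\<lambda>k. \<Sum>l=1..k. N l) at_top sequentially"
  shows "AE s in S. (\<lambda>k. flat_amis_estimator N \<xi> Z (\<lambda>\<omega>. h (path_upto T X \<omega>)) k s)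
           \<longlonglongrightarrow> (\<integral>\<omega>. h (path_upto T X \<omega>) \<partial>Q)"
proof -
  interpret Q: prob_space Q by fact
  interpret S: prob_space S using assms(10) by (simp add: amis_sampling_def)
  define g where "g \<omega> = h (path_upto T X \<omega>)" for \<omega>
  obtain C where C: "\<And>u. u \<in> \<U> \<Longrightarrow> control_sup_norm T (girsanov_measure T Q F W u) u < ereal C"
    using assms(8) by blast
  obtain r where r: "1 < r" and g_r: "integrable Q (\<lambda>\<omega>. \<bar>g \<omega>\<bar> powr r)"
    using assms(9) unfolding g_def by blast
  have X_meas: "X t \<in> borel_measurable Q" if "t \<in> {0..T}" for t
  proof (rule measurable_from_subalg)
    show "subalgebra Q (F t)" using assms(3) that by (simp add: filtration_upto_def)
    show "X t \<in> borel_measurable (F t)" using assms(5) that by (simp add: ito_process_def)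
  qed
  have "path_upto T X \<in> Q \<rightarrow>\<^sub>M (\<Pi>\<^sub>M t\<in>{0..T}. borel)"
    unfolding path_upto_def[abs_def] by (intro measurable_restrict X_meas)
  from measurable_compose[OF this assms(6)] have g_meas[measurable]: "g \<in> borel_measurable Q"
    by (simp add: g_def[abs_def])
  have amis: "\<And>k n. 1 \<le> k \<Longrightarrow> n \<in> {1..N k} \<Longrightarrow> \<xi> k n \<in> S \<rightarrow>\<^sub>M Q"
    "\<And>k x. 1 \<le> k \<Longrightarrow> x \<in> space (history_space Q N k) \<Longrightarrow> U k x \<in> \<U> \<and> is_importance_weight T Q F W (U k x) (Z k x)"
    "\<And>k. 1 \<le> k \<Longrightarrow> (\<lambda>(x, \<omega>). Z k x \<omega>) \<in> borel_measurable (history_space Q N k \<Otimes>\<^sub>M Q)"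
    "\<And>k A. 1 \<le> k \<Longrightarrow> (\<And>n. n \<in> {1..N k} \<Longrightarrow> A n \<in> sets Q) \<Longrightarrow>
      AE s in S. real_cond_exp S (history_algebra Q N S \<xi> k)
             (indicator {s \<in> space S. \<forall>n\<in>{1..N k}. \<xi> k n s \<in> A n}) s =
           (\<Prod>n=1..N k. measure (girsanov_measure T Q F W (U k (history N \<xi> k s))) (A n))"
    using assms(10) unfolding amis_sampling_def by blast+
  have Z_slice: "Z k x \<in> borel_measurable Q" if "1 \<le> k" "x \<in> space (history_space Q N k)" for k x
  proof -
    have "(\<lambda>\<omega>. (x, \<omega>)) \<in> Q \<rightarrow>\<^sub>M (history_space Q N k \<Otimes>\<^sub>M Q)" using that by measurable
    from measurable_compose[OF this amis(3)[OF that(1)]] show ?thesis by simp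
  qed
  have weight: "AE \<omega> in Q. 0 < Z k x \<omega>"
    "girsanov_measure T Q F W (U k x) = density Q (\<lambda>\<omega>. ennreal (1 / Z k x \<omega>))"
    "(\<integral>\<^sup>+\<omega>. ennreal (Z k x \<omega>) \<partial>Q) \<le> ennreal (exp (C\<^sup>2 * T))"
    "prob_space (density Q (\<lambda>\<omega>. ennreal (1 / Z k x \<omega>)))"
    if "1 \<le> k" "x \<in> space (history_space Q N k)" for k x
  proof -
    have "U k x \<in> \<U>" "is_importance_weight T Q F W (U k x) (Z k x)" using amis(2)[OF that] by auto
    then have control: "girsanov_control T Q F W (U k x)" using assms(7) by blast
    note girsanov = girsanov_importance_weight[OF assms(2-4) assms(1) control C[OF \<open>U k x \<in> \<U>\<close>]
      \<open>is_importance_weight T Q F W (U k x) (Z k x)\<close> Z_slice[OF that]]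
    show "AE \<omega> in Q. 0 < Z k x \<omega>"
      "girsanov_measure T Q F W (U k x) = density Q (\<lambda>\<omega>. ennreal (1 / Z k x \<omega>))"
      "(\<integral>\<^sup>+\<omega>. ennreal (Z k x \<omega>) \<partial>Q) \<le> ennreal (exp (C\<^sup>2 * T))"
      by (fact girsanov)+
    then show "prob_space (density Q (\<lambda>\<omega>. ennreal (1 / Z k x \<omega>)))"
      using control by (simp add: girsanov_control_def)
  qed
  have history: "history N \<xi> k s \<in> space (history_space Q N k)" if "s \<in> space S" for k s
    using measurable_space[OF amis(1) that]
    by (auto simp: history_eq_draws draws_def history_space_def space_PiM past_def)
  interpret adaptive_sampling Q S N \<xi> Z
  proof (intro adaptive_sampling.intro adaptive_sampling_axioms.intro)
    fix k and A :: "nat \<Rightarrow> 'a set"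
    assume k: "1 \<le> k" and A: "\<And>n. n \<in> {1..N k} \<Longrightarrow> A n \<in> sets Q"
    have "AE s in S. real_cond_exp S (history_algebra Q N S \<xi> k)
             (indicator {s \<in> space S. \<forall>n\<in>{1..N k}. \<xi> k n s \<in> A n}) s =
           (\<Prod>n=1..N k. measure (girsanov_measure T Q F W (U k (history N \<xi> k s))) (A n))"
      by (rule amis(4)[OF k]) (rule A)
    then show "AE s in S. real_cond_exp S (history_algebra Q N S \<xi> k)
             (indicator {s \<in> space S. \<forall>n\<in>{1..N k}. \<xi> k n s \<in> A n}) s =
        (\<Prod>n=1..N k. measure (density Q (\<lambda>\<omega>. ennreal (1 / Z k (history N \<xi> k s) \<omega>))) (A n))"
      using AE_space by eventually_elim (simp only: weight(2)[OF k history])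
  qed (fact amis weight Q.prob_space_axioms S.prob_space_axioms)+
  define q where "q = 2 * r / (r + 1)"
  have q: "1 < q" "q \<le> 2" using r by (simp_all add: q_def field_simps)
  define K where "K = (\<integral>\<omega>. \<bar>g \<omega>\<bar> powr r \<partial>Q) + exp (C\<^sup>2 * T)"
  have total: "filterlim (total_draws N) at_top sequentially"
    using assms(11) by (simp add: total_draws_def[abs_def])
  \<comment> \<open>Nonnegative integrands dominated by \<open>\<bar>g\<bar>\<close>; they are the positive and negative part of \<open>g\<close> below.\<close>
  have part: "AE s in S. (\<lambda>k. flat_amis_estimator N \<xi> Z f k s) \<longlonglongrightarrow> (\<integral>\<omega>. f \<omega> \<partial>Q)" "integrable Q f"
    if [measurable]: "f \<in> borel_measurable Q" and f: "\<And>\<omega>. 0 \<le> f \<omega>" "\<And>\<omega>. f \<omega> \<le> \<bar>g \<omega>\<bar>" for f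
  proof -
    have f_r: "f \<omega> powr r \<le> \<bar>g \<omega>\<bar> powr r" for \<omega>
      using f[of \<omega>] r by (intro powr_mono2) auto
    show int: "integrable Q f"
    proof (rule Bochner_Integration.integrable_bound[of _ "\<lambda>\<omega>. 1 + \<bar>g \<omega>\<bar> powr r"])
      show "AE \<omega> in Q. norm (f \<omega>) \<le> norm (1 + \<bar>g \<omega>\<bar> powr r)"
      proof (rule AE_I2)
        fix \<omega>
        have "f \<omega> \<le> 1 + f \<omega> powr r"
        proof (cases "f \<omega> \<le> 1")
          case False
          then have "f \<omega> powr 1 \<le> f \<omega> powr r" using r by (intro powr_mono) auto
          then show ?thesis using False by simp
        qed (simp add: add_increasing2)
        then show "norm (f \<omega>) \<le> norm (1 + \<bar>g \<omega>\<bar> powr r)" using f[of \<omega>] f_r[of \<omega>] by simp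
      qed
    qed (use g_r in auto)
    show "AE s in S. (\<lambda>k. flat_amis_estimator N \<xi> Z f k s) \<longlonglongrightarrow> (\<integral>\<omega>. f \<omega> \<partial>Q)"
    proof (rule flat_amis_consistent_nonneg[where q = q and K = K])
      show "(\<integral>\<^sup>+\<omega>. ennreal (f \<omega>) \<partial>Q) = ennreal (\<integral>\<omega>. f \<omega> \<partial>Q)"
        using int f by (intro nn_integral_eq_integral) auto
      fix k x assume k: "1 \<le> k" and x: "x \<in> space (history_space Q N k)"
      have [measurable]: "Z k x \<in> borel_measurable Q" by (rule Z_slice[OF k x])
      have "(\<integral>\<^sup>+\<omega>. ennreal (1 / Z k x \<omega>) * ennreal ((f \<omega> * max 0 (Z k x \<omega>)) powr q) \<partial>Q)
          \<le> (\<integral>\<^sup>+\<omega>. ennreal (\<bar>g \<omega>\<bar> powr r) + ennreal (Z k x \<omega>) \<partial>Q)"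
      proof (rule nn_integral_mono_AE)
        show "AE \<omega> in Q. ennreal (1 / Z k x \<omega>) * ennreal ((f \<omega> * max 0 (Z k x \<omega>)) powr q)
            \<le> ennreal (\<bar>g \<omega>\<bar> powr r) + ennreal (Z k x \<omega>)"
          using weight(1)[OF k x]
        proof eventually_elim
          case (elim \<omega>)
          have "1 / Z k x \<omega> * (f \<omega> * Z k x \<omega>) powr q \<le> f \<omega> powr r + Z k x \<omega>"
            unfolding q_def using f elim r by (intro weighted_moment_interpolation) auto
          also have "\<dots> \<le> \<bar>g \<omega>\<bar> powr r + Z k x \<omega>" using f_r[of \<omega>] by simp
          finally show ?case using elim
            by (simp add: ennreal_mult[symmetric] ennreal_plus[symmetric] ennreal_leI del: ennreal_plus)
        qed
      qed
      also have "\<dots> = ennreal (\<integral>\<omega>. \<bar>g \<omega>\<bar> powr r \<partial>Q) + (\<integral>\<^sup>+\<omega>. ennreal (Z k x \<omega>) \<partial>Q)"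
        using g_r by (subst nn_integral_add) (simp_all add: nn_integral_eq_integral)
      also have "\<dots> \<le> ennreal (\<integral>\<omega>. \<bar>g \<omega>\<bar> powr r \<partial>Q) + ennreal (exp (C\<^sup>2 * T))"
        by (intro add_left_mono weight k x)
      also have "\<dots> = ennreal K" by (simp add: K_def)
      finally show "(\<integral>\<^sup>+\<omega>. ennreal (1 / Z k x \<omega>) * ennreal ((f \<omega> * max 0 (Z k x \<omega>)) powr q) \<partial>Q) \<le> ennreal K" .
    qed (use f q total in auto)
  qed
  define gp gm where "gp \<omega> = max 0 (g \<omega>)" and "gm \<omega> = max 0 (- g \<omega>)" for \<omega>
  have gp: "gp \<in> borel_measurable Q" "\<And>\<omega>. 0 \<le> gp \<omega>" "\<And>\<omega>. gp \<omega> \<le> \<bar>g \<omega>\<bar>"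
    and gm: "gm \<in> borel_measurable Q" "\<And>\<omega>. 0 \<le> gm \<omega>" "\<And>\<omega>. gm \<omega> \<le> \<bar>g \<omega>\<bar>"
    unfolding gp_def[abs_def] gm_def[abs_def] by auto
  have split: "g \<omega> = gp \<omega> - gm \<omega>" for \<omega> by (auto simp: gp_def gm_def)
  have estimator: "flat_amis_estimator N \<xi> Z g k s
      = flat_amis_estimator N \<xi> Z gp k s - flat_amis_estimator N \<xi> Z gm k s" for k s
    unfolding flat_amis_estimator_def split
    by (simp add: left_diff_distrib sum_subtractf diff_divide_distrib)
  have integral: "(\<integral>\<omega>. g \<omega> \<partial>Q) = (\<integral>\<omega>. gp \<omega> \<partial>Q) - (\<integral>\<omega>. gm \<omega> \<partial>Q)"
    unfolding split using part(2)[OF gp] part(2)[OF gm] by simp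
  have "AE s in S. (\<lambda>k. flat_amis_estimator N \<xi> Z g k s) \<longlonglongrightarrow> (\<integral>\<omega>. g \<omega> \<partial>Q)"
    using part(1)[OF gp] part(1)[OF gm]
    by eventually_elim (simp only: estimator integral, intro tendsto_diff)
  then show ?thesis by (simp add: g_def[abs_def])
qed

end
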